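(* Let $\mathcal C=(C,M,\operatorname{pr})$ be a regular cover with structure group $G$, and let $U\subseteq C$. Let $b=b_1b_2$ where $b_1=(b_{11},\dots,b_{1n})\in C^n$ is strongly independent in fibres over $U$ and $b_2=(b_{21},\dots,b_{2k})$ is such that for each $i=1,\dots,k$ the tuple $b_{11},\dots,b_{1n},b_{2i}$ is not strongly independent in fibres. Let $m_1=\operatorname{pr}(b_1)$, $m_2=\operatorname{pr}(b_2)$. Then there are $\emptyset$-definable finite normal subgroups $H_i\triangleleft G$ ($i=1,\dots,k$), an $\emptyset$-definable subgroup $H\le H_1\times\dots\times H_k$, and a positive quantifier-free formula $\phi(y_1,y_2)$ over $U\cup M$ such that $\models\phi(b_1,b_2)$, $H\cdot b_2=\phi(b_1,C^k)$, and $\phi(b_1,C^k)$ is an atom over $M\cup\{b_1\}\cup U$.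
   Context: Zariski structures: sets with Noetherian topologies on all Cartesian powers and a dimension function satisfying the standard Zariski-structure axioms, regarded as first-order structures with a predicate for each closed set (closed sets = positive quantifier-free definable sets) and constants naming all elements of the (prime) model. $\mathrm{loc}(b/A)$ is the smallest $A$-closed set containing $b$; an atom over $A$ is an $A$-definable set all of whose elements have the same type over $A$. A topological sort is $D/E$ with $D$ definable and $E$ a closed equivalence relation; a morphism $f:T_1\to T_2$ is a map with $f\times\mathrm{id}:T_1\times M^n\to T_2\times M^n$ continuous for all $n$. A Zariski group is a group that is a topological sort with multiplication and inversion morphisms; a morphic action is free if the orbit relation is closed and $(a,g\cdot a)\mapsto g$ is a morphism. A regular cover $\mathcal C=(C,M,\operatorname{pr})$ is a two-sorted Zariski structure with a Zariski group $G$ acting morphically and freely on $C$ by continuous bijections, $M$ a topological sort of $C$ with $\operatorname{pr}$ the $\emptyset$-definable quotient surjection, each fibre $\operatorname{pr}^{-1}(m)$ a $G$-orbit, and $G$ a Zariski group in $M$. Standing assumptions: $G$ is definably almost simple (proper definable normal subgroups are finite) and every definable normal subgroup of $G^k$ is $\emptyset$-definable; $G\subseteq M^l$ is definable in $M$; every fibre $\operatorname{pr}^{-1}(m)$ is an atom over $M$. $G^k$ acts coordinatewise on $C^k$. A tuple $b\in C^n$ with $\operatorname{pr}(b)=m$ is strongly independent in fibres over $A$ if $\mathrm{loc}(b/M\cup A)=\{c\in C^n:\operatorname{pr}(c)=m\}$ ("strongly independent" without qualification means over $\emptyset$). *)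

theory Defs
  imports
    "HOL-Analysis.Abstract_Topology"
    "HOL-Algebra.Group_Action"
    "HOL-Algebra.Product_Groups"
    "HOL-Combinatorics.Permutations"
begin

section \<open>Many-sorted Noetherian Zariski structures\<close>

text \<open>
  A tuple is a list, its signature the list of the sorts of its entries; a one-sorted structure is
  the case of a one-element type of sorts. \<open>tuples D [s\<^sub>1,\<dots>,s\<^sub>n]\<close> is \<open>D s\<^sub>1 \<times> \<dots> \<times> D s\<^sub>n\<close>.
  The projection onto the coordinates in a set \<open>I\<close> of positions is \<open>\<lambda>x. nths x I\<close>.
\<close>

definition tuples :: "('s \<Rightarrow> 'a set) \<Rightarrow> 's list \<Rightarrow> 'a list set" where
  "tuples D \<sigma> = listset (map D \<sigma>)"

definition pr_img :: "nat set \<Rightarrow> 'a list set \<Rightarrow> 'a list set" where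
  "pr_img I S = (\<lambda>x. nths x I) ` S"

definition pr_fibre :: "nat set \<Rightarrow> 'a list set \<Rightarrow> 'a list \<Rightarrow> 'a list set" where
  "pr_fibre I S a = {x \<in> S. nths x I = a}"

definition irreducible_in :: "'b topology \<Rightarrow> 'b set \<Rightarrow> bool" where
  "irreducible_in X S \<longleftrightarrow> S \<subseteq> topspace X \<and> S \<noteq> {} \<and>
     (\<forall>S1 S2. closedin (subtopology X S) S1 \<longrightarrow> closedin (subtopology X S) S2 \<longrightarrow>
        S = S1 \<union> S2 \<longrightarrow> S1 = S \<or> S2 = S)"

definition locally_closed_in :: "'b topology \<Rightarrow> 'b set \<Rightarrow> bool" where
  "locally_closed_in X S \<longleftrightarrow> (\<exists>U. openin X U \<and> closedin (subtopology X U) S)"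

definition constructible_in :: "'b topology \<Rightarrow> 'b set \<Rightarrow> bool" where
  "constructible_in X S \<longleftrightarrow>
     (\<exists>\<F>. finite \<F> \<and> (\<forall>Q\<in>\<F>. locally_closed_in X Q) \<and> S = \<Union>\<F>)"

text \<open>
  Closedness under finite unions and arbitrary intersections, and of the empty and the full set,
  is contained in the type of topologies.
\<close>

locale noetherian_topological_structure =
  fixes D :: "'s \<Rightarrow> 'a set" and T :: "'s list \<Rightarrow> 'a list topology"
  assumes topspace_eq: "topspace (T \<sigma>) = tuples D \<sigma>"
    and closed_equality: "closedin (T [s, s]) {[x, x] | x. x \<in> D s}"
    and closed_point: "x \<in> D s \<Longrightarrow> closedin (T [s]) {[x]}"
    and closed_product: "\<lbrakk>closedin (T \<sigma>) S; closedin (T \<tau>) R\<rbrakk> \<Longrightarrow>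
      closedin (T (\<sigma> @ \<tau>)) {x @ y | x y. x \<in> S \<and> y \<in> R}"
    and closed_permute: "\<lbrakk>closedin (T \<sigma>) S; \<pi> permutes {..<length \<sigma>}\<rbrakk> \<Longrightarrow>
      closedin (T (permute_list \<pi> \<sigma>)) (permute_list \<pi> ` S)"
    and closed_fibre: "\<lbrakk>closedin (T (\<sigma> @ \<tau>)) S; a \<in> tuples D \<sigma>\<rbrakk> \<Longrightarrow>
      closedin (T \<tau>) {y \<in> tuples D \<tau>. a @ y \<in> S}"
    and dcc: "\<lbrakk>\<And>i. closedin (T \<sigma>) (F i); decseq F\<rbrakk> \<Longrightarrow> \<exists>n. \<forall>m\<ge>n. F m = F n"

text \<open>
  These are Zilber's axioms: semi-properness and a good dimension. The
  dimension is only meaningful on nonempty constructible sets.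
\<close>

locale zariski_structure = noetherian_topological_structure D T
  for D :: "'s \<Rightarrow> 'a set" and T :: "'s list \<Rightarrow> 'a list topology" +
  fixes dm :: "'s list \<Rightarrow> 'a list set \<Rightarrow> nat"
  assumes semi_proper: "\<lbrakk>closedin (T \<sigma>) S; irreducible_in (T \<sigma>) S\<rbrakk> \<Longrightarrow>
      \<exists>F. closedin (T (nths \<sigma> I)) F \<and> F \<subset> T (nths \<sigma> I) closure_of pr_img I S \<and>
          T (nths \<sigma> I) closure_of pr_img I S - F \<subseteq> pr_img I S"
    and dim_point: "x \<in> tuples D \<sigma> \<Longrightarrow> dm \<sigma> {x} = 0"
    and dim_union: "\<lbrakk>constructible_in (T \<sigma>) S1; constructible_in (T \<sigma>) S2; S1 \<noteq> {}; S2 \<noteq> {}\<rbrakk> \<Longrightarrow>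
      dm \<sigma> (S1 \<union> S2) = max (dm \<sigma> S1) (dm \<sigma> S2)"
    and dim_strong_irreducibility:
      "\<lbrakk>locally_closed_in (T \<sigma>) S; irreducible_in (T \<sigma>) S;
        closedin (subtopology (T \<sigma>) S) S1; S1 \<noteq> {}; S1 \<noteq> S\<rbrakk> \<Longrightarrow> dm \<sigma> S1 < dm \<sigma> S"
    and dim_addition:
      "\<lbrakk>locally_closed_in (T \<sigma>) S; irreducible_in (T \<sigma>) S\<rbrakk> \<Longrightarrow>
        dm \<sigma> S = dm (nths \<sigma> I) (pr_img I S) + (INF a\<in>pr_img I S. dm \<sigma> (pr_fibre I S a))"
    and dim_fibre_condition:
      "\<lbrakk>locally_closed_in (T \<sigma>) S; irreducible_in (T \<sigma>) S\<rbrakk> \<Longrightarrow>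
        \<exists>V. openin (subtopology (T (nths \<sigma> I)) (pr_img I S)) V \<and> V \<noteq> {} \<and>
          (\<forall>v\<in>V. dm \<sigma> (pr_fibre I S v) = (INF a\<in>pr_img I S. dm \<sigma> (pr_fibre I S a)))"


section \<open>First-order formulas\<close>

text \<open>
  De Bruijn formulas: \<open>Var i\<close> is the \<open>i\<close>-th entry of the tuple at which a formula is evaluated, and
  \<open>Ex s\<close> prepends an element of sort \<open>s\<close>. A relation symbol is the relation it denotes, together
  with its signature.
\<close>

datatype 'a tm = Var nat | Const 'a

datatype ('s, 'a) fm =
    Eq "'a tm" "'a tm"
  | Rel "'s list" "'a list set" "'a tm list"
  | Neg "('s, 'a) fm"
  | Conj "('s, 'a) fm" "('s, 'a) fm"
  | Disj "('s, 'a) fm" "('s, 'a) fm"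
  | Ex 's "('s, 'a) fm"

fun tm_val :: "'a list \<Rightarrow> 'a tm \<Rightarrow> 'a" where
  "tm_val xs (Var i) = xs ! i"
| "tm_val xs (Const a) = a"

text \<open>
  The family \<open>D\<close> is the range of the quantifiers, so that satisfaction in a substructure of a
  structure is obtained by changing \<open>D\<close>.
\<close>

fun sat :: "('s \<Rightarrow> 'a set) \<Rightarrow> ('s, 'a) fm \<Rightarrow> 'a list \<Rightarrow> bool" where
  "sat D (Eq t u) xs \<longleftrightarrow> tm_val xs t = tm_val xs u"
| "sat D (Rel \<tau> S ts) xs \<longleftrightarrow> map (tm_val xs) ts \<in> S"
| "sat D (Neg \<phi>) xs \<longleftrightarrow> \<not> sat D \<phi> xs"
| "sat D (Conj \<phi> \<psi>) xs \<longleftrightarrow> sat D \<phi> xs \<and> sat D \<psi> xs"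
| "sat D (Disj \<phi> \<psi>) xs \<longleftrightarrow> sat D \<phi> xs \<or> sat D \<psi> xs"
| "sat D (Ex s \<phi>) xs \<longleftrightarrow> (\<exists>x\<in>D s. sat D \<phi> (x # xs))"

fun tm_has_sort :: "('s \<Rightarrow> 'a set) \<Rightarrow> 's list \<Rightarrow> 'a tm \<Rightarrow> 's \<Rightarrow> bool" where
  "tm_has_sort D \<sigma> (Var i) s \<longleftrightarrow> i < length \<sigma> \<and> \<sigma> ! i = s"
| "tm_has_sort D \<sigma> (Const a) s \<longleftrightarrow> a \<in> D s"

fun well_sorted ::
  "('s \<Rightarrow> 'a set) \<Rightarrow> ('s list \<Rightarrow> 'a list set set) \<Rightarrow> 's list \<Rightarrow> ('s, 'a) fm \<Rightarrow> bool" where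
  "well_sorted D L \<sigma> (Eq t u) \<longleftrightarrow> (\<exists>s. tm_has_sort D \<sigma> t s \<and> tm_has_sort D \<sigma> u s)"
| "well_sorted D L \<sigma> (Rel \<tau> S ts) \<longleftrightarrow> S \<in> L \<tau> \<and> list_all2 (tm_has_sort D \<sigma>) ts \<tau>"
| "well_sorted D L \<sigma> (Neg \<phi>) \<longleftrightarrow> well_sorted D L \<sigma> \<phi>"
| "well_sorted D L \<sigma> (Conj \<phi> \<psi>) \<longleftrightarrow> well_sorted D L \<sigma> \<phi> \<and> well_sorted D L \<sigma> \<psi>"
| "well_sorted D L \<sigma> (Disj \<phi> \<psi>) \<longleftrightarrow> well_sorted D L \<sigma> \<phi> \<and> well_sorted D L \<sigma> \<psi>"
| "well_sorted D L \<sigma> (Ex s \<phi>) \<longleftrightarrow> well_sorted D L (s # \<sigma>) \<phi>"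

fun tm_params :: "'a tm \<Rightarrow> 'a set" where
  "tm_params (Var i) = {}"
| "tm_params (Const a) = {a}"

fun params :: "('s, 'a) fm \<Rightarrow> 'a set" where
  "params (Eq t u) = tm_params t \<union> tm_params u"
| "params (Rel \<tau> S ts) = (\<Union>t\<in>set ts. tm_params t)"
| "params (Neg \<phi>) = params \<phi>"
| "params (Conj \<phi> \<psi>) = params \<phi> \<union> params \<psi>"
| "params (Disj \<phi> \<psi>) = params \<phi> \<union> params \<psi>"
| "params (Ex s \<phi>) = params \<phi>"

fun pos_qf :: "('s, 'a) fm \<Rightarrow> bool" where
  "pos_qf (Eq t u) \<longleftrightarrow> True"
| "pos_qf (Rel \<tau> S ts) \<longleftrightarrow> True"
| "pos_qf (Neg \<phi>) \<longleftrightarrow> False"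
| "pos_qf (Conj \<phi> \<psi>) \<longleftrightarrow> pos_qf \<phi> \<and> pos_qf \<psi>"
| "pos_qf (Disj \<phi> \<psi>) \<longleftrightarrow> pos_qf \<phi> \<and> pos_qf \<psi>"
| "pos_qf (Ex s \<phi>) \<longleftrightarrow> False"

text \<open>The sorts occurring in the relation symbols and quantifiers of a formula.\<close>

fun fm_sorts :: "('s, 'a) fm \<Rightarrow> 's set" where
  "fm_sorts (Eq t u) = {}"
| "fm_sorts (Rel \<tau> S ts) = set \<tau>"
| "fm_sorts (Neg \<phi>) = fm_sorts \<phi>"
| "fm_sorts (Conj \<phi> \<psi>) = fm_sorts \<phi> \<union> fm_sorts \<psi>"
| "fm_sorts (Disj \<phi> \<psi>) = fm_sorts \<phi> \<union> fm_sorts \<psi>"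
| "fm_sorts (Ex s \<phi>) = insert s (fm_sorts \<phi>)"


section \<open>Zariski structures as first-order structures\<close>

text \<open>
  \<open>univ\<close> are the sorts, \<open>zar\<close> the topologies (closed sets with arbitrary
  parameters) and \<open>zdim\<close> the dimension; \<open>rels\<close> are the predicates of the language, and \<open>named\<close> the
  elements named by a constant.
\<close>

record ('s, 'a) zariski =
  univ :: "'s \<Rightarrow> 'a set"
  zar :: "'s list \<Rightarrow> 'a list topology"
  zdim :: "'s list \<Rightarrow> 'a list set \<Rightarrow> nat"
  rels :: "'s list \<Rightarrow> 'a list set set"
  named :: "'s \<Rightarrow> 'a set"

definition formula_over ::
  "('s, 'a, 'z) zariski_scheme \<Rightarrow> 'a set \<Rightarrow> 's list \<Rightarrow> ('s, 'a) fm \<Rightarrow> bool" where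
  "formula_over Z A \<sigma> \<phi> \<longleftrightarrow>
     well_sorted (univ Z) (rels Z) \<sigma> \<phi> \<and> params \<phi> \<subseteq> A \<union> (\<Union>s. named Z s)"

definition solutions ::
  "('s, 'a, 'z) zariski_scheme \<Rightarrow> 's list \<Rightarrow> ('s, 'a) fm \<Rightarrow> 'a list set" where
  "solutions Z \<sigma> \<phi> = {x \<in> tuples (univ Z) \<sigma>. sat (univ Z) \<phi> x}"

definition definable_over ::
  "('s, 'a, 'z) zariski_scheme \<Rightarrow> 'a set \<Rightarrow> 's list \<Rightarrow> 'a list set \<Rightarrow> bool" where
  "definable_over Z A \<sigma> X \<longleftrightarrow> (\<exists>\<phi>. formula_over Z A \<sigma> \<phi> \<and> X = solutions Z \<sigma> \<phi>)"

definition closed_over ::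
  "('s, 'a, 'z) zariski_scheme \<Rightarrow> 'a set \<Rightarrow> 's list \<Rightarrow> 'a list set \<Rightarrow> bool" where
  "closed_over Z A \<sigma> X \<longleftrightarrow> (\<exists>\<phi>. formula_over Z A \<sigma> \<phi> \<and> pos_qf \<phi> \<and> X = solutions Z \<sigma> \<phi>)"

definition same_type_over ::
  "('s, 'a, 'z) zariski_scheme \<Rightarrow> 'a set \<Rightarrow> 's list \<Rightarrow> 'a list \<Rightarrow> 'a list \<Rightarrow> bool" where
  "same_type_over Z A \<sigma> x y \<longleftrightarrow>
     (\<forall>\<phi>. formula_over Z A \<sigma> \<phi> \<longrightarrow> sat (univ Z) \<phi> x = sat (univ Z) \<phi> y)"

definition atom_over ::
  "('s, 'a, 'z) zariski_scheme \<Rightarrow> 'a set \<Rightarrow> 's list \<Rightarrow> 'a list set \<Rightarrow> bool" where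
  "atom_over Z A \<sigma> X \<longleftrightarrow>
     definable_over Z A \<sigma> X \<and> (\<forall>x\<in>X. \<forall>y\<in>X. same_type_over Z A \<sigma> x y)"

text \<open>By Noetherianity this intersection is itself closed over \<open>A\<close>.\<close>

definition loc ::
  "('s, 'a, 'z) zariski_scheme \<Rightarrow> 'a set \<Rightarrow> 's list \<Rightarrow> 'a list \<Rightarrow> 'a list set" where
  "loc Z A \<sigma> b = \<Inter>{X. closed_over Z A \<sigma> X \<and> b \<in> X}"

text \<open>
  The language has a predicate for each closed set that does not need parameters: if there were one
  for every closed set of the structure at hand, its points would all be definable without
  parameters. For a structure that elementarily extends a Zariski structure all of whose points are
  named, the predicates are exactly the closed sets of the latter.
\<close>

definition zariski_model :: "('s, 'a, 'z) zariski_scheme \<Rightarrow> bool" where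
  "zariski_model Z \<longleftrightarrow>
     zariski_structure (univ Z) (zar Z) (zdim Z) \<and>
     (\<forall>s t. s \<noteq> t \<longrightarrow> univ Z s \<inter> univ Z t = {}) \<and>
     (\<forall>s. named Z s \<subseteq> univ Z s) \<and>
     (\<forall>\<sigma> S. closedin (zar Z \<sigma>) S \<longleftrightarrow> closed_over Z UNIV \<sigma> S) \<and>
     (\<forall>\<sigma> S. S \<in> rels Z \<sigma> \<longleftrightarrow> closedin (zar Z \<sigma>) S \<and> definable_over Z {} \<sigma> S)"

text \<open>
  A topological sort \<open>D/E\<close> with \<open>E\<close> equality is a definable set \<open>D\<close> of tuples
  of a signature \<open>\<sigma>\<close>, and \<open>D \<times> \<Prod>\<tau>\<close> carries the subspace topology of \<open>\<sigma> @ \<tau>\<close>. As the structure is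
  many-sorted, the powers in the definition of a morphism are the products \<open>\<tau>\<close> of sorts.
\<close>

definition sort_times ::
  "('s, 'a, 'z) zariski_scheme \<Rightarrow> 's list \<Rightarrow> 'a list set \<Rightarrow> 's list \<Rightarrow> 'a list topology" where
  "sort_times Z \<sigma> X \<tau> =
     subtopology (zar Z (\<sigma> @ \<tau>)) {x @ y | x y. x \<in> X \<and> y \<in> tuples (univ Z) \<tau>}"

definition morphism ::
  "('s, 'a, 'z) zariski_scheme \<Rightarrow> 's list \<Rightarrow> 'a list set \<Rightarrow> 's list \<Rightarrow> 'a list set \<Rightarrow>
     ('a list \<Rightarrow> 'a list) \<Rightarrow> bool" where
  "morphism Z \<sigma> X \<sigma>' X' f \<longleftrightarrow> f ` X \<subseteq> X' \<and>
     (\<forall>\<tau>. continuous_map (sort_times Z \<sigma> X \<tau>) (sort_times Z \<sigma>' X' \<tau>)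
        (\<lambda>z. f (take (length \<sigma>) z) @ drop (length \<sigma>) z))"

definition zariski_group ::
  "('s, 'a, 'z) zariski_scheme \<Rightarrow> 's list \<Rightarrow> 'a list monoid \<Rightarrow> bool" where
  "zariski_group Z \<sigma> G \<longleftrightarrow>
     group G \<and> definable_over Z UNIV \<sigma> (carrier G) \<and>
     morphism Z (\<sigma> @ \<sigma>) {g @ h | g h. g \<in> carrier G \<and> h \<in> carrier G} \<sigma> (carrier G)
       (\<lambda>z. take (length \<sigma>) z \<otimes>\<^bsub>G\<^esub> drop (length \<sigma>) z) \<and>
     morphism Z \<sigma> (carrier G) \<sigma> (carrier G) (\<lambda>g. inv\<^bsub>G\<^esub> g)"


section \<open>Regular covers\<close>

datatype csort = Cover | Base

text \<open>\<open>C\<close> is the sort \<open>Cover\<close> and \<open>M\<close> the sort \<open>Base\<close>; \<open>grp \<subseteq> M\<^sup>l\<close> with \<open>l = grp_len\<close>.\<close>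

record 'a cover = "(csort, 'a) zariski" +
  proj :: "'a \<Rightarrow> 'a"
  grp :: "'a list monoid"
  grp_len :: nat
  act :: "'a list \<Rightarrow> 'a \<Rightarrow> 'a"

abbreviation grp_sig :: "('a, 'z) cover_scheme \<Rightarrow> csort list" where
  "grp_sig K \<equiv> replicate (grp_len K) Base"

text \<open>
  The action is a morphism \<open>G \<times> C \<rightarrow> C\<close>. Its graph is closed by this, and it is
  required to be one of the predicates of the language, i.e. not to need parameters.
\<close>

definition morphic_action :: "('a, 'z) cover_scheme \<Rightarrow> bool" where
  "morphic_action K \<longleftrightarrow>
     group_action (grp K) (univ K Cover) (act K) \<and>
     morphism K (grp_sig K @ [Cover]) {g @ [x] | g x. g \<in> carrier (grp K) \<and> x \<in> univ K Cover}
       [Cover] (tuples (univ K) [Cover])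
       (\<lambda>z. [act K (take (grp_len K) z) (z ! grp_len K)]) \<and>
     definable_over K {} (grp_sig K @ [Cover, Cover])
       {g @ [x, act K g x] | g x. g \<in> carrier (grp K) \<and> x \<in> univ K Cover} \<and>
     (\<forall>g\<in>carrier (grp K). continuous_map (zar K [Cover]) (zar K [Cover]) (map (act K g)))"

definition orbit_relation :: "('a, 'z) cover_scheme \<Rightarrow> 'a list set" where
  "orbit_relation K = {[x, act K g x] | g x. g \<in> carrier (grp K) \<and> x \<in> univ K Cover}"

definition free_action :: "('a, 'z) cover_scheme \<Rightarrow> bool" where
  "free_action K \<longleftrightarrow>
     closedin (zar K [Cover, Cover]) (orbit_relation K) \<and>
     (\<exists>d. (\<forall>g\<in>carrier (grp K). \<forall>x\<in>univ K Cover. d [x, act K g x] = g) \<and>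
          morphism K [Cover, Cover] (orbit_relation K) (grp_sig K) (carrier (grp K)) d)"

text \<open>
  \<open>proj_at \<sigma>\<close> is the quotient map of \<open>C\<^sup>n\<close>, \<open>n = length \<sigma>\<close>, onto the product of sorts
  \<open>\<sigma>\<close>. That it is a topological quotient map for all \<open>\<sigma>\<close>, and that the fibres of \<open>proj\<close> are the
  classes of the closed equivalence relation \<open>orbit_relation\<close>, says that \<open>M\<close> is the topological
  sort of \<open>C\<close> modulo this relation.
\<close>

definition proj_at :: "('a, 'z) cover_scheme \<Rightarrow> csort list \<Rightarrow> 'a list \<Rightarrow> 'a list" where
  "proj_at K \<sigma> xs = map2 (\<lambda>s x. case s of Cover \<Rightarrow> x | Base \<Rightarrow> proj K x) \<sigma> xs"

definition regular_cover :: "('a, 'z) cover_scheme \<Rightarrow> bool" where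
  "regular_cover K \<longleftrightarrow>
     zariski_model K \<and>
     zariski_group K (grp_sig K) (grp K) \<and>
     morphic_action K \<and> free_action K \<and>
     proj K ` univ K Cover = univ K Base \<and>
     definable_over K {} [Cover, Base] {[x, proj K x] | x. x \<in> univ K Cover} \<and>
     (\<forall>\<sigma>. quotient_map (zar K (replicate (length \<sigma>) Cover)) (zar K \<sigma>) (proj_at K \<sigma>)) \<and>
     (\<forall>x\<in>univ K Cover. {y \<in> univ K Cover. proj K y = proj K x} = orbit (grp K) (act K) x)"

text \<open>
  Elements \<open>g\<close> of the product of \<open>k\<close> copies of \<open>G\<close> are extensional functions on \<open>{..<k}\<close>; definability
  of subsets refers to the concatenated tuples \<open>g 0 @ \<dots> @ g (k - 1)\<close> in \<open>M\<^sup>k\<^sup>l\<close>.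
\<close>

definition grp_power :: "('a, 'z) cover_scheme \<Rightarrow> nat \<Rightarrow> (nat \<Rightarrow> 'a list) monoid" where
  "grp_power K k = product_group {..<k} (\<lambda>_. grp K)"

definition power_definable_over ::
  "('a, 'z) cover_scheme \<Rightarrow> 'a set \<Rightarrow> nat \<Rightarrow> (nat \<Rightarrow> 'a list) set \<Rightarrow> bool" where
  "power_definable_over K A k N \<longleftrightarrow>
     definable_over K A (replicate (k * grp_len K) Base) ((\<lambda>g. concat (map g [0..<k])) ` N)"

definition power_act :: "('a, 'z) cover_scheme \<Rightarrow> (nat \<Rightarrow> 'a list) \<Rightarrow> 'a list \<Rightarrow> 'a list" where
  "power_act K g b = map (\<lambda>i. act K (g i) (b ! i)) [0..<length b]"

definition definably_almost_simple :: "('a, 'z) cover_scheme \<Rightarrow> bool" where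
  "definably_almost_simple K \<longleftrightarrow>
     (\<forall>N. N \<lhd> grp K \<longrightarrow> definable_over K UNIV (grp_sig K) N \<longrightarrow> N \<noteq> carrier (grp K) \<longrightarrow> finite N)"

text \<open>Definable in the structure \<open>M\<close> means by a formula that speaks about the sort \<open>M\<close> only.\<close>

definition definable_in_base :: "('a, 'z) cover_scheme \<Rightarrow> nat \<Rightarrow> 'a list set \<Rightarrow> bool" where
  "definable_in_base K n X \<longleftrightarrow>
     (\<exists>\<phi>. formula_over K (univ K Base) (replicate n Base) \<phi> \<and> fm_sorts \<phi> \<subseteq> {Base} \<and>
        X = solutions K (replicate n Base) \<phi>)"

text \<open>
  The named elements of \<open>M\<close> form an elementary substructure of \<open>M\<close>, the prime model. Nothing is
  assumed about named elements of \<open>C\<close>: as the fibres are atoms over \<open>M\<close>, naming an element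
  of \<open>C\<close> turns its fibre into a singleton and hence makes \<open>G\<close> trivial.
\<close>

definition base_prime_model_named :: "('a, 'z) cover_scheme \<Rightarrow> bool" where
  "base_prime_model_named K \<longleftrightarrow>
     (\<forall>n \<phi>. formula_over K {} (replicate n Base) \<phi> \<longrightarrow> fm_sorts \<phi> \<subseteq> {Base} \<longrightarrow>
        (\<forall>x\<in>tuples (named K) (replicate n Base). sat (named K) \<phi> x = sat (univ K) \<phi> x))"

definition standing_assumptions :: "('a, 'z) cover_scheme \<Rightarrow> bool" where
  "standing_assumptions K \<longleftrightarrow>
     base_prime_model_named K \<and>
     definably_almost_simple K \<and>
     (\<forall>k N. N \<lhd> grp_power K k \<longrightarrow> power_definable_over K UNIV k N \<longrightarrow>
        power_definable_over K {} k N) \<and>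
     definable_in_base K (grp_len K) (carrier (grp K)) \<and>
     (\<forall>m\<in>univ K Base. atom_over K (univ K Base) [Cover] {[x] | x. x \<in> univ K Cover \<and> proj K x = m})"

definition strongly_independent :: "('a, 'z) cover_scheme \<Rightarrow> 'a set \<Rightarrow> 'a list \<Rightarrow> bool" where
  "strongly_independent K A b \<longleftrightarrow>
     loc K (univ K Base \<union> A) (replicate (length b) Cover) b =
       {c \<in> tuples (univ K) (replicate (length b) Cover). map (proj K) c = map (proj K) b}"

end

(*
  The locus L of b2 over M, b1 and U is a single orbit of its stabiliser in G^k: translates of closed
  sets over M are closed over M, and a locus is minimal. To bound the stabiliser coordinate by
  coordinate, consider the locus of (b1, b2_i) over M and its stabiliser R in G^(n+1). As the fibre of
  b2_i is an atom over M, R projects onto the last factor G, so the kernel of the projection of R to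
  G^n is a normal subgroup of G. It is proper because b1 is strongly independent but (b1, b2_i) is not,
  hence finite. So the stabiliser of L is a finite set of tuples from the finite subset
  H_1 x ... x H_k, whose entries lie in the prime model.

  Passing from closed sets to types needs quantifier elimination: projections of constructible sets
  are constructible by the axioms on dimension, so every definable set is constructible; closures of
  0-definable sets are 0-definable, so 0-definable sets are Boolean combinations of predicates.
*)

theory Submission
  imports Defs
begin

section \<open>Noetherian topologies and constructible sets\<close>

text \<open>The predicates of the language are the closed sets definable without parameters, while a
  decomposition into locally closed pieces may use any parameters. Constructibility alone therefore
  does not eliminate quantifiers over the empty set. Instead a 0-definable set is peeled: its
  closure is a predicate, and what the closure adds is again 0-definable, with a smaller closure.
  Translation stays over \<open>M\<close> because \<open>G\<close> lies in a power of
  \<open>M\<close>, so that a group element can enter a formula as a parameter. If \<open>g\<close>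
  moves the base point into its locus \<open>L\<close>, minimality only yields
  \<open>g L \<subseteq> L\<close>; the descending chain condition turns this inclusion into an
  equality, and so makes these \<open>g\<close> a group. No formula is written down that describes
  \<open>H\<close> structurally. Each finite \<open>H_i\<close> is 0-definable by the hypothesis on
  normal subgroups. Its unnamed points would form a 0-definable set, which would have a named point
  if it were nonempty. Hence all points of \<open>H_i\<close> are named, and \<open>H\<close> can be
  listed point by point.\<close>

lemma locally_closed_in_iff:
  "locally_closed_in X S \<longleftrightarrow> (\<exists>U C. openin X U \<and> closedin X C \<and> S = U \<inter> C)"
  unfolding locally_closed_in_def closedin_subtopology by blast

lemma constructible_in_locally_closed: "locally_closed_in X S \<Longrightarrow> constructible_in X S"
  unfolding constructible_in_def by (rule exI[of _ "{S}"]) auto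

lemma locally_closed_in_Int:
  "locally_closed_in X S \<Longrightarrow> locally_closed_in X R \<Longrightarrow> locally_closed_in X (S \<inter> R)"
  unfolding locally_closed_in_iff
proof (elim exE conjE)
  fix U C V E assume "openin X U" "closedin X C" "S = U \<inter> C" "openin X V" "closedin X E" "R = V \<inter> E"
  then show "\<exists>W F. openin X W \<and> closedin X F \<and> S \<inter> R = W \<inter> F"
    by (intro exI[of _ "U \<inter> V"] exI[of _ "C \<inter> E"]) auto
qed

lemma locally_closed_in_closedin: "closedin X S \<Longrightarrow> locally_closed_in X S"
  unfolding locally_closed_in_iff by (metis closedin_subset inf.absorb2 openin_topspace)

lemma constructible_in_closedin: "closedin X S \<Longrightarrow> constructible_in X S"
  by (simp add: constructible_in_locally_closed locally_closed_in_closedin)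

lemma constructible_in_diff: "closedin X S \<Longrightarrow> closedin X R \<Longrightarrow> constructible_in X (S - R)"
  by (rule constructible_in_locally_closed, unfold locally_closed_in_iff,
      rule exI[of _ "topspace X - R"], rule exI[of _ S])
    (auto dest: closedin_subset)

lemma constructible_in_Un:
  assumes "constructible_in X S" "constructible_in X R"
  shows "constructible_in X (S \<union> R)"
proof -
  obtain \<F> \<G> where F: "finite \<F>" "\<forall>Q\<in>\<F>. locally_closed_in X Q" "S = \<Union>\<F>"
    and G: "finite \<G>" "\<forall>Q\<in>\<G>. locally_closed_in X Q" "R = \<Union>\<G>"
    using assms unfolding constructible_in_def by (elim exE conjE) (rule that)
  show ?thesis unfolding constructible_in_def F(3) G(3)
    by (rule exI[of _ "\<F> \<union> \<G>"]) (use F(1,2) G(1,2) in auto)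
qed

lemma constructible_in_Union:
  "finite \<F> \<Longrightarrow> \<forall>S\<in>\<F>. constructible_in X S \<Longrightarrow> constructible_in X (\<Union>\<F>)"
  by (induction \<F> rule: finite_induct) (auto simp: constructible_in_closedin constructible_in_Un)

lemma constructible_in_Int:
  assumes "constructible_in X S" "constructible_in X R"
  shows "constructible_in X (S \<inter> R)"
proof -
  obtain \<F> \<G> where F: "finite \<F>" "\<forall>Q\<in>\<F>. locally_closed_in X Q" "S = \<Union>\<F>"
    and G: "finite \<G>" "\<forall>Q\<in>\<G>. locally_closed_in X Q" "R = \<Union>\<G>"
    using assms unfolding constructible_in_def by (elim exE conjE) (rule that)
  have "S \<inter> R = \<Union>((\<lambda>(P, Q). P \<inter> Q) ` (\<F> \<times> \<G>))" using F(3) G(3) by auto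
  moreover have "constructible_in X \<dots>"
    using F G by (intro constructible_in_Union)
      (auto intro!: constructible_in_locally_closed locally_closed_in_Int)
  ultimately show ?thesis by simp
qed

lemma constructible_in_Compl:
  assumes "constructible_in X S"
  shows "constructible_in X (topspace X - S)"
proof -
  have "constructible_in X (topspace X - \<Union>\<F>)"
    if "finite \<F>" "\<forall>Q\<in>\<F>. locally_closed_in X Q" for \<F>
    using that
  proof (induction \<F> rule: finite_induct)
    case empty
    then show ?case by (simp add: constructible_in_closedin)
  next
    case (insert Q \<F>)
    then obtain U C where Q: "openin X U" "closedin X C" "Q = U \<inter> C"
      unfolding locally_closed_in_iff by auto
    have "constructible_in X ((topspace X - U) \<union> (topspace X - C))"
      using Q by (intro constructible_in_Un constructible_in_closedin constructible_in_diff) auto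
    moreover have "topspace X - \<Union>(insert Q \<F>) =
        ((topspace X - U) \<union> (topspace X - C)) \<inter> (topspace X - \<Union>\<F>)"
      using Q by auto
    ultimately show ?case using insert by (simp add: constructible_in_Int)
  qed
  with assms show ?thesis unfolding constructible_in_def[of X S] by (elim exE conjE) simp
qed

text \<open>Each \<open>N\<close> is nowhere dense in \<open>Y\<close>. Induction removes one set at
  a time, since \<open>V - N\<close> is again open and still meets \<open>Y\<close>.\<close>

lemma openin_Int_nowhere_dense_Union:
  assumes "finite \<N>" "\<forall>N\<in>\<N>. closedin X N"
    and "\<And>N V. N \<in> \<N> \<Longrightarrow> openin X V \<Longrightarrow> V \<inter> Y \<noteq> {} \<Longrightarrow> V \<inter> Y - N \<noteq> {}"
    and "openin X V" "V \<inter> Y \<noteq> {}"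
  shows "V \<inter> Y - \<Union>\<N> \<noteq> {}"
  using assms
proof (induction \<N> arbitrary: V rule: finite_induct)
  case (insert N \<N>)
  have "V \<inter> Y - N \<noteq> {}" using insert.prems by blast
  then have "(V - N) \<inter> Y \<noteq> {}" by blast
  moreover have "openin X (V - N)" using insert.prems by (simp add: openin_diff)
  ultimately have "(V - N) \<inter> Y - \<Union>\<N> \<noteq> {}" using insert by simp
  then show ?case by blast
qed simp

text \<open>A locally closed piece \<open>Q\<close> is open in its closure, so the frontier
  \<open>N Q\<close> is closed. It is nowhere dense in the closure of \<open>S\<close>, because an
  open set meeting the closure of \<open>Q\<close> meets \<open>Q\<close>. Finitely many such
  frontiers cover the frontier of \<open>S\<close> and cannot fill its closure. This strict decrease
  drives \<open>definable_induct\<close>.\<close>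

lemma closure_of_frontier_constructible:
  assumes S: "constructible_in X S" "S \<noteq> {}"
  shows "X closure_of (X closure_of S - S) \<subset> X closure_of S"
proof -
  obtain \<F> where F: "finite \<F>" "\<forall>Q\<in>\<F>. locally_closed_in X Q" "S = \<Union>\<F>"
    using S(1) unfolding constructible_in_def by (elim exE conjE) (rule that)
  define N where "N Q = X closure_of Q - Q" for Q
  have sub: "Q \<subseteq> X closure_of Q" if "Q \<in> \<F>" for Q
    using F(2) that unfolding locally_closed_in_iff
    by (metis closedin_subset closure_of_subset inf.coboundedI2)
  have cN: "closedin X (N Q)" if Q: "Q \<in> \<F>" for Q
  proof -
    obtain U C where UC: "openin X U" "closedin X C" "Q = U \<inter> C"
      using F(2) Q unfolding locally_closed_in_iff by metis
    have "X closure_of Q \<subseteq> C" using UC by (simp add: closure_of_minimal)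
    then have "N Q = X closure_of Q - U" unfolding N_def using UC sub[OF Q] by blast
    then show ?thesis using UC by (simp add: closedin_diff)
  qed
  have nd: "V \<inter> (X closure_of S) - N Q \<noteq> {}"
    if "Q \<in> \<F>" "openin X V" "V \<inter> (X closure_of S) \<noteq> {}" for Q V
  proof (cases "V \<inter> X closure_of Q = {}")
    case True
    then show ?thesis using that unfolding N_def by blast
  next
    case False
    then have "V \<inter> Q \<noteq> {}" using that(2) openin_Int_closure_of_eq_empty by blast
    moreover have "Q \<subseteq> X closure_of S" using sub[OF that(1)] closure_of_mono[of Q S X] F(3) that(1) by blast
    ultimately show ?thesis unfolding N_def by blast
  qed
  have ne: "topspace X \<inter> X closure_of S \<noteq> {}"
  proof -
    have "S \<subseteq> X closure_of S" using sub F(3) closure_of_mono[of _ S X] by blast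
    then show ?thesis using S(2) closure_of_subset_topspace[of X S] by blast
  qed
  have cl: "X closure_of S = (\<Union>Q\<in>\<F>. X closure_of Q)"
    unfolding F(3) using F(1) by (rule closure_of_Union)
  have 1: "X closure_of S - \<Union>(N ` \<F>) \<noteq> {}"
  proof -
    have "topspace X \<inter> X closure_of S - \<Union>(N ` \<F>) \<noteq> {}"
    proof (rule openin_Int_nowhere_dense_Union[of "N ` \<F>" X])
      show "V \<inter> X closure_of S - M \<noteq> {}"
        if "M \<in> N ` \<F>" "openin X V" "V \<inter> X closure_of S \<noteq> {}" for M V
        using nd that by auto
    qed (use F(1) cN ne in auto)
    then show ?thesis by auto
  qed
  have "X closure_of S - S \<subseteq> \<Union>(N ` \<F>)" using cl F(3) unfolding N_def by blast
  then have "X closure_of (X closure_of S - S) \<subseteq> \<Union>(N ` \<F>)"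
    using F(1) cN by (intro closure_of_minimal closedin_Union) auto
  moreover have "X closure_of (X closure_of S - S) \<subseteq> X closure_of S"
    by (rule closure_of_minimal) auto
  ultimately show ?thesis using 1 by blast
qed

lemma irreducible_in_closed_cover:
  assumes "irreducible_in X C" "closedin X C" "finite \<F>" "\<forall>F\<in>\<F>. closedin X F" "C \<subseteq> \<Union>\<F>"
  shows "\<exists>F\<in>\<F>. C \<subseteq> F"
  using assms(3-5)
proof (induction \<F> rule: finite_induct)
  case empty
  then show ?case using assms(1) unfolding irreducible_in_def by auto
next
  case (insert F \<F>)
  have 1: "closedin (subtopology X C) (C \<inter> F)" "closedin (subtopology X C) (C \<inter> \<Union>\<F>)"
    using insert assms(2) by (auto simp: closedin_closed_subtopology intro!: closedin_Int closedin_Union)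
  have 2: "C = (C \<inter> F) \<union> (C \<inter> \<Union>\<F>)" using insert by auto
  have "C \<inter> F = C \<or> C \<inter> \<Union>\<F> = C"
    using assms(1)[unfolded irreducible_in_def] 1 2 by blast
  then show ?case
  proof
    assume "C \<inter> \<Union>\<F> = C" then show ?case using insert by auto
  qed auto
qed

lemma irreducible_in_closure_of_continuous_image:
  assumes C: "irreducible_in X C" "closedin X C" and f: "continuous_map X Y f"
  shows "irreducible_in Y (Y closure_of (f ` C))"
proof -
  have im: "f ` C \<subseteq> topspace Y"
    using C f closedin_subset[of X C] by (auto simp: continuous_map_def Pi_iff)
  have ne: "C \<noteq> {}" using C unfolding irreducible_in_def by auto
  show ?thesis unfolding irreducible_in_def
  proof (intro conjI allI impI)
    show "Y closure_of f ` C \<subseteq> topspace Y" by (rule closure_of_subset_topspace)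
    show "Y closure_of f ` C \<noteq> {}" using im ne closure_of_subset[of "f ` C" Y] by auto
    fix S1 S2
    assume cl: "closedin (subtopology Y (Y closure_of f ` C)) S1"
      "closedin (subtopology Y (Y closure_of f ` C)) S2"
      and eq: "Y closure_of f ` C = S1 \<union> S2"
    have c: "closedin Y S1" "closedin Y S2" using cl by (auto simp: closedin_closed_subtopology)
    let ?p = "\<lambda>S. {x \<in> topspace X. f x \<in> S}"
    have "C \<subseteq> \<Union>{?p S1, ?p S2}"
      using eq closure_of_subset[OF im] closedin_subset[OF C(2)] by auto
    then have "\<exists>F\<in>{?p S1, ?p S2}. C \<subseteq> F"
      using c f by (intro irreducible_in_closed_cover[OF C]) (auto intro: closedin_continuous_map_preimage)
    then have "f ` C \<subseteq> S1 \<or> f ` C \<subseteq> S2" by auto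
    then have "Y closure_of f ` C \<subseteq> S1 \<or> Y closure_of f ` C \<subseteq> S2"
      using c closure_of_minimal by metis
    then show "S1 = Y closure_of f ` C \<or> S2 = Y closure_of f ` C" using eq by blast
  qed
qed

section \<open>Tuples of a given signature\<close>

lemma tuples_Nil [simp]: "tuples D [] = {[]}"
  by (simp add: tuples_def)

lemma Cons_in_tuples [simp]: "x # xs \<in> tuples D (s # \<sigma>) \<longleftrightarrow> x \<in> D s \<and> xs \<in> tuples D \<sigma>"
  by (simp add: tuples_def set_Cons_def)

lemma tuples_Cons: "tuples D (s # \<sigma>) = {x # xs | x xs. x \<in> D s \<and> xs \<in> tuples D \<sigma>}"
  by (simp add: tuples_def set_Cons_def)

lemma tuples_iff: "x \<in> tuples D \<sigma> \<longleftrightarrow> length x = length \<sigma> \<and> (\<forall>i<length \<sigma>. x ! i \<in> D (\<sigma> ! i))"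
proof (induction \<sigma> arbitrary: x)
  case (Cons s \<sigma>)
  then show ?case by (cases x) (auto simp: tuples_Cons All_less_Suc2)
qed auto

lemma length_tuples: "x \<in> tuples D \<sigma> \<Longrightarrow> length x = length \<sigma>"
  by (simp add: tuples_iff)

lemma append_in_tuples:
  "length x = length \<sigma> \<Longrightarrow> x @ y \<in> tuples D (\<sigma> @ \<tau>) \<longleftrightarrow> x \<in> tuples D \<sigma> \<and> y \<in> tuples D \<tau>"
proof (induction \<sigma> arbitrary: x)
  case (Cons s \<sigma>)
  then show ?case by (cases x) auto
qed auto

lemma append_in_tuplesI:
  "x \<in> tuples D \<sigma> \<Longrightarrow> y \<in> tuples D \<tau> \<Longrightarrow> x @ y \<in> tuples D (\<sigma> @ \<tau>)"
  by (simp add: append_in_tuples length_tuples)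

lemma tuples_appendE:
  assumes "z \<in> tuples D (\<sigma> @ \<tau>)"
  obtains x y where "z = x @ y" "x \<in> tuples D \<sigma>" "y \<in> tuples D \<tau>"
proof (rule that)
  show "z = take (length \<sigma>) z @ drop (length \<sigma>) z" by simp
  have "length (take (length \<sigma>) z) = length \<sigma>" using length_tuples[OF assms] by simp
  then show "take (length \<sigma>) z \<in> tuples D \<sigma>" "drop (length \<sigma>) z \<in> tuples D \<tau>"
    using append_in_tuples[of "take (length \<sigma>) z" \<sigma> "drop (length \<sigma>) z" D \<tau>] assms by auto
qed

section \<open>Noetherian induction, irreducible components and the first projection\<close>

context noetherian_topological_structure
begin

lemma wf_closed: "wf {(A, B). closedin (T \<sigma>) A \<and> closedin (T \<sigma>) B \<and> A \<subset> B}"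
proof (unfold wf_iff_no_infinite_down_chain, rule notI, elim exE)
  fix f assume f: "\<forall>i. (f (Suc i), f i) \<in> {(A, B). closedin (T \<sigma>) A \<and> closedin (T \<sigma>) B \<and> A \<subset> B}"
  then have "decseq f" by (auto intro!: decseq_SucI)
  moreover have "\<And>i. closedin (T \<sigma>) (f i)" using f by blast
  ultimately obtain n where n: "\<forall>m\<ge>n. f m = f n" using dcc by blast
  have "f (Suc n) = f n" by (rule n[rule_format]) simp
  then show False using f by auto
qed

lemma closed_induct [consumes 1, case_names closed]:
  assumes "closedin (T \<sigma>) C"
    and "\<And>C. closedin (T \<sigma>) C \<Longrightarrow> (\<And>C'. closedin (T \<sigma>) C' \<Longrightarrow> C' \<subset> C \<Longrightarrow> P C') \<Longrightarrow> P C"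
  shows "P C"
  using assms(1)
proof (induction C rule: wf_induct_rule[OF wf_closed[of \<sigma>]])
  case (1 C)
  then show ?case using assms(2)[of C] by blast
qed

lemma irreducible_decomposition:
  assumes "closedin (T \<sigma>) C"
  shows "\<exists>\<F>. finite \<F> \<and> (\<forall>F\<in>\<F>. closedin (T \<sigma>) F \<and> irreducible_in (T \<sigma>) F) \<and> C = \<Union>\<F>"
  using assms
proof (induction rule: closed_induct)
  case (closed C)
  show ?case
  proof (cases "C = {} \<or> irreducible_in (T \<sigma>) C")
    case True
    then show ?thesis
    proof
      assume "C = {}" then show ?thesis by (intro exI[of _ "{}"]) auto
    next
      assume "irreducible_in (T \<sigma>) C"
      then show ?thesis using closed by (intro exI[of _ "{C}"]) auto
    qed
  next
    case False
    then obtain S1 S2 where S: "closedin (subtopology (T \<sigma>) C) S1" "closedin (subtopology (T \<sigma>) C) S2"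
      "C = S1 \<union> S2" "S1 \<noteq> C" "S2 \<noteq> C"
      unfolding irreducible_in_def using closedin_subset[OF closed(1)] by blast
    have c: "closedin (T \<sigma>) S1" "closedin (T \<sigma>) S2"
      using S closed(1) by (auto simp: closedin_closed_subtopology)
    have p: "S1 \<subset> C" "S2 \<subset> C" using S by auto
    obtain \<F> where F: "finite \<F>" "\<forall>F\<in>\<F>. closedin (T \<sigma>) F \<and> irreducible_in (T \<sigma>) F" "S1 = \<Union>\<F>"
      using closed(2)[OF c(1) p(1)] by (elim exE conjE) (rule that)
    obtain \<G> where G: "finite \<G>" "\<forall>F\<in>\<G>. closedin (T \<sigma>) F \<and> irreducible_in (T \<sigma>) F" "S2 = \<Union>\<G>"
      using closed(2)[OF c(2) p(2)] by (elim exE conjE) (rule that)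
    show ?thesis by (intro exI[of _ "\<F> \<union> \<G>"]) (use F G S in blast)
  qed
qed

lemma closed_singleton: "a \<in> tuples D \<sigma> \<Longrightarrow> closedin (T \<sigma>) {a}"
proof (induction \<sigma> arbitrary: a)
  case Nil
  then show ?case using topspace_eq[of "[]"] closedin_topspace[of "T []"] by simp
next
  case (Cons s \<sigma>)
  then obtain x xs where a: "a = x # xs" "x \<in> D s" "xs \<in> tuples D \<sigma>" by (auto simp: tuples_Cons)
  have "closedin (T ([s] @ \<sigma>)) {u @ v | u v. u \<in> {[x]} \<and> v \<in> {xs}}"
    using a Cons.IH by (intro closed_product closed_point)
  then show ?case using a by simp
qed

lemma continuous_map_tl: "continuous_map (T (s # \<sigma>)) (T \<sigma>) tl"
  unfolding continuous_map_closedin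
proof (intro conjI allI impI Pi_I)
  fix x assume "x \<in> topspace (T (s # \<sigma>))"
  then show "tl x \<in> topspace (T \<sigma>)" by (auto simp: topspace_eq tuples_Cons)
next
  fix F assume F: "closedin (T \<sigma>) F"
  have "closedin (T [s]) (tuples D [s])" using closedin_topspace[of "T [s]"] by (simp add: topspace_eq)
  then have "closedin (T ([s] @ \<sigma>)) {u @ v | u v. u \<in> tuples D [s] \<and> v \<in> F}"
    using F by (rule closed_product)
  moreover have "{u @ v | u v. u \<in> tuples D [s] \<and> v \<in> F} = {x \<in> topspace (T (s # \<sigma>)). tl x \<in> F}"
  proof (intro equalityI subsetI)
    fix x assume "x \<in> {u @ v | u v. u \<in> tuples D [s] \<and> v \<in> F}"
    then show "x \<in> {x \<in> topspace (T (s # \<sigma>)). tl x \<in> F}"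
      using closedin_subset[OF F] unfolding topspace_eq tuples_Cons[of D s] by auto
  next
    fix x assume "x \<in> {x \<in> topspace (T (s # \<sigma>)). tl x \<in> F}"
    then obtain d v where "x = [d] @ v" "d \<in> D s" "v \<in> F" by (auto simp: topspace_eq tuples_Cons)
    then show "x \<in> {u @ v | u v. u \<in> tuples D [s] \<and> v \<in> F}"
      by (intro CollectI exI[of _ "[d]"] exI[of _ v]) simp
  qed
  ultimately show "closedin (T (s # \<sigma>)) {x \<in> topspace (T (s # \<sigma>)). tl x \<in> F}" by simp
qed

end

text \<open>\<open>Ex\<close> prepends its variable, so eliminating it means forgetting the first
  coordinate. This equation turns the axioms on coordinate projections into statements about
  \<open>tl\<close>.\<close>

lemma nths_atLeast_Suc_0: "nths xs {Suc 0..} = tl xs"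
proof -
  have "{j. Suc j \<in> {Suc 0..}} = UNIV" by auto
  then show ?thesis by (cases xs) (simp_all add: nths_Cons nths_all)
qed

section \<open>Chevalley's theorem: projections of constructible sets\<close>

context zariski_structure
begin

lemma semi_proper_tl:
  "closedin (T (s # \<sigma>)) S \<Longrightarrow> irreducible_in (T (s # \<sigma>)) S \<Longrightarrow>
    \<exists>F. closedin (T \<sigma>) F \<and> F \<subset> T \<sigma> closure_of tl ` S \<and> T \<sigma> closure_of tl ` S - F \<subseteq> tl ` S"
  using semi_proper[of "s # \<sigma>" S "{Suc 0..}"] by (simp add: pr_img_def nths_atLeast_Suc_0)

lemma dim_addition_tl:
  "locally_closed_in (T (s # \<sigma>)) S \<Longrightarrow> irreducible_in (T (s # \<sigma>)) S \<Longrightarrow>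
    dm (s # \<sigma>) S = dm \<sigma> (tl ` S) + (INF a\<in>tl ` S. dm (s # \<sigma>) {x \<in> S. tl x = a})"
  using dim_addition[of "s # \<sigma>" S "{Suc 0..}"]
  by (simp add: pr_img_def nths_atLeast_Suc_0 pr_fibre_def)

lemma dim_fibre_condition_tl:
  "locally_closed_in (T (s # \<sigma>)) S \<Longrightarrow> irreducible_in (T (s # \<sigma>)) S \<Longrightarrow>
    \<exists>V. openin (subtopology (T \<sigma>) (tl ` S)) V \<and> V \<noteq> {} \<and>
      (\<forall>v\<in>V. dm (s # \<sigma>) {x \<in> S. tl x = v} = (INF a\<in>tl ` S. dm (s # \<sigma>) {x \<in> S. tl x = a}))"
  using dim_fibre_condition[of "s # \<sigma>" S "{Suc 0..}"]
  by (simp add: pr_img_def nths_atLeast_Suc_0 pr_fibre_def)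

text \<open>The addition formula measures the image of a projection, whereas components are compared
  through the closures of their images; this identifies the two dimensions. A nonempty
  \<open>F\<close> has smaller dimension than \<open>B\<close> by strong irreducibility, so
  \<open>B - F\<close> has that of \<open>B\<close>, and \<open>W\<close> lies in between.\<close>

lemma dim_dense_constructible:
  assumes "closedin (T \<sigma>) B" "irreducible_in (T \<sigma>) B" "closedin (T \<sigma>) F" "F \<subset> B"
    and "constructible_in (T \<sigma>) W" "B - F \<subseteq> W" "W \<subseteq> B"
  shows "dm \<sigma> W = dm \<sigma> B"
proof -
  have ne: "B - F \<noteq> {}" "W \<noteq> {}" "B \<noteq> {}" using assms by auto
  have cB: "constructible_in (T \<sigma>) B" "constructible_in (T \<sigma>) (B - F)"
    using assms by (auto intro: constructible_in_closedin constructible_in_diff)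
  have "dm \<sigma> (B - F) = dm \<sigma> B"
  proof (cases "F = {}")
    case False
    have "dm \<sigma> F < dm \<sigma> B"
      using assms False
      by (intro dim_strong_irreducibility) (auto simp: closedin_closed_subtopology intro: locally_closed_in_closedin)
    moreover have "dm \<sigma> ((B - F) \<union> F) = max (dm \<sigma> (B - F)) (dm \<sigma> F)"
      using cB ne False assms by (intro dim_union) (auto intro: constructible_in_closedin)
    moreover have "(B - F) \<union> F = B" using assms by auto
    ultimately show ?thesis by auto
  qed simp
  moreover have "dm \<sigma> ((B - F) \<union> W) = max (dm \<sigma> (B - F)) (dm \<sigma> W)"
    using cB ne assms by (intro dim_union) auto
  moreover have "dm \<sigma> (W \<union> B) = max (dm \<sigma> W) (dm \<sigma> B)"
    using cB ne assms by (intro dim_union) auto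
  moreover have "(B - F) \<union> W = W" "W \<union> B = B" using assms by auto
  ultimately show ?thesis by auto
qed

text \<open>The bound is asked of nonempty members only, as the axioms leave the dimension of the
  empty set open.\<close>

lemma dim_Union_less:
  assumes "finite \<F>" "\<forall>F\<in>\<F>. closedin (T \<sigma>) F" "\<forall>F\<in>\<F>. F \<noteq> {} \<longrightarrow> dm \<sigma> F < r" "\<Union>\<F> \<noteq> {}"
  shows "dm \<sigma> (\<Union>\<F>) < r"
  using assms
proof (induction \<F> rule: finite_induct)
  case (insert F \<F>)
  show ?case
  proof (cases "F = {} \<or> \<Union>\<F> = {}")
    case True
    then show ?thesis
    proof
      assume "F = {}" then show ?thesis using insert by simp
    next
      assume "\<Union>\<F> = {}" then show ?thesis using insert.prems by (simp only: Union_insert) simp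
    qed
  next
    case False
    have "dm \<sigma> (F \<union> \<Union>\<F>) = max (dm \<sigma> F) (dm \<sigma> (\<Union>\<F>))"
      using insert False by (intro dim_union constructible_in_closedin closedin_Union) auto
    then show ?thesis using insert False by simp
  qed
qed simp

text \<open>
  A point of \<open>B\<close> outside \<open>tl ` (C - E)\<close> has a fibre in \<open>C\<close> covered by \<open>E\<close>. The components of \<open>E\<close> that
  dominate \<open>B\<close> have smaller dimension than \<open>C\<close>, hence smaller generic fibres.
\<close>

lemma projection_contains_open:
  assumes C: "closedin (T (s # \<sigma>)) C" "irreducible_in (T (s # \<sigma>)) C"
    and E: "closedin (T (s # \<sigma>)) E" "\<not> C \<subseteq> E"
    and IH: "\<And>C'. closedin (T (s # \<sigma>)) C' \<Longrightarrow> C' \<subset> C \<Longrightarrow> constructible_in (T \<sigma>) (tl ` C')"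
  shows "\<exists>F. closedin (T \<sigma>) F \<and> F \<subset> T \<sigma> closure_of tl ` C \<and> T \<sigma> closure_of tl ` C - F \<subseteq> tl ` (C - E)"
proof -
  define B where "B = T \<sigma> closure_of tl ` C"
  have B: "closedin (T \<sigma>) B" "irreducible_in (T \<sigma>) B"
    unfolding B_def using irreducible_in_closure_of_continuous_image[OF C(2,1) continuous_map_tl] by auto
  have tlC: "tl ` C \<subseteq> topspace (T \<sigma>)"
    using closedin_subset[OF C(1)] continuous_map_tl[of s \<sigma>] by (auto simp: continuous_map_def Pi_iff)
  have CB: "tl ` C \<subseteq> B" unfolding B_def using tlC by (rule closure_of_subset)
  have pre: "closedin (T (s # \<sigma>)) {x \<in> S. tl x \<in> F}" if "closedin (T (s # \<sigma>)) S" "closedin (T \<sigma>) F" for S F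
  proof -
    have "{x \<in> S. tl x \<in> F} = S \<inter> {x \<in> topspace (T (s # \<sigma>)). tl x \<in> F}"
      using closedin_subset[OF that(1)] by auto
    then show ?thesis
      using that closedin_continuous_map_preimage[OF continuous_map_tl that(2)] by auto
  qed
  have fibcl: "closedin (T (s # \<sigma>)) {x \<in> S. tl x = a}" if "closedin (T (s # \<sigma>)) S" "a \<in> B" for S a
    using pre[OF that(1), of "{a}"] that(2) closedin_subset[OF B(1)] closed_singleton[of a \<sigma>]
    by (auto simp: topspace_eq)
  \<comment> \<open>Off \<open>F\<close> the image is everything by semi-properness. What lies over
    \<open>F\<close> is a proper closed subset of \<open>C\<close>, and its image is constructible
    by \<open>IH\<close>.\<close>
  have constr: "constructible_in (T \<sigma>) (tl ` C)" and F0: "\<exists>F. closedin (T \<sigma>) F \<and> F \<subset> B \<and> B - F \<subseteq> tl ` C"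
  proof -
    obtain F where F: "closedin (T \<sigma>) F" "F \<subset> B" "B - F \<subseteq> tl ` C"
      using semi_proper_tl[OF C] unfolding B_def by metis
    then show "\<exists>F. closedin (T \<sigma>) F \<and> F \<subset> B \<and> B - F \<subseteq> tl ` C" by auto
    have "\<not> tl ` C \<subseteq> F"
      using F closure_of_minimal[of "tl ` C" F "T \<sigma>"] unfolding B_def by blast
    then have "{x \<in> C. tl x \<in> F} \<subset> C" by blast
    then have "constructible_in (T \<sigma>) (tl ` {x \<in> C. tl x \<in> F})" using IH pre F C by blast
    moreover have "tl ` C = (B - F) \<union> tl ` {x \<in> C. tl x \<in> F}" using F CB by blast
    ultimately show "constructible_in (T \<sigma>) (tl ` C)"
      using F B by (metis constructible_in_Un constructible_in_diff)
  qed
  then obtain F0 where F0: "closedin (T \<sigma>) F0" "F0 \<subset> B" "B - F0 \<subseteq> tl ` C" by metis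
  \<comment> \<open>The least dimension of a nonempty fibre. By the addition formula it is the
    difference of the dimensions of \<open>C\<close> and \<open>B\<close>.\<close>
  define r where "r = (INF a\<in>tl ` C. dm (s # \<sigma>) {x \<in> C. tl x = a})"
  have dC: "dm (s # \<sigma>) C = dm \<sigma> B + r"
    using dim_addition_tl[OF locally_closed_in_closedin[OF C(1)] C(2)]
      dim_dense_constructible[OF B F0(1,2) constr F0(3) CB] by (simp add: r_def)
  obtain \<E> where \<E>: "finite \<E>" "\<forall>F\<in>\<E>. closedin (T (s # \<sigma>)) F \<and> irreducible_in (T (s # \<sigma>)) F" "C \<inter> E = \<Union>\<E>"
    using irreducible_decomposition[OF closedin_Int[OF C(1) E(1)]] by (elim exE conjE) (rule that)
  have "\<forall>J\<in>\<E>. \<exists>F. closedin (T \<sigma>) F \<and> F \<subset> B \<and>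
      (\<forall>a\<in>B - F. {x \<in> J. tl x = a} \<noteq> {} \<longrightarrow> dm (s # \<sigma>) {x \<in> J. tl x = a} < r)"
  proof
    fix J assume J: "J \<in> \<E>"
    have Jc: "closedin (T (s # \<sigma>)) J" "irreducible_in (T (s # \<sigma>)) J" using \<E> J by auto
    have JC: "J \<subset> C" using \<E>(3) J E by blast
    then have cJB: "T \<sigma> closure_of tl ` J \<subseteq> B" unfolding B_def by (intro closure_of_mono) auto
    have JcJ: "tl ` J \<subseteq> T \<sigma> closure_of tl ` J" using JC tlC by (intro closure_of_subset) auto
    show "\<exists>F. closedin (T \<sigma>) F \<and> F \<subset> B \<and>
      (\<forall>a\<in>B - F. {x \<in> J. tl x = a} \<noteq> {} \<longrightarrow> dm (s # \<sigma>) {x \<in> J. tl x = a} < r)"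
    proof (cases "T \<sigma> closure_of tl ` J = B")
      \<comment> \<open>A component that does not dominate \<open>B\<close> has no fibres outside
        the closure of its image, so this closure is removed.\<close>
      case False
      then show ?thesis using cJB JcJ by (intro exI[of _ "T \<sigma> closure_of tl ` J"]) auto
    next
      case True
      obtain G where G: "closedin (T \<sigma>) G" "G \<subset> B" "B - G \<subseteq> tl ` J"
        using semi_proper_tl[OF Jc] True by metis
      define rJ where "rJ = (INF a\<in>tl ` J. dm (s # \<sigma>) {x \<in> J. tl x = a})"
      obtain V where V: "openin (subtopology (T \<sigma>) (tl ` J)) V" "V \<noteq> {}"
        "\<forall>v\<in>V. dm (s # \<sigma>) {x \<in> J. tl x = v} = rJ"
        using dim_fibre_condition_tl[OF locally_closed_in_closedin[OF Jc(1)] Jc(2), folded rJ_def]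
        by (elim exE conjE) (rule that)
      obtain W where W: "openin (T \<sigma>) W" "V = W \<inter> tl ` J" using V(1) by (auto simp: openin_subtopology)
      have "dm (s # \<sigma>) J = dm \<sigma> B + rJ"
        using dim_addition_tl[OF locally_closed_in_closedin[OF Jc(1)] Jc(2)]
          dim_dense_constructible[OF B G(1,2) IH[OF Jc(1) JC] G(3)] JcJ True by (simp add: rJ_def)
      moreover have "dm (s # \<sigma>) J < dm (s # \<sigma>) C"
        using Jc C JC unfolding irreducible_in_def[of _ J]
        by (intro dim_strong_irreducibility locally_closed_in_closedin)
          (auto simp: closedin_closed_subtopology)
      ultimately have rr: "rJ < r" using dC by simp
      \<comment> \<open>\<open>V\<close> is open only in the image of \<open>J\<close>. Avoiding
        \<open>G\<close> keeps a point in that image, and avoiding \<open>B - W\<close> keeps it in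
        \<open>V\<close>. By irreducibility the two closed sets do not cover
        \<open>B\<close>.\<close>
      have BW: "closedin (T \<sigma>) (B - W)" "B - W \<subset> B"
        using B W V(2) JcJ True by (auto simp: closedin_diff)
      have "\<not> B \<subseteq> \<Union>{G, B - W}"
        using irreducible_in_closed_cover[OF B(2,1), of "{G, B - W}"] G BW by auto
      then have "G \<union> (B - W) \<subset> B" using G(2) by auto
      moreover have "dm (s # \<sigma>) {x \<in> J. tl x = a} < r" if "a \<in> B - (G \<union> (B - W))" for a
        using that V(3) W(2) G(3) rr by auto
      ultimately show ?thesis using G(1) BW(1) by (intro exI[of _ "G \<union> (B - W)"]) auto
    qed
  qed
  from bchoice[OF this] obtain f where f: "\<forall>J\<in>\<E>. closedin (T \<sigma>) (f J) \<and> f J \<subset> B \<and>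
      (\<forall>a\<in>B - f J. {x \<in> J. tl x = a} \<noteq> {} \<longrightarrow> dm (s # \<sigma>) {x \<in> J. tl x = a} < r)"
    by (elim exE) (rule that)
  \<comment> \<open>\<open>F0\<close> is removed as well, so that the remaining points have nonempty
    fibres in \<open>C\<close>, which the bound \<open>r\<close> applies to.\<close>
  define F where "F = \<Union>(insert F0 (f ` \<E>))"
  have clF: "closedin (T \<sigma>) F" unfolding F_def using \<E>(1) f F0 by (intro closedin_Union) auto
  have "\<not> B \<subseteq> F"
    unfolding F_def using irreducible_in_closed_cover[OF B(2,1), of "insert F0 (f ` \<E>)"] \<E>(1) f F0 by auto
  moreover have "F \<subseteq> B" unfolding F_def using f F0 by auto
  moreover have "B - F \<subseteq> tl ` (C - E)"
  proof
    fix a assume a: "a \<in> B - F"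
    show "a \<in> tl ` (C - E)"
    proof (rule ccontr)
      assume na: "a \<notin> tl ` (C - E)"
      have aC: "a \<in> tl ` C" using a F0 unfolding F_def by auto
      have eq: "{x \<in> C. tl x = a} = \<Union>((\<lambda>J. {x \<in> J. tl x = a}) ` \<E>)"
        using na \<E>(3) by blast
      have "dm (s # \<sigma>) (\<Union>((\<lambda>J. {x \<in> J. tl x = a}) ` \<E>)) < r"
      proof (rule dim_Union_less)
        show "\<forall>F\<in>(\<lambda>J. {x \<in> J. tl x = a}) ` \<E>. closedin (T (s # \<sigma>)) F" using fibcl \<E>(2) a by auto
        show "\<forall>F\<in>(\<lambda>J. {x \<in> J. tl x = a}) ` \<E>. F \<noteq> {} \<longrightarrow> dm (s # \<sigma>) F < r"
          using f a unfolding F_def by auto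
        show "\<Union>((\<lambda>J. {x \<in> J. tl x = a}) ` \<E>) \<noteq> {}" using aC unfolding eq[symmetric] by auto
      qed (use \<E>(1) in auto)
      moreover have "r \<le> dm (s # \<sigma>) {x \<in> C. tl x = a}"
        unfolding r_def using aC by (intro cINF_lower) auto
      ultimately show False using eq by simp
    qed
  qed
  ultimately show ?thesis using clF unfolding B_def by blast
qed

text \<open>Over a dense open part of the closure of the image nothing is missed; the rest is the
  image of the proper closed subset of \<open>C\<close> lying over the complement. \<open>E\<close>
  is arbitrary in the induction because smaller closed sets are needed both with \<open>E\<close>
  itself and with the empty set in its place.\<close>

lemma constructible_tl_locally_closed:
  assumes "closedin (T (s # \<sigma>)) C" "closedin (T (s # \<sigma>)) E"
  shows "constructible_in (T \<sigma>) (tl ` (C - E))"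
  using assms
proof (induction arbitrary: E rule: closed_induct)
  case (closed C)
  show ?case
  proof (cases "C \<subseteq> E")
    case True
    then have "tl ` (C - E) = {}" by auto
    then show ?thesis by (simp only: constructible_in_closedin closedin_empty)
  next
    case nsub: False
    show ?thesis
    proof (cases "irreducible_in (T (s # \<sigma>)) C")
      case False
      then obtain S1 S2 where S: "closedin (subtopology (T (s # \<sigma>)) C) S1"
        "closedin (subtopology (T (s # \<sigma>)) C) S2" "C = S1 \<union> S2" "S1 \<noteq> C" "S2 \<noteq> C"
        unfolding irreducible_in_def using closedin_subset[OF closed(1)] nsub by blast
      then have "constructible_in (T \<sigma>) (tl ` (S1 - E))" "constructible_in (T \<sigma>) (tl ` (S2 - E))"
        using closed by (auto simp: closedin_closed_subtopology)
      moreover have "tl ` (C - E) = tl ` (S1 - E) \<union> tl ` (S2 - E)" using S(3) by auto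
      ultimately show ?thesis by (simp add: constructible_in_Un)
    next
      case True
      have "\<exists>F. closedin (T \<sigma>) F \<and> F \<subset> T \<sigma> closure_of tl ` C \<and>
          T \<sigma> closure_of tl ` C - F \<subseteq> tl ` (C - E)"
      proof (rule projection_contains_open[OF closed(1) True closed(3) nsub])
        show "constructible_in (T \<sigma>) (tl ` C')" if "closedin (T (s # \<sigma>)) C'" "C' \<subset> C" for C'
          using closed(2)[OF that, of "{}"] by simp
      qed
      then obtain F where F: "closedin (T \<sigma>) F" "F \<subset> T \<sigma> closure_of tl ` C"
        "T \<sigma> closure_of tl ` C - F \<subseteq> tl ` (C - E)" by metis
      have tlC: "tl ` C \<subseteq> topspace (T \<sigma>)"
        using closedin_subset[OF closed(1)] continuous_map_tl[of s \<sigma>] by (auto simp: continuous_map_def Pi_iff)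
      define C' where "C' = C \<inter> {x \<in> topspace (T (s # \<sigma>)). tl x \<in> F}"
      have "closedin (T (s # \<sigma>)) C'" unfolding C'_def
        using closed(1) F(1) by (intro closedin_Int closedin_continuous_map_preimage[OF continuous_map_tl])
      moreover have "\<not> tl ` C \<subseteq> F" using F closure_of_minimal[of "tl ` C" F] by blast
      then have "C' \<subset> C" unfolding C'_def by blast
      ultimately have "constructible_in (T \<sigma>) (tl ` (C' - E))" using closed by blast
      moreover have "tl ` (C - E) = (T \<sigma> closure_of tl ` C - F) \<union> tl ` (C' - E)"
        using F(3) closure_of_subset[OF tlC] closedin_subset[OF closed(1)] unfolding C'_def by blast
      ultimately show ?thesis using F(1) by (simp add: constructible_in_Un constructible_in_diff)
    qed
  qed
qed

theorem constructible_tl: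
  assumes "constructible_in (T (s # \<sigma>)) S"
  shows "constructible_in (T \<sigma>) (tl ` S)"
proof -
  obtain \<F> where F: "finite \<F>" "\<forall>Q\<in>\<F>. locally_closed_in (T (s # \<sigma>)) Q" "S = \<Union>\<F>"
    using assms unfolding constructible_in_def by (elim exE conjE) (rule that)
  have "constructible_in (T \<sigma>) (tl ` Q)" if Q: "Q \<in> \<F>" for Q
  proof -
    obtain U C where "openin (T (s # \<sigma>)) U" "closedin (T (s # \<sigma>)) C" "Q = U \<inter> C"
      using F(2) Q unfolding locally_closed_in_iff by metis
    moreover have "U \<inter> C = C - (topspace (T (s # \<sigma>)) - U)"
      using \<open>closedin (T (s # \<sigma>)) C\<close> closedin_subset by blast
    ultimately show ?thesis
      using constructible_tl_locally_closed[of s \<sigma> C "topspace (T (s # \<sigma>)) - U"]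
      by (simp add: closedin_diff)
  qed
  moreover have "tl ` S = \<Union>((`) tl ` \<F>)" using F(3) by auto
  ultimately show ?thesis using F(1) by (simp add: constructible_in_Union)
qed

end

section \<open>Definable sets\<close>

fun tm_lift :: "'a tm \<Rightarrow> 'a tm" where
  "tm_lift (Var i) = Var (Suc i)"
| "tm_lift (Const a) = Const a"

fun tm_subst :: "(nat \<Rightarrow> 'a tm) \<Rightarrow> ('a \<Rightarrow> 'a tm) \<Rightarrow> 'a tm \<Rightarrow> 'a tm" where
  "tm_subst v c (Var i) = v i"
| "tm_subst v c (Const a) = c a"

text \<open>Constants are substituted as well, so that parameters can be turned into variables.\<close>

fun fm_subst :: "(nat \<Rightarrow> 'a tm) \<Rightarrow> ('a \<Rightarrow> 'a tm) \<Rightarrow> ('s, 'a) fm \<Rightarrow> ('s, 'a) fm" where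
  "fm_subst v c (Eq t u) = Eq (tm_subst v c t) (tm_subst v c u)"
| "fm_subst v c (Rel \<tau> S ts) = Rel \<tau> S (map (tm_subst v c) ts)"
| "fm_subst v c (Neg \<phi>) = Neg (fm_subst v c \<phi>)"
| "fm_subst v c (Conj \<phi> \<psi>) = Conj (fm_subst v c \<phi>) (fm_subst v c \<psi>)"
| "fm_subst v c (Disj \<phi> \<psi>) = Disj (fm_subst v c \<phi>) (fm_subst v c \<psi>)"
| "fm_subst v c (Ex s \<phi>) = Ex s (fm_subst (case_nat (Var 0) (tm_lift \<circ> v)) (tm_lift \<circ> c) \<phi>)"

lemma tm_val_lift [simp]: "tm_val (x # xs) (tm_lift t) = tm_val xs t"
  by (cases t) auto

lemma tm_has_sort_lift: "tm_has_sort D \<sigma> t s \<Longrightarrow> tm_has_sort D (s' # \<sigma>) (tm_lift t) s"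
  by (cases t) auto

lemma tm_params_lift [simp]: "tm_params (tm_lift t) = tm_params t"
  by (cases t) auto

lemma tm_val_subst:
  assumes "tm_has_sort D \<sigma> t s" "\<forall>i<length \<sigma>. tm_val xs (v i) = ys ! i" "\<forall>a\<in>tm_params t. tm_val xs (c a) = a"
  shows "tm_val xs (tm_subst v c t) = tm_val ys t"
  using assms by (cases t) auto

lemma tm_has_sort_subst:
  assumes "tm_has_sort D \<sigma> t s" "\<forall>i<length \<sigma>. tm_has_sort D \<tau> (v i) (\<sigma> ! i)"
    "\<forall>a\<in>tm_params t. \<forall>s. a \<in> D s \<longrightarrow> tm_has_sort D \<tau> (c a) s"
  shows "tm_has_sort D \<tau> (tm_subst v c t) s"
  using assms by (cases t) auto

lemma sat_subst:
  assumes "well_sorted D L \<sigma> \<phi>" "\<forall>i<length \<sigma>. tm_val xs (v i) = ys ! i" "\<forall>a\<in>params \<phi>. tm_val xs (c a) = a"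
  shows "sat D (fm_subst v c \<phi>) xs = sat D \<phi> ys"
  using assms
proof (induction \<phi> arbitrary: \<sigma> v c xs ys)
  case (Eq t u)
  then obtain s where "tm_has_sort D \<sigma> t s" "tm_has_sort D \<sigma> u s" by auto
  then show ?case using Eq.prems(2,3) tm_val_subst[of D \<sigma> _ s xs v ys c] by auto
next
  case (Rel \<tau> S ts)
  have "map (tm_val xs \<circ> tm_subst v c) ts = map (tm_val ys) ts"
  proof (rule map_cong[OF refl])
    fix t assume t: "t \<in> set ts"
    then obtain i where i: "i < length ts" "t = ts ! i" by (metis in_set_conv_nth)
    then have "tm_has_sort D \<sigma> t (\<tau> ! i)" using Rel.prems(1) by (auto simp: list_all2_conv_all_nth)
    then show "(tm_val xs \<circ> tm_subst v c) t = tm_val ys t"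
      using Rel.prems(2,3) t tm_val_subst[of D \<sigma> t "\<tau> ! i" xs v ys c] by auto
  qed
  then show ?case by (simp del: map_eq_conv)
next
  case (Ex s \<phi>)
  have "sat D (fm_subst (case_nat (Var 0) (tm_lift \<circ> v)) (tm_lift \<circ> c) \<phi>) (x # xs) = sat D \<phi> (x # ys)" for x
  proof (rule Ex.IH)
    show "well_sorted D L (s # \<sigma>) \<phi>" using Ex.prems by simp
    show "\<forall>i<length (s # \<sigma>). tm_val (x # xs) (case_nat (Var 0) (tm_lift \<circ> v) i) = (x # ys) ! i"
      using Ex.prems(2) by (simp add: All_less_Suc2)
    show "\<forall>a\<in>params \<phi>. tm_val (x # xs) ((tm_lift \<circ> c) a) = a" using Ex.prems(3) by simp
  qed
  then show ?case by simp
next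
  case (Conj \<phi> \<psi>)
  show ?case
    using Conj.IH(1)[of \<sigma> xs v ys c] Conj.IH(2)[of \<sigma> xs v ys c] Conj.prems by simp
next
  case (Disj \<phi> \<psi>)
  show ?case
    using Disj.IH(1)[of \<sigma> xs v ys c] Disj.IH(2)[of \<sigma> xs v ys c] Disj.prems by simp
next
  case (Neg \<phi>)
  show ?case using Neg.IH[of \<sigma> xs v ys c] Neg.prems by simp
qed

lemma well_sorted_subst:
  assumes "well_sorted D L \<sigma> \<phi>" "\<forall>i<length \<sigma>. tm_has_sort D \<tau> (v i) (\<sigma> ! i)"
    "\<forall>a\<in>params \<phi>. \<forall>s. a \<in> D s \<longrightarrow> tm_has_sort D \<tau> (c a) s"
  shows "well_sorted D L \<tau> (fm_subst v c \<phi>)"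
  using assms
proof (induction \<phi> arbitrary: \<sigma> \<tau> v c)
  case (Eq t u)
  then obtain s where "tm_has_sort D \<sigma> t s" "tm_has_sort D \<sigma> u s" by auto
  then show ?case using Eq.prems(2,3) tm_has_sort_subst[of D \<sigma> _ s \<tau> v c] by (auto intro!: exI[of _ s])
next
  case (Rel \<rho> S ts)
  have "tm_has_sort D \<tau> (tm_subst v c (ts ! i)) (\<rho> ! i)" if "i < length ts" for i
  proof (rule tm_has_sort_subst[of D \<sigma>])
    show "\<forall>a\<in>tm_params (ts ! i). \<forall>s. a \<in> D s \<longrightarrow> tm_has_sort D \<tau> (c a) s"
      using Rel.prems(3) nth_mem[OF that] by auto
  qed (use that Rel.prems in \<open>auto simp: list_all2_conv_all_nth\<close>)
  then show ?case using Rel.prems(1) by (auto simp: list_all2_conv_all_nth)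
next
  case (Ex s \<phi>)
  have "well_sorted D L (s # \<tau>) (fm_subst (case_nat (Var 0) (tm_lift \<circ> v)) (tm_lift \<circ> c) \<phi>)"
  proof (rule Ex.IH)
    show "well_sorted D L (s # \<sigma>) \<phi>" using Ex.prems by simp
    show "\<forall>i<length (s # \<sigma>). tm_has_sort D (s # \<tau>) (case_nat (Var 0) (tm_lift \<circ> v) i) ((s # \<sigma>) ! i)"
      using Ex.prems(2) by (simp add: All_less_Suc2 tm_has_sort_lift)
    show "\<forall>a\<in>params \<phi>. \<forall>s'. a \<in> D s' \<longrightarrow> tm_has_sort D (s # \<tau>) ((tm_lift \<circ> c) a) s'"
      using Ex.prems(3) by (simp add: tm_has_sort_lift)
  qed
  then show ?case by simp
next
  case (Conj \<phi> \<psi>)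
  show ?case
    using Conj.IH(1)[of \<sigma> \<tau> v c] Conj.IH(2)[of \<sigma> \<tau> v c] Conj.prems by simp
next
  case (Disj \<phi> \<psi>)
  show ?case
    using Disj.IH(1)[of \<sigma> \<tau> v c] Disj.IH(2)[of \<sigma> \<tau> v c] Disj.prems by simp
next
  case (Neg \<phi>)
  show ?case using Neg.IH[of \<sigma> \<tau> v c] Neg.prems by simp
qed

lemma tm_params_subst:
  "\<forall>i. tm_params (v i) \<subseteq> B \<Longrightarrow> \<forall>a\<in>tm_params t. tm_params (c a) \<subseteq> B \<Longrightarrow> tm_params (tm_subst v c t) \<subseteq> B"
  by (cases t) auto

lemma params_subst:
  "\<forall>i. tm_params (v i) \<subseteq> B \<Longrightarrow> \<forall>a\<in>params \<phi>. tm_params (c a) \<subseteq> B \<Longrightarrow> params (fm_subst v c \<phi>) \<subseteq> B"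
proof (induction \<phi> arbitrary: v c)
  case (Eq t u)
  then show ?case by (simp add: tm_params_subst)
next
  case (Rel \<tau> S ts)
  then have "tm_params (tm_subst v c t) \<subseteq> B" if "t \<in> set ts" for t
    using that by (intro tm_params_subst) auto
  then show ?case by auto
next
  case (Ex s \<phi>)
  have "params (fm_subst (case_nat (Var 0) (tm_lift \<circ> v)) (tm_lift \<circ> c) \<phi>) \<subseteq> B"
    using Ex.prems by (intro Ex.IH) (auto split: nat.split)
  then show ?case by simp
qed auto

lemma pos_qf_subst [simp]: "pos_qf (fm_subst v c \<phi>) = pos_qf \<phi>"
  by (induction \<phi> arbitrary: v c) auto

lemma finite_tm_params: "finite (tm_params t)"
  by (cases t) auto

lemma finite_params: "finite (params \<phi>)"
  by (induction \<phi>) (auto simp: finite_tm_params)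

lemma params_sorted: "well_sorted D L \<sigma> \<phi> \<Longrightarrow> a \<in> params \<phi> \<Longrightarrow> \<exists>s. a \<in> D s"
proof (induction \<phi> arbitrary: \<sigma>)
  case (Eq t u)
  then show ?case by (cases t; cases u) auto
next
  case (Rel \<tau> S ts)
  then obtain i where "i < length ts" "a \<in> tm_params (ts ! i)" by (auto simp: in_set_conv_nth)
  moreover from this have "tm_has_sort D \<sigma> (ts ! i) (\<tau> ! i)"
    using Rel.prems by (auto simp: list_all2_conv_all_nth)
  ultimately show ?case by (cases "ts ! i") auto
qed auto

text \<open>A block of coordinates written as terms. Lists made of such blocks and of constants
  describe projections, permutations and fibres uniformly, as pullbacks
  \<open>{x. map (tm_val x) ts \<in> X}\<close>.\<close>

definition vars :: "nat \<Rightarrow> nat \<Rightarrow> 'a tm list" where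
  "vars i n = map Var [i..<i + n]"

lemma map_tm_val_vars: "i + n \<le> length x \<Longrightarrow> map (tm_val x) (vars i n) = take n (drop i x)"
  unfolding vars_def by (rule nth_equalityI) auto

lemma map_tm_val_Const [simp]: "map (tm_val x \<circ> Const) a = a"
  by (simp add: comp_def)

lemma tm_params_vars [simp]: "(\<Union>t\<in>set (vars i n). tm_params t) = {}"
  by (auto simp: vars_def)

lemma vars_sorted:
  "i + n \<le> length \<sigma> \<Longrightarrow> take n (drop i \<sigma>) = \<tau> \<Longrightarrow> list_all2 (tm_has_sort D \<sigma>) (vars i n) \<tau>"
  by (auto simp: vars_def list_all2_conv_all_nth)

lemma Const_sorted: "list_all2 (tm_has_sort D \<sigma>) (map Const a) \<tau> \<longleftrightarrow> a \<in> tuples D \<tau>"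
  by (auto simp: list_all2_conv_all_nth tuples_iff)

lemma map_tm_val_sorted:
  "x \<in> tuples D \<sigma> \<Longrightarrow> list_all2 (tm_has_sort D \<sigma>) ts \<tau> \<Longrightarrow> map (tm_val x) ts \<in> tuples D \<tau>"
proof -
  assume x: "x \<in> tuples D \<sigma>" and ts: "list_all2 (tm_has_sort D \<sigma>) ts \<tau>"
  have "tm_val x (ts ! i) \<in> D (\<tau> ! i)" if "i < length \<tau>" for i
  proof -
    have "tm_has_sort D \<sigma> (ts ! i) (\<tau> ! i)" using ts that by (simp add: list_all2_conv_all_nth)
    then show ?thesis using x by (cases "ts ! i") (auto simp: tuples_iff)
  qed
  then show ?thesis using ts by (auto simp: tuples_iff list_all2_conv_all_nth)
qed

section \<open>Boolean operations, projections and pullbacks of definable sets\<close>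

lemma definable_closed_over: "closed_over Z A \<sigma> X \<Longrightarrow> definable_over Z A \<sigma> X"
  unfolding closed_over_def definable_over_def by blast

lemma closed_over_mono: "closed_over Z A \<sigma> X \<Longrightarrow> A \<subseteq> B \<Longrightarrow> closed_over Z B \<sigma> X"
  unfolding closed_over_def formula_over_def by blast

lemma definable_over_mono: "definable_over Z A \<sigma> X \<Longrightarrow> A \<subseteq> B \<Longrightarrow> definable_over Z B \<sigma> X"
  unfolding definable_over_def formula_over_def by blast

lemma definable_over_subset: "definable_over Z A \<sigma> X \<Longrightarrow> X \<subseteq> tuples (univ Z) \<sigma>"
  unfolding definable_over_def solutions_def by auto

lemma closed_over_Rel:
  assumes "P \<in> rels Z \<tau>" "list_all2 (tm_has_sort (univ Z) \<sigma>) ts \<tau>"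
    "(\<Union>t\<in>set ts. tm_params t) \<subseteq> A \<union> (\<Union>s. named Z s)"
  shows "closed_over Z A \<sigma> {x \<in> tuples (univ Z) \<sigma>. map (tm_val x) ts \<in> P}"
  unfolding closed_over_def formula_over_def
  by (rule exI[of _ "Rel \<tau> P ts"]) (use assms in \<open>simp add: solutions_def\<close>)

lemma definable_over_Int:
  assumes "definable_over Z A \<sigma> X" "definable_over Z A \<sigma> Y"
  shows "definable_over Z A \<sigma> (X \<inter> Y)"
proof -
  obtain \<phi> \<psi> where "formula_over Z A \<sigma> \<phi>" "X = solutions Z \<sigma> \<phi>" "formula_over Z A \<sigma> \<psi>" "Y = solutions Z \<sigma> \<psi>"
    using assms unfolding definable_over_def by metis
  then show ?thesis unfolding definable_over_def formula_over_def
    by (intro exI[of _ "Conj \<phi> \<psi>"]) (auto simp: solutions_def)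
qed

lemma definable_over_Compl:
  assumes "definable_over Z A \<sigma> X"
  shows "definable_over Z A \<sigma> (tuples (univ Z) \<sigma> - X)"
proof -
  obtain \<phi> where "formula_over Z A \<sigma> \<phi>" "X = solutions Z \<sigma> \<phi>"
    using assms unfolding definable_over_def by metis
  then show ?thesis unfolding definable_over_def formula_over_def
    by (intro exI[of _ "Neg \<phi>"]) (auto simp: solutions_def)
qed

lemma definable_over_Diff:
  assumes "definable_over Z A \<sigma> X" "definable_over Z A \<sigma> Y"
  shows "definable_over Z A \<sigma> (X - Y)"
proof -
  have "X - Y = X \<inter> (tuples (univ Z) \<sigma> - Y)" using definable_over_subset[OF assms(1)] by auto
  then show ?thesis using assms by (simp add: definable_over_Int definable_over_Compl)
qed

lemma definable_over_Un:
  assumes "definable_over Z A \<sigma> X" "definable_over Z A \<sigma> Y"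
  shows "definable_over Z A \<sigma> (X \<union> Y)"
proof -
  let ?T = "tuples (univ Z) \<sigma>"
  have "X \<union> Y = ?T - ((?T - X) \<inter> (?T - Y))" using assms[THEN definable_over_subset] by auto
  then show ?thesis using assms by (metis definable_over_Int definable_over_Compl)
qed

text \<open>The quantified block stands in front because \<open>Ex\<close> prepends; other
  arrangements of coordinates are first brought into this form by
  \<open>definable_over_subst\<close>.\<close>

lemma definable_over_Ex:
  assumes "definable_over Z A (\<tau> @ \<sigma>) X"
  shows "definable_over Z A \<sigma> {x \<in> tuples (univ Z) \<sigma>. \<exists>y\<in>tuples (univ Z) \<tau>. y @ x \<in> X}"
  using assms
proof (induction \<tau> arbitrary: X)
  case Nil
  then have "X = {x \<in> tuples (univ Z) \<sigma>. x \<in> X}" using definable_over_subset by fastforce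
  then show ?case using Nil by simp
next
  case (Cons s \<tau>)
  obtain \<phi> where \<phi>: "formula_over Z A (s # \<tau> @ \<sigma>) \<phi>" "X = solutions Z (s # \<tau> @ \<sigma>) \<phi>"
    using Cons.prems unfolding definable_over_def by auto
  then have "definable_over Z A (\<tau> @ \<sigma>) (solutions Z (\<tau> @ \<sigma>) (Ex s \<phi>))"
    unfolding definable_over_def formula_over_def by (intro exI[of _ "Ex s \<phi>"]) auto
  note Cons.IH[OF this]
  moreover have "{x \<in> tuples (univ Z) \<sigma>. \<exists>y\<in>tuples (univ Z) (s # \<tau>). y @ x \<in> X} =
      {x \<in> tuples (univ Z) \<sigma>. \<exists>y\<in>tuples (univ Z) \<tau>. y @ x \<in> solutions Z (\<tau> @ \<sigma>) (Ex s \<phi>)}"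
  proof (rule Collect_cong, rule conj_cong[OF refl])
    fix x assume x: "x \<in> tuples (univ Z) \<sigma>"
    have "(\<exists>y\<in>tuples (univ Z) (s # \<tau>). y @ x \<in> X) \<longleftrightarrow>
        (\<exists>d\<in>univ Z s. \<exists>y\<in>tuples (univ Z) \<tau>. d # y @ x \<in> X)"
      by (fastforce simp: tuples_Cons[of _ s \<tau>])
    also have "\<dots> \<longleftrightarrow> (\<exists>y\<in>tuples (univ Z) \<tau>. \<exists>d\<in>univ Z s. d # y @ x \<in> X)" by blast
    also have "\<dots> \<longleftrightarrow> (\<exists>y\<in>tuples (univ Z) \<tau>. y @ x \<in> solutions Z (\<tau> @ \<sigma>) (Ex s \<phi>))"
      using x by (intro bex_cong[OF refl]) (auto simp: \<phi>(2) solutions_def append_in_tuplesI)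
    finally show "(\<exists>y\<in>tuples (univ Z) (s # \<tau>). y @ x \<in> X) \<longleftrightarrow>
      (\<exists>y\<in>tuples (univ Z) \<tau>. y @ x \<in> solutions Z (\<tau> @ \<sigma>) (Ex s \<phi>))" .
  qed
  ultimately show ?case by simp
qed

lemma solutions_subst:
  assumes \<phi>: "formula_over Z A \<tau> \<phi>" and ts: "list_all2 (tm_has_sort (univ Z) \<sigma>) ts \<tau>"
    "(\<Union>t\<in>set ts. tm_params t) \<subseteq> A \<union> (\<Union>s. named Z s)"
  shows "\<exists>\<psi>. formula_over Z A \<sigma> \<psi> \<and> pos_qf \<psi> = pos_qf \<phi> \<and>
    solutions Z \<sigma> \<psi> = {x \<in> tuples (univ Z) \<sigma>. map (tm_val x) ts \<in> solutions Z \<tau> \<phi>}"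
proof -
  \<comment> \<open>Past the end of \<open>ts\<close> the default is a variable, so that it
    contributes no parameter: \<open>params_subst\<close> makes a demand on every index.\<close>
  define v where "v = (\<lambda>i. if i < length ts then ts ! i else Var i)"
  have len: "length ts = length \<tau>" using ts by (simp add: list_all2_conv_all_nth)
  have "formula_over Z A \<sigma> (fm_subst v Const \<phi>)"
    unfolding formula_over_def
  proof
    show "well_sorted (univ Z) (rels Z) \<sigma> (fm_subst v Const \<phi>)"
      by (rule well_sorted_subst[of _ _ \<tau>])
        (use \<phi> ts in \<open>auto simp: formula_over_def v_def list_all2_conv_all_nth\<close>)
    show "params (fm_subst v Const \<phi>) \<subseteq> A \<union> (\<Union>s. named Z s)"
    proof (rule params_subst)
      show "\<forall>i. tm_params (v i) \<subseteq> A \<union> (\<Union>s. named Z s)"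
      proof
        fix i
        show "tm_params (v i) \<subseteq> A \<union> (\<Union>s. named Z s)"
        proof (cases "i < length ts")
          case True
          then show ?thesis using ts(2) nth_mem[OF True] by (simp add: v_def UN_subset_iff)
        qed (simp add: v_def)
      qed
    qed (use \<phi> in \<open>auto simp: formula_over_def\<close>)
  qed
  moreover have "sat (univ Z) (fm_subst v Const \<phi>) x = sat (univ Z) \<phi> (map (tm_val x) ts)" for x
    by (rule sat_subst[of _ "rels Z" \<tau>]) (use \<phi> len in \<open>auto simp: formula_over_def v_def\<close>)
  ultimately show ?thesis
    by (intro exI[of _ "fm_subst v Const \<phi>"]) (auto simp: solutions_def map_tm_val_sorted[OF _ ts(1)])
qed

lemma definable_over_subst:
  assumes "definable_over Z A \<tau> X" "list_all2 (tm_has_sort (univ Z) \<sigma>) ts \<tau>"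
    "(\<Union>t\<in>set ts. tm_params t) \<subseteq> A \<union> (\<Union>s. named Z s)"
  shows "definable_over Z A \<sigma> {x \<in> tuples (univ Z) \<sigma>. map (tm_val x) ts \<in> X}"
proof -
  obtain \<phi> where \<phi>: "formula_over Z A \<tau> \<phi>" "X = solutions Z \<tau> \<phi>"
    using assms(1) unfolding definable_over_def by metis
  show ?thesis using solutions_subst[OF \<phi>(1) assms(2,3)] unfolding definable_over_def \<phi>(2) by metis
qed

lemma closed_over_subst:
  assumes "closed_over Z A \<tau> X" "list_all2 (tm_has_sort (univ Z) \<sigma>) ts \<tau>"
    "(\<Union>t\<in>set ts. tm_params t) \<subseteq> A \<union> (\<Union>s. named Z s)"
  shows "closed_over Z A \<sigma> {x \<in> tuples (univ Z) \<sigma>. map (tm_val x) ts \<in> X}"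
proof -
  obtain \<phi> where \<phi>: "formula_over Z A \<tau> \<phi>" "pos_qf \<phi>" "X = solutions Z \<tau> \<phi>"
    using assms(1) unfolding closed_over_def by metis
  show ?thesis using solutions_subst[OF \<phi>(1) assms(2,3)] \<phi>(2) unfolding closed_over_def \<phi>(3) by metis
qed

section \<open>Parameters as arguments of predicates\<close>

locale zmodel =
  fixes Z :: "('s, 'a, 'z) zariski_scheme"
  assumes model: "zariski_model Z"
begin

sublocale zariski_structure "univ Z" "zar Z" "zdim Z"
  using model unfolding zariski_model_def by blast

lemma sort_unique: "x \<in> univ Z s \<Longrightarrow> x \<in> univ Z t \<Longrightarrow> s = t"
  using model unfolding zariski_model_def by blast

lemma closedin_iff: "closedin (zar Z \<sigma>) S \<longleftrightarrow> closed_over Z UNIV \<sigma> S"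
  using model unfolding zariski_model_def by blast

lemma rels_iff: "S \<in> rels Z \<sigma> \<longleftrightarrow> closedin (zar Z \<sigma>) S \<and> definable_over Z {} \<sigma> S"
  using model unfolding zariski_model_def by blast

lemma closed_over_closedin: "closed_over Z A \<sigma> X \<Longrightarrow> closedin (zar Z \<sigma>) X"
  unfolding closedin_iff by (rule closed_over_mono) auto

lemma closed_over_rels: "closed_over Z {} \<sigma> X \<Longrightarrow> X \<in> rels Z \<sigma>"
  by (simp add: rels_iff closed_over_closedin definable_closed_over)

text \<open>All constants, the named ones included, become leading variables. As the sorts are
  disjoint, the sort picked by \<open>SOME\<close> is the one at which the constant occurs, and the
  new formula is well sorted.\<close>

lemma solutions_abstract_params:
  assumes \<phi>: "formula_over Z A \<sigma> \<phi>"
  shows "\<exists>\<rho> a \<psi>. a \<in> tuples (univ Z) \<rho> \<and> set a \<subseteq> A \<union> (\<Union>s. named Z s) \<and>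
    formula_over Z {} (\<rho> @ \<sigma>) \<psi> \<and> pos_qf \<psi> = pos_qf \<phi> \<and>
    solutions Z \<sigma> \<phi> = {x \<in> tuples (univ Z) \<sigma>. a @ x \<in> solutions Z (\<rho> @ \<sigma>) \<psi>}"
proof -
  obtain a where a: "set a = params \<phi>" using finite_list[OF finite_params] by metis
  define \<rho> where "\<rho> = map (\<lambda>y. SOME s. y \<in> univ Z s) a"
  have "a ! i \<in> univ Z (\<rho> ! i)" if "i < length a" for i
  proof -
    have "a ! i \<in> params \<phi>" using a that nth_mem by metis
    then have "\<exists>s. a ! i \<in> univ Z s" using \<phi> params_sorted unfolding formula_over_def by metis
    then show ?thesis using that someI_ex[of "\<lambda>s. a ! i \<in> univ Z s"] by (simp add: \<rho>_def)
  qed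
  then have aT: "a \<in> tuples (univ Z) \<rho>" by (auto simp: tuples_iff \<rho>_def)
  have len: "length a = length \<rho>" by (simp add: \<rho>_def)
  have "\<forall>y\<in>params \<phi>. \<exists>i. i < length a \<and> a ! i = y"
    unfolding a[symmetric] by (simp add: in_set_conv_nth)
  from bchoice[OF this] obtain pos where pos: "\<forall>y\<in>params \<phi>. pos y < length a \<and> a ! pos y = y"
    by (elim exE) (rule that)
  define v where "v = (\<lambda>i. Var (length \<rho> + i) :: 'a tm)"
  define c where "c = (\<lambda>y. Var (pos y) :: 'a tm)"
  define \<psi> where "\<psi> = fm_subst v c \<phi>"
  have "well_sorted (univ Z) (rels Z) (\<rho> @ \<sigma>) \<psi>"
    unfolding \<psi>_def
  proof (rule well_sorted_subst[of _ _ \<sigma>])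
    show "\<forall>y\<in>params \<phi>. \<forall>s. y \<in> univ Z s \<longrightarrow> tm_has_sort (univ Z) (\<rho> @ \<sigma>) (c y) s"
    proof (intro ballI allI impI)
      fix y s assume y: "y \<in> params \<phi>" "y \<in> univ Z s"
      then have "a ! pos y \<in> univ Z (\<rho> ! pos y)" "pos y < length \<rho>"
        using pos aT len by (auto simp: tuples_iff)
      then show "tm_has_sort (univ Z) (\<rho> @ \<sigma>) (c y) s"
        using y pos sort_unique by (auto simp: c_def nth_append)
    qed
  qed (use \<phi> in \<open>auto simp: formula_over_def v_def\<close>)
  moreover have "params \<psi> \<subseteq> {}" unfolding \<psi>_def by (rule params_subst) (auto simp: v_def c_def)
  moreover have "sat (univ Z) \<psi> (a @ x) = sat (univ Z) \<phi> x" for x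
    unfolding \<psi>_def
    by (rule sat_subst[of _ "rels Z" \<sigma>])
      (use \<phi> pos len in \<open>auto simp: formula_over_def v_def c_def nth_append\<close>)
  moreover have "set a \<subseteq> A \<union> (\<Union>s. named Z s)" using a \<phi> by (auto simp: formula_over_def)
  ultimately show ?thesis
    using aT by (intro exI[of _ \<rho>] exI[of _ a] exI[of _ \<psi>])
      (auto simp: formula_over_def solutions_def append_in_tuplesI \<psi>_def)
qed

lemma definable_over_abstract:
  assumes "definable_over Z A \<sigma> X"
  obtains \<rho> a Y where "a \<in> tuples (univ Z) \<rho>" "set a \<subseteq> A \<union> (\<Union>s. named Z s)"
    "definable_over Z {} (\<rho> @ \<sigma>) Y" "X = {x \<in> tuples (univ Z) \<sigma>. a @ x \<in> Y}"
proof -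
  obtain \<phi> where \<phi>: "formula_over Z A \<sigma> \<phi>" "X = solutions Z \<sigma> \<phi>"
    using assms unfolding definable_over_def by blast
  obtain \<rho> a \<psi> where "a \<in> tuples (univ Z) \<rho>" "set a \<subseteq> A \<union> (\<Union>s. named Z s)"
    "formula_over Z {} (\<rho> @ \<sigma>) \<psi>"
    "solutions Z \<sigma> \<phi> = {x \<in> tuples (univ Z) \<sigma>. a @ x \<in> solutions Z (\<rho> @ \<sigma>) \<psi>}"
    using solutions_abstract_params[OF \<phi>(1)] by (elim exE conjE) (rule that)
  then show ?thesis
    by (intro that[of a \<rho> "solutions Z (\<rho> @ \<sigma>) \<psi>"]) (auto simp: \<phi>(2) definable_over_def)
qed

text \<open>Once its constants are variables, a positive quantifier-free formula defines a closed
  set without parameters, which is itself a predicate. So one relation symbol takes the place of the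
  whole formula.\<close>

lemma closed_over_abstract:
  assumes "closed_over Z A \<sigma> X"
  obtains \<rho> a P where "a \<in> tuples (univ Z) \<rho>" "set a \<subseteq> A \<union> (\<Union>s. named Z s)"
    "P \<in> rels Z (\<rho> @ \<sigma>)" "X = {x \<in> tuples (univ Z) \<sigma>. a @ x \<in> P}"
proof -
  obtain \<phi> where \<phi>: "formula_over Z A \<sigma> \<phi>" "pos_qf \<phi>" "X = solutions Z \<sigma> \<phi>"
    using assms unfolding closed_over_def by blast
  obtain \<rho> a \<psi> where \<psi>: "a \<in> tuples (univ Z) \<rho>" "set a \<subseteq> A \<union> (\<Union>s. named Z s)"
    "formula_over Z {} (\<rho> @ \<sigma>) \<psi>" "pos_qf \<psi> = pos_qf \<phi>"
    "solutions Z \<sigma> \<phi> = {x \<in> tuples (univ Z) \<sigma>. a @ x \<in> solutions Z (\<rho> @ \<sigma>) \<psi>}"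
    using solutions_abstract_params[OF \<phi>(1)] by (elim exE conjE) (rule that)
  have "solutions Z (\<rho> @ \<sigma>) \<psi> \<in> rels Z (\<rho> @ \<sigma>)"
    using \<psi> \<phi>(2) by (intro closed_over_rels) (auto simp: closed_over_def)
  then show ?thesis
    using \<psi>(1,2) by (intro that[of a \<rho> "solutions Z (\<rho> @ \<sigma>) \<psi>"]) (auto simp: \<phi>(3) \<psi>(5))
qed

text \<open>A positive tautology is not at hand; for the empty signature there is not even a
  variable to equate with itself. The full set is instead shown to be a predicate. Being closed, it
  has some formula with parameters; these become variables, the union of a set and its complement
  gives the full set of longer tuples, and a projection returns to \<open>\<sigma>\<close>.\<close>

lemma closed_over_tuples [simp]: "closed_over Z A \<sigma> (tuples (univ Z) \<sigma>)"
proof -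
  have "closed_over Z UNIV \<sigma> (tuples (univ Z) \<sigma>)"
    using closedin_topspace[of "zar Z \<sigma>"] by (simp add: topspace_eq closedin_iff)
  then obtain \<phi> where \<phi>: "formula_over Z UNIV \<sigma> \<phi>"
    unfolding closed_over_def by metis
  obtain \<rho> a \<psi> where \<psi>: "a \<in> tuples (univ Z) \<rho>" "formula_over Z {} (\<rho> @ \<sigma>) \<psi>"
    using solutions_abstract_params[OF \<phi>(1)] by metis
  have "definable_over Z {} (\<rho> @ \<sigma>) (tuples (univ Z) (\<rho> @ \<sigma>))"
  proof -
    let ?S = "solutions Z (\<rho> @ \<sigma>) \<psi>"
    have "definable_over Z {} (\<rho> @ \<sigma>) ?S" using \<psi>(2) unfolding definable_over_def by metis
    then have "definable_over Z {} (\<rho> @ \<sigma>) (?S \<union> (tuples (univ Z) (\<rho> @ \<sigma>) - ?S))"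
      by (intro definable_over_Un definable_over_Compl)
    moreover have "?S \<union> (tuples (univ Z) (\<rho> @ \<sigma>) - ?S) = tuples (univ Z) (\<rho> @ \<sigma>)"
      by (auto simp: solutions_def)
    ultimately show ?thesis by simp
  qed
  then have "definable_over Z {} \<sigma> {x \<in> tuples (univ Z) \<sigma>. \<exists>y\<in>tuples (univ Z) \<rho>. y @ x \<in> tuples (univ Z) (\<rho> @ \<sigma>)}"
    by (rule definable_over_Ex)
  moreover have "{x \<in> tuples (univ Z) \<sigma>. \<exists>y\<in>tuples (univ Z) \<rho>. y @ x \<in> tuples (univ Z) (\<rho> @ \<sigma>)} = tuples (univ Z) \<sigma>"
    using \<psi>(1) by (auto simp: append_in_tuplesI)
  ultimately have "tuples (univ Z) \<sigma> \<in> rels Z \<sigma>"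
    using closedin_topspace[of "zar Z \<sigma>"] by (simp add: rels_iff topspace_eq)
  from closed_over_Rel[OF this, of \<sigma> "vars 0 (length \<sigma>)" A]
  show ?thesis
    by (simp add: vars_sorted map_tm_val_vars length_tuples cong: conj_cong)
qed

text \<open>Together with \<open>closed_over_abstract\<close> this identifies the closed sets over
  \<open>A\<close> with the fibres of predicates at tuples from \<open>A\<close> and the named
  elements.\<close>

lemma closed_over_slice:
  assumes "P \<in> rels Z (\<rho> @ \<sigma>)" "a \<in> tuples (univ Z) \<rho>" "set a \<subseteq> A \<union> (\<Union>s. named Z s)"
  shows "closed_over Z A \<sigma> {x \<in> tuples (univ Z) \<sigma>. a @ x \<in> P}"
proof -
  have "closed_over Z A \<sigma> {x \<in> tuples (univ Z) \<sigma>. map (tm_val x) (map Const a @ vars 0 (length \<sigma>)) \<in> P}"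
    using assms(2,3)
    by (intro closed_over_Rel[OF assms(1)] list_all2_appendI vars_sorted) (auto simp: Const_sorted vars_def)
  then show ?thesis by (simp add: map_tm_val_vars length_tuples cong: conj_cong)
qed

lemma closed_over_Int:
  assumes "closed_over Z A \<sigma> X" "closed_over Z A \<sigma> Y"
  shows "closed_over Z A \<sigma> (X \<inter> Y)"
proof -
  obtain \<phi> \<psi> where "formula_over Z A \<sigma> \<phi>" "X = solutions Z \<sigma> \<phi>" "formula_over Z A \<sigma> \<psi>" "Y = solutions Z \<sigma> \<psi>"
    "pos_qf \<phi>" "pos_qf \<psi>"
    using assms unfolding closed_over_def by metis
  then show ?thesis unfolding closed_over_def formula_over_def
    by (intro exI[of _ "Conj \<phi> \<psi>"]) (auto simp: solutions_def)
qed

lemma closed_over_singleton: "set a \<subseteq> A \<union> (\<Union>s. named Z s) \<Longrightarrow> a \<in> tuples (univ Z) \<sigma> \<Longrightarrow> closed_over Z A \<sigma> {a}"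
proof (induction \<sigma> arbitrary: a)
  case Nil
  then show ?case using closed_over_tuples[of A "[]"] by simp
next
  case (Cons s \<sigma>)
  then obtain y b where a: "a = y # b" "y \<in> univ Z s" "b \<in> tuples (univ Z) \<sigma>" by (auto simp: tuples_Cons)
  have 1: "closed_over Z A (s # \<sigma>) (solutions Z (s # \<sigma>) (Eq (Var 0) (Const y)))"
    unfolding closed_over_def formula_over_def using Cons.prems a
    by (intro exI[of _ "Eq (Var 0) (Const y)"]) auto
  have 2: "closed_over Z A (s # \<sigma>)
      {x \<in> tuples (univ Z) (s # \<sigma>). map (tm_val x) (vars 1 (length \<sigma>)) \<in> {b}}"
    using Cons a by (intro closed_over_subst[of _ _ \<sigma>] vars_sorted) auto
  have 3: "{x \<in> tuples (univ Z) (s # \<sigma>). map (tm_val x) (vars 1 (length \<sigma>)) \<in> {b}} \<inter>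
      solutions Z (s # \<sigma>) (Eq (Var 0) (Const y)) = {a}"
    using a by (auto simp: solutions_def map_tm_val_vars tuples_Cons length_tuples)
  from closed_over_Int[OF 2 1] show ?case unfolding 3 .
qed

lemma definable_over_empty: "definable_over Z A \<sigma> {}"
  using definable_over_Compl[OF definable_closed_over[OF closed_over_tuples[of A \<sigma>]]] by simp

lemma definable_over_finite:
  assumes "finite X" "X \<subseteq> tuples (univ Z) \<sigma>" "\<forall>a\<in>X. set a \<subseteq> A \<union> (\<Union>s. named Z s)"
  shows "definable_over Z A \<sigma> X"
  using assms
proof (induction X rule: finite_induct)
  case (insert a X)
  then have "definable_over Z A \<sigma> ({a} \<union> X)"
    by (intro definable_over_Un definable_closed_over[OF closed_over_singleton]) auto
  then show ?case by simp
qed (simp add: definable_over_empty)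

text \<open>
  The closure is the intersection of the closed sets \<open>{x. a' @ x \<in> P}\<close> containing \<open>X\<close>, where \<open>P\<close> is
  fixed such that the closure is of this form.
\<close>

lemma definable_over_closure:
  assumes X: "definable_over Z {} \<sigma> X"
  shows "(zar Z \<sigma>) closure_of X \<in> rels Z \<sigma>"
proof -
  let ?C = "(zar Z \<sigma>) closure_of X"
  let ?D = "univ Z"
  have Xs: "X \<subseteq> tuples ?D \<sigma>" using X by (rule definable_over_subset)
  have "closed_over Z UNIV \<sigma> ?C" using closedin_closure_of by (simp flip: closedin_iff)
  then obtain \<rho> a P where a: "a \<in> tuples ?D \<rho>" and P: "P \<in> rels Z (\<rho> @ \<sigma>)"
    and C: "?C = {x \<in> tuples ?D \<sigma>. a @ x \<in> P}"
    by (rule closed_over_abstract)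
  have dP: "definable_over Z {} (\<rho> @ \<sigma>) P" using P by (simp add: rels_iff)
  \<comment> \<open>In a tuple \<open>z @ b @ x\<close> of \<open>V\<close> the entry
    \<open>z\<close> shows that the fibre of \<open>P\<close> at \<open>b\<close> does not contain
    \<open>X\<close>; \<open>x\<close> is a dummy. Hence \<open>Y\<close> below consists of the
    \<open>b @ x\<close> for which the fibre at \<open>b\<close> contains \<open>X\<close> but
    misses \<open>x\<close>.\<close>
  define V where "V = {w \<in> tuples ?D (\<sigma> @ \<rho> @ \<sigma>). map (tm_val w) (vars 0 (length \<sigma>)) \<in> X} -
    {w \<in> tuples ?D (\<sigma> @ \<rho> @ \<sigma>). map (tm_val w) (vars (length \<sigma>) (length \<rho>) @ vars 0 (length \<sigma>)) \<in> P}"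
  have dV: "definable_over Z {} (\<sigma> @ \<rho> @ \<sigma>) V"
    unfolding V_def
    by (intro definable_over_Diff definable_over_subst[OF X] definable_over_subst[OF dP]
        list_all2_appendI vars_sorted) auto
  have V: "z @ b @ x \<in> V \<longleftrightarrow> z \<in> X \<and> b @ z \<notin> P"
    if "z \<in> tuples ?D \<sigma>" "b \<in> tuples ?D \<rho>" "x \<in> tuples ?D \<sigma>" for z b x
    using that unfolding V_def
    by (simp add: map_tm_val_vars length_tuples append_in_tuples)
  define Y where "Y = (tuples ?D (\<rho> @ \<sigma>) - P) - {w \<in> tuples ?D (\<rho> @ \<sigma>). \<exists>z\<in>tuples ?D \<sigma>. z @ w \<in> V}"
  have dY: "definable_over Z {} (\<rho> @ \<sigma>) Y"
    unfolding Y_def by (intro definable_over_Diff definable_over_Compl dP definable_over_Ex dV)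
  have Y: "b @ x \<in> Y \<longleftrightarrow> b @ x \<notin> P \<and> (\<forall>z\<in>X. b @ z \<in> P)"
    if "b \<in> tuples ?D \<rho>" "x \<in> tuples ?D \<sigma>" for b x
    using that Xs V[OF _ that] unfolding Y_def by (auto simp: append_in_tuplesI)
  have "?C = tuples ?D \<sigma> - {x \<in> tuples ?D \<sigma>. \<exists>b\<in>tuples ?D \<rho>. b @ x \<in> Y}"
  proof (intro equalityI subsetI)
    fix x assume x: "x \<in> ?C"
    have "b @ x \<in> P" if b: "b \<in> tuples ?D \<rho>" "\<forall>z\<in>X. b @ z \<in> P" for b
    proof -
      have "closedin (zar Z \<sigma>) {x \<in> tuples ?D \<sigma>. b @ x \<in> P}"
        using closed_over_slice[OF P b(1), of UNIV] by (simp add: closedin_iff)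
      then have "?C \<subseteq> {x \<in> tuples ?D \<sigma>. b @ x \<in> P}"
        using b Xs by (intro closure_of_minimal) auto
      then show ?thesis using x by blast
    qed
    then show "x \<in> tuples ?D \<sigma> - {x \<in> tuples ?D \<sigma>. \<exists>b\<in>tuples ?D \<rho>. b @ x \<in> Y}"
      using x C Y by auto
  next
    fix x assume x: "x \<in> tuples ?D \<sigma> - {x \<in> tuples ?D \<sigma>. \<exists>b\<in>tuples ?D \<rho>. b @ x \<in> Y}"
    \<comment> \<open>The original parameter \<open>a\<close> is one of the \<open>b\<close>, and
      its fibre is the closure itself; so the intersection is no larger.\<close>
    have "X \<subseteq> ?C" using Xs by (intro closure_of_subset) (simp add: topspace_eq)
    then have "\<forall>z\<in>X. a @ z \<in> P" using C by auto
    then show "x \<in> ?C" using x Y[OF a, of x] a C by blast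
  qed
  then have "definable_over Z {} \<sigma> ?C"
    using definable_over_Compl[OF definable_over_Ex[OF dY]] by simp
  then show ?thesis by (simp add: rels_iff)
qed

section \<open>Quantifier elimination without parameters\<close>

lemma constructible_solutions:
  "well_sorted (univ Z) (rels Z) \<sigma> \<phi> \<Longrightarrow> constructible_in (zar Z \<sigma>) (solutions Z \<sigma> \<phi>)"
proof (induction \<phi> arbitrary: \<sigma>)
  case (Eq t u)
  then have "closed_over Z UNIV \<sigma> (solutions Z \<sigma> (Eq t u))"
    unfolding closed_over_def formula_over_def by (intro exI[of _ "Eq t u"]) auto
  then show ?case by (simp add: constructible_in_closedin closedin_iff)
next
  case (Rel \<tau> S ts)
  then have "closed_over Z UNIV \<sigma> (solutions Z \<sigma> (Rel \<tau> S ts))"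
    unfolding closed_over_def formula_over_def by (intro exI[of _ "Rel \<tau> S ts"]) auto
  then show ?case by (simp add: constructible_in_closedin closedin_iff)
next
  case (Neg \<phi>)
  have "solutions Z \<sigma> (Neg \<phi>) = topspace (zar Z \<sigma>) - solutions Z \<sigma> \<phi>"
    by (auto simp: solutions_def topspace_eq)
  then show ?case using Neg by (simp add: constructible_in_Compl)
next
  case (Conj \<phi> \<psi>)
  have "solutions Z \<sigma> (Conj \<phi> \<psi>) = solutions Z \<sigma> \<phi> \<inter> solutions Z \<sigma> \<psi>"
    by (auto simp: solutions_def)
  then show ?case using Conj by (simp add: constructible_in_Int)
next
  case (Disj \<phi> \<psi>)
  have "solutions Z \<sigma> (Disj \<phi> \<psi>) = solutions Z \<sigma> \<phi> \<union> solutions Z \<sigma> \<psi>"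
    by (auto simp: solutions_def)
  then show ?case using Disj by (simp add: constructible_in_Un)
next
  case (Ex s \<phi>)
  have "solutions Z \<sigma> (Ex s \<phi>) = tl ` solutions Z (s # \<sigma>) \<phi>"
  proof (intro equalityI subsetI)
    fix x assume "x \<in> solutions Z \<sigma> (Ex s \<phi>)"
    then obtain y where "y # x \<in> solutions Z (s # \<sigma>) \<phi>" by (auto simp: solutions_def)
    then show "x \<in> tl ` solutions Z (s # \<sigma>) \<phi>" by (metis image_eqI list.sel(3))
  qed (auto simp: solutions_def tuples_Cons)
  then show ?case using constructible_tl[OF Ex.IH] Ex.prems by simp
qed

text \<open>With \<open>C\<close> the closure of \<open>X\<close>, the set \<open>C - X\<close> is
  again 0-definable and has a strictly smaller closure. After finitely many steps \<open>X\<close>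
  is exhausted as an alternating difference \<open>C - (C' - (C'' - ...))\<close> of
  predicates.\<close>

lemma definable_induct [consumes 1, case_names empty frontier]:
  assumes "definable_over Z {} \<sigma> X" "P {}"
    and step: "\<And>C X. C \<in> rels Z \<sigma> \<Longrightarrow> X \<subseteq> C \<Longrightarrow> P (C - X) \<Longrightarrow> P X"
  shows "P X"
proof -
  have "P X" if "closedin (zar Z \<sigma>) C" "definable_over Z {} \<sigma> X" "C = (zar Z \<sigma>) closure_of X" for C X
    using that
  proof (induction arbitrary: X rule: closed_induct)
    case (closed C)
    show ?case
    proof (cases "X = {}")
      case True
      then show ?thesis using assms(2) by simp
    next
      case False
      have C: "C \<in> rels Z \<sigma>" using definable_over_closure closed by metis
      have XC: "X \<subseteq> C"
        using closed definable_over_subset[OF closed(3)] closure_of_subset[of X "zar Z \<sigma>"]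
        by (simp add: topspace_eq)
      have d: "definable_over Z {} \<sigma> (C - X)" using C closed by (auto simp: rels_iff intro: definable_over_Diff)
      have "constructible_in (zar Z \<sigma>) X"
        using closed(3) constructible_solutions unfolding definable_over_def formula_over_def by metis
      from closure_of_frontier_constructible[OF this False]
      have "(zar Z \<sigma>) closure_of (C - X) \<subset> C" using closed by simp
      then have "P (C - X)" using closed(2)[OF closedin_closure_of _ d] by simp
      then show ?thesis using step[OF C XC] by simp
    qed
  qed
  from this[OF closedin_closure_of assms(1) refl] show ?thesis .
qed

lemma same_rels_same_type:
  assumes "definable_over Z {} \<sigma> X" "\<forall>P\<in>rels Z \<sigma>. x \<in> P \<longleftrightarrow> y \<in> P"
  shows "x \<in> X \<longleftrightarrow> y \<in> X"
  using assms(1)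
proof (induction rule: definable_induct)
  case (frontier C X)
  then have "x \<in> C \<longleftrightarrow> y \<in> C" using assms(2) by simp
  then show ?case using frontier(2,3) by blast
qed simp

text \<open>With the parameters of a formula moved into a tuple \<open>a\<close>, its truth at
  \<open>x\<close> depends only on the predicates that hold at \<open>a @ x\<close>, and their
  fibres at \<open>a\<close> are closed over \<open>A\<close>.\<close>

lemma same_type_overI:
  assumes xy: "x \<in> tuples (univ Z) \<sigma>" "y \<in> tuples (univ Z) \<sigma>"
    and same: "\<And>X. closed_over Z A \<sigma> X \<Longrightarrow> x \<in> X \<longleftrightarrow> y \<in> X"
  shows "same_type_over Z A \<sigma> x y"
  unfolding same_type_over_def
proof (intro allI impI)
  fix \<phi> assume "formula_over Z A \<sigma> \<phi>"
  then have "definable_over Z A \<sigma> (solutions Z \<sigma> \<phi>)"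
    unfolding definable_over_def by (intro exI[of _ \<phi>] conjI refl)
  then obtain \<rho> a Y where a: "a \<in> tuples (univ Z) \<rho>" "set a \<subseteq> A \<union> (\<Union>s. named Z s)"
    and Y: "definable_over Z {} (\<rho> @ \<sigma>) Y"
    and eq: "solutions Z \<sigma> \<phi> = {x \<in> tuples (univ Z) \<sigma>. a @ x \<in> Y}"
    by (rule definable_over_abstract)
  have "a @ x \<in> Y \<longleftrightarrow> a @ y \<in> Y"
  proof (rule same_rels_same_type[OF Y], intro ballI)
    fix P assume P: "P \<in> rels Z (\<rho> @ \<sigma>)"
    show "a @ x \<in> P \<longleftrightarrow> a @ y \<in> P"
      using same[OF closed_over_slice[OF P a]] xy by simp
  qed
  then have "x \<in> solutions Z \<sigma> \<phi> \<longleftrightarrow> y \<in> solutions Z \<sigma> \<phi>" using xy unfolding eq by simp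
  then show "sat (univ Z) \<phi> x = sat (univ Z) \<phi> y" using xy by (simp add: solutions_def)
qed

text \<open>The prime model is elementary only for formulas about the sort \<open>M\<close>. A
  0-definable subset of a power of \<open>M\<close> may come with quantifiers over \<open>C\<close>;
  as a combination of predicates on its own signature it needs none.\<close>

lemma definable_by_own_sorts:
  assumes "definable_over Z {} \<sigma> X"
  shows "\<exists>\<phi>. formula_over Z {} \<sigma> \<phi> \<and> fm_sorts \<phi> \<subseteq> set \<sigma> \<and> X = solutions Z \<sigma> \<phi>"
  using assms
proof (induction rule: definable_induct)
  case empty
  have "{} \<in> rels Z \<sigma>" by (simp add: rels_iff definable_over_empty)
  then have "formula_over Z {} \<sigma> (Rel \<sigma> {} (vars 0 (length \<sigma>)))"
    by (simp add: formula_over_def vars_sorted)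
  then show ?case by (intro exI[of _ "Rel \<sigma> {} (vars 0 (length \<sigma>))"]) (auto simp: solutions_def)
next
  case (frontier C X)
  then obtain \<phi> where \<phi>: "formula_over Z {} \<sigma> \<phi>" "fm_sorts \<phi> \<subseteq> set \<sigma>" "C - X = solutions Z \<sigma> \<phi>" by auto
  let ?\<psi> = "Conj (Rel \<sigma> C (vars 0 (length \<sigma>))) (Neg \<phi>)"
  have CT: "C \<subseteq> tuples (univ Z) \<sigma>"
    using frontier(1) closedin_subset[of "zar Z \<sigma>" C] by (simp add: rels_iff topspace_eq)
  have "formula_over Z {} \<sigma> ?\<psi>" using \<phi>(1) frontier(1) by (simp add: formula_over_def vars_sorted)
  moreover have "X = solutions Z \<sigma> ?\<psi>"
  proof -
    have "solutions Z \<sigma> ?\<psi> = C - solutions Z \<sigma> \<phi>"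
      using CT by (auto simp: solutions_def map_tm_val_vars length_tuples)
    also have "\<dots> = X" using frontier(2) unfolding \<phi>(3)[symmetric] by blast
    finally show ?thesis by simp
  qed
  ultimately show ?case using \<phi>(2) by (intro exI[of _ ?\<psi>]) auto
qed

end

section \<open>Loci and the prime model\<close>

context zmodel
begin

lemma mem_loc: "b \<in> loc Z A \<sigma> b"
  by (simp add: loc_def)

lemma loc_subset: "closed_over Z A \<sigma> X \<Longrightarrow> b \<in> X \<Longrightarrow> loc Z A \<sigma> b \<subseteq> X"
  unfolding loc_def by blast

text \<open>By well-foundedness the family has a minimal member, and this is the least one since the
  family is closed under binary intersections.\<close>

lemma closed_over_loc:
  assumes b: "b \<in> tuples (univ Z) \<sigma>"
  shows "closed_over Z A \<sigma> (loc Z A \<sigma> b)"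
proof -
  let ?R = "{(A, B). closedin (zar Z \<sigma>) A \<and> closedin (zar Z \<sigma>) B \<and> A \<subset> B}"
  let ?Q = "{X. closed_over Z A \<sigma> X \<and> b \<in> X}"
  have T: "tuples (univ Z) \<sigma> \<in> ?Q" using b by simp
  obtain X where X: "X \<in> ?Q" and min: "\<forall>Y. (Y, X) \<in> ?R \<longrightarrow> Y \<notin> ?Q"
    using iffD1[OF wf_eq_minimal wf_closed[of \<sigma>], THEN spec, THEN spec, THEN mp, OF T]
    by (elim bexE) (rule that)
  have "X \<subseteq> Y" if "Y \<in> ?Q" for Y
  proof (rule ccontr)
    assume "\<not> X \<subseteq> Y"
    moreover have "X \<inter> Y \<in> ?Q" using X that by (simp add: closed_over_Int)
    moreover have "closedin (zar Z \<sigma>) X" "closedin (zar Z \<sigma>) (X \<inter> Y)"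
      using X that by (auto intro: closed_over_closedin closed_over_Int)
    ultimately show False using spec[OF min, of "X \<inter> Y"] by blast
  qed
  then have "loc Z A \<sigma> b = X" unfolding loc_def using X by (intro antisym Inter_lower Inter_greatest)
  then show ?thesis using X by simp
qed

lemma loc_subset_tuples: "b \<in> tuples (univ Z) \<sigma> \<Longrightarrow> loc Z A \<sigma> b \<subseteq> tuples (univ Z) \<sigma>"
  by (rule loc_subset) simp

end

section \<open>Transfer to the prime model\<close>

fun exs :: "'s list \<Rightarrow> ('s, 'a) fm \<Rightarrow> ('s, 'a) fm" where
  "exs [] \<phi> = \<phi>"
| "exs (s # \<sigma>) \<phi> = exs \<sigma> (Ex s \<phi>)"

text \<open>The head of the signature is quantified innermost. As each quantifier prepends, the
  witnesses end up in the order of the signature.\<close>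

lemma sat_exs: "sat D (exs \<sigma> \<phi>) xs \<longleftrightarrow> (\<exists>a\<in>tuples D \<sigma>. sat D \<phi> (a @ xs))"
proof (induction \<sigma> arbitrary: \<phi>)
  case (Cons s \<sigma>)
  have "sat D (exs (s # \<sigma>) \<phi>) xs \<longleftrightarrow> (\<exists>a\<in>tuples D \<sigma>. \<exists>x\<in>D s. sat D \<phi> (x # a @ xs))"
    by (simp add: Cons.IH)
  also have "\<dots> \<longleftrightarrow> (\<exists>a\<in>tuples D (s # \<sigma>). sat D \<phi> (a @ xs))"
    by (fastforce simp: tuples_Cons)
  finally show ?case .
qed simp

lemma well_sorted_exs: "well_sorted D L \<tau> (exs \<sigma> \<phi>) \<longleftrightarrow> well_sorted D L (\<sigma> @ \<tau>) \<phi>"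
  by (induction \<sigma> arbitrary: \<phi>) auto

lemma params_exs [simp]: "params (exs \<sigma> \<phi>) = params \<phi>"
  by (induction \<sigma> arbitrary: \<phi>) auto

lemma fm_sorts_exs: "fm_sorts (exs \<sigma> \<phi>) = set \<sigma> \<union> fm_sorts \<phi>"
  by (induction \<sigma> arbitrary: \<phi>) auto

locale rcover =
  fixes K :: "('a, 'z) cover_scheme"
  assumes regular: "regular_cover K"
begin

sublocale zmodel K
  using regular unfolding regular_cover_def by unfold_locales blast

text \<open>Elementarity is used twice: the existential closure passes down to the named elements,
  and the formula at the witness found there passes back up.\<close>

lemma nonempty_definable_has_named_point:
  assumes prime: "base_prime_model_named K"
    and X: "definable_over K {} (replicate n Base) X" "X \<noteq> {}"
  shows "\<exists>a\<in>X. set a \<subseteq> (\<Union>s. named K s)"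
proof -
  obtain \<phi> where \<phi>: "formula_over K {} (replicate n Base) \<phi>" "fm_sorts \<phi> \<subseteq> set (replicate n Base)"
    "X = solutions K (replicate n Base) \<phi>"
    using definable_by_own_sorts[OF X(1)] by (elim exE conjE) (rule that)
  have sorts: "fm_sorts \<phi> \<subseteq> {Base}" using \<phi>(2) by auto
  let ?\<psi> = "exs (replicate n Base) \<phi>"
  have "sat (univ K) ?\<psi> []" using X(2) unfolding \<phi>(3) by (auto simp: sat_exs solutions_def)
  moreover have "formula_over K {} (replicate 0 Base) ?\<psi>"
    using \<phi>(1) by (simp add: formula_over_def well_sorted_exs)
  moreover have "fm_sorts ?\<psi> \<subseteq> {Base}" using sorts by (auto simp: fm_sorts_exs)
  ultimately have "sat (named K) ?\<psi> []"
    using prime unfolding base_prime_model_named_def by (metis tuples_Nil replicate_0 singletonI)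
  then obtain a where a: "a \<in> tuples (named K) (replicate n Base)" "sat (named K) \<phi> a"
    by (auto simp: sat_exs)
  then have "sat (univ K) \<phi> a"
    using prime \<phi>(1) sorts unfolding base_prime_model_named_def by metis
  moreover have "named K Base \<subseteq> univ K Base" using model unfolding zariski_model_def by blast
  then have "a \<in> tuples (univ K) (replicate n Base)" using a(1) by (auto simp: tuples_iff)
  moreover have "set a \<subseteq> (\<Union>s. named K s)" using a(1) by (fastforce simp: tuples_iff in_set_conv_nth)
  ultimately show ?thesis unfolding \<phi>(3) solutions_def by blast
qed

text \<open>The named points of \<open>X\<close> form a finite, hence 0-definable set. If anything
  remained after removing them, the remainder would be 0-definable and nonempty, and so would have a
  named point.\<close>

lemma finite_definable_named:
  assumes prime: "base_prime_model_named K"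
    and X: "definable_over K {} (replicate n Base) X" "finite X" and a: "a \<in> X"
  shows "set a \<subseteq> (\<Union>s. named K s)"
proof (rule ccontr)
  assume na: "\<not> set a \<subseteq> (\<Union>s. named K s)"
  let ?X0 = "{x \<in> X. set x \<subseteq> (\<Union>s. named K s)}"
  have "definable_over K {} (replicate n Base) ?X0"
    using X(2) definable_over_subset[OF X(1)] by (intro definable_over_finite) auto
  then have "definable_over K {} (replicate n Base) (X - ?X0)"
    by (rule definable_over_Diff[OF X(1)])
  moreover have "X - ?X0 \<noteq> {}" using a na by blast
  ultimately show False using nonempty_definable_has_named_point[OF prime] by blast
qed

section \<open>Translates and stabilisers of loci\<close>

lemma group_grp: "group (grp K)"
  using regular unfolding regular_cover_def zariski_group_def by blast

lemma group_action_act: "group_action (grp K) (univ K Cover) (act K)"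
  using regular unfolding regular_cover_def morphic_action_def by blast

lemma grp_subset_tuples: "carrier (grp K) \<subseteq> tuples (univ K) (grp_sig K)"
  using regular definable_over_subset unfolding regular_cover_def zariski_group_def by blast

lemma length_grp: "g \<in> carrier (grp K) \<Longrightarrow> length g = grp_len K"
  using grp_subset_tuples length_tuples by fastforce

lemma set_grp: "g \<in> carrier (grp K) \<Longrightarrow> set g \<subseteq> univ K Base"
  using grp_subset_tuples by (fastforce simp: tuples_iff in_set_conv_nth)

lemma act_closed: "g \<in> carrier (grp K) \<Longrightarrow> x \<in> univ K Cover \<Longrightarrow> act K g x \<in> univ K Cover"
  using group_action.element_image[OF group_action_act] by blast

lemma act_mult:
  "g \<in> carrier (grp K) \<Longrightarrow> h \<in> carrier (grp K) \<Longrightarrow> x \<in> univ K Cover \<Longrightarrow>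
    act K (g \<otimes>\<^bsub>grp K\<^esub> h) x = act K g (act K h x)"
  using group_action.composition_rule[OF group_action_act] by metis

lemma act_one: "x \<in> univ K Cover \<Longrightarrow> act K \<one>\<^bsub>grp K\<^esub> x = x"
  using group_action.id_eq_one[OF group_action_act] by (metis restrict_apply')

lemma act_cancel:
  assumes "g \<in> carrier (grp K)" "h \<in> carrier (grp K)" "x \<in> univ K Cover" "act K g x = act K h x"
  shows "g = h"
proof -
  obtain d where "\<forall>g\<in>carrier (grp K). \<forall>x\<in>univ K Cover. d [x, act K g x] = g"
    using regular unfolding regular_cover_def free_action_def by blast
  then show ?thesis using assms by metis
qed

lemma proj_eq_iff:
  assumes "x \<in> univ K Cover" "y \<in> univ K Cover"
  shows "proj K y = proj K x \<longleftrightarrow> (\<exists>g\<in>carrier (grp K). y = act K g x)"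
proof -
  have "{y \<in> univ K Cover. proj K y = proj K x} = orbit (grp K) (act K) x"
    using regular assms unfolding regular_cover_def by blast
  then show ?thesis using assms unfolding orbit_def by blast
qed

lemma definable_act_graph:
  "definable_over K {} (grp_sig K @ [Cover, Cover])
    {g @ [x, act K g x] | g x. g \<in> carrier (grp K) \<and> x \<in> univ K Cover}"
  using regular unfolding regular_cover_def morphic_action_def by blast

text \<open>
  The preimage \<open>W\<close> of a closed set under the action is only relatively closed, as \<open>grp K\<close> need not be
  closed. Its closure is a predicate of the language and has the same fibres over \<open>grp K\<close>.
\<close>

lemma act_preimage:
  assumes P: "P \<in> rels K (Cover # \<tau>)"
  shows "\<exists>Q\<in>rels K (grp_sig K @ Cover # \<tau>).
    \<forall>g\<in>carrier (grp K). \<forall>c\<in>univ K Cover. \<forall>t\<in>tuples (univ K) \<tau>.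
      g @ c # t \<in> Q \<longleftrightarrow> act K g c # t \<in> P"
proof -
  let ?G = "carrier (grp K)" and ?C = "univ K Cover" and ?l = "grp_len K" and ?D = "univ K"
  let ?\<Gamma> = "{g @ [x, act K g x] | g x. g \<in> ?G \<and> x \<in> ?C}"
  let ?GC = "{g @ [x] | g x. g \<in> ?G \<and> x \<in> ?C}"
  let ?GCT = "{x @ y | x y. x \<in> ?GC \<and> y \<in> tuples ?D \<tau>}"
  let ?f' = "\<lambda>z. [act K (take ?l (take (length (grp_sig K @ [Cover])) z)) (take (length (grp_sig K @ [Cover])) z ! ?l)]
    @ drop (length (grp_sig K @ [Cover])) z"
  define W where "W = {g @ c # t | g c t. g \<in> ?G \<and> c \<in> ?C \<and> t \<in> tuples ?D \<tau> \<and> act K g c # t \<in> P}"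
  have WI: "g @ c # t \<in> W" if "g \<in> ?G" "c \<in> ?C" "t \<in> tuples ?D \<tau>" "act K g c # t \<in> P" for g c t
    unfolding W_def using that by blast
  have dP: "definable_over K {} (Cover # \<tau>) P" and cP: "closedin (zar K (Cover # \<tau>)) P"
    using P by (auto simp: rels_iff)
  have "closedin (subtopology (zar K (grp_sig K @ Cover # \<tau>)) ?GCT) W"
  proof -
    have "morphism K (grp_sig K @ [Cover]) ?GC [Cover] (tuples ?D [Cover])
        (\<lambda>z. [act K (take ?l z) (z ! ?l)])"
      using regular unfolding regular_cover_def morphic_action_def by blast
    then have cont: "continuous_map (sort_times K (grp_sig K @ [Cover]) ?GC \<tau>)
        (sort_times K [Cover] (tuples ?D [Cover]) \<tau>) ?f'"
      unfolding morphism_def by blast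
    have "P \<subseteq> {x @ y | x y. x \<in> tuples ?D [Cover] \<and> y \<in> tuples ?D \<tau>}"
    proof
      fix p assume "p \<in> P"
      then have "p \<in> tuples ?D ([Cover] @ \<tau>)" using definable_over_subset[OF dP] by auto
      then show "p \<in> {x @ y | x y. x \<in> tuples ?D [Cover] \<and> y \<in> tuples ?D \<tau>}"
        by (rule tuples_appendE) blast
    qed
    then have "closedin (sort_times K [Cover] (tuples ?D [Cover]) \<tau>) P"
      unfolding sort_times_def closedin_subtopology using cP by auto
    from closedin_continuous_map_preimage[OF cont this]
    have pre: "closedin (sort_times K (grp_sig K @ [Cover]) ?GC \<tau>)
        {z \<in> topspace (sort_times K (grp_sig K @ [Cover]) ?GC \<tau>). ?f' z \<in> P}" .
    have "?GCT \<subseteq> tuples ?D ((grp_sig K @ [Cover]) @ \<tau>)"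
    proof
      fix z assume "z \<in> ?GCT"
      then obtain g x y where z: "z = (g @ [x]) @ y" "g \<in> ?G" "x \<in> ?C" "y \<in> tuples ?D \<tau>" by blast
      show "z \<in> tuples ?D ((grp_sig K @ [Cover]) @ \<tau>)"
        unfolding z(1) using z grp_subset_tuples by (intro append_in_tuplesI) auto
    qed
    then have top: "topspace (sort_times K (grp_sig K @ [Cover]) ?GC \<tau>) = ?GCT"
      unfolding sort_times_def topspace_subtopology topspace_eq by blast
    have W: "{z \<in> ?GCT. ?f' z \<in> P} = W"
    proof -
      have f': "?f' ((g @ [c]) @ t) = act K g c # t" if "g \<in> ?G" for g c t
        using length_grp[OF that] by (simp add: nth_append)
      show ?thesis
      proof (intro equalityI subsetI)
        fix z assume z: "z \<in> {z \<in> ?GCT. ?f' z \<in> P}"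
        then obtain g c t where g: "z = (g @ [c]) @ t" "g \<in> ?G" "c \<in> ?C" "t \<in> tuples ?D \<tau>"
          by (elim CollectE conjE exE) (rule that, simp_all)
        moreover from z have "?f' z \<in> P" by (elim CollectE conjE)
        then have "act K g c # t \<in> P" unfolding g(1) f'[OF g(2)] .
        ultimately show "z \<in> W" unfolding W_def by auto
      next
        fix z assume "z \<in> W"
        then obtain g c t where g: "z = (g @ [c]) @ t" "g \<in> ?G" "c \<in> ?C" "t \<in> tuples ?D \<tau>"
          "act K g c # t \<in> P"
          unfolding W_def by (elim CollectE conjE exE) (rule that, simp_all)
        have 1: "?f' z \<in> P" unfolding g(1) f'[OF g(2)] by (rule g(5))
        have 2: "z \<in> ?GCT" using g(1-4) by blast
        show "z \<in> {z \<in> ?GCT. ?f' z \<in> P}" by (rule CollectI) (rule conjI[OF 2 1])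
      qed
    qed
    show ?thesis
      using pre unfolding top W by (simp only: sort_times_def append.assoc append_Cons append_Nil)
  qed
  then obtain F where F: "closedin (zar K (grp_sig K @ Cover # \<tau>)) F" "W = F \<inter> ?GCT"
    unfolding closedin_subtopology by (elim exE conjE) (rule that)
  let ?Q = "(zar K (grp_sig K @ Cover # \<tau>)) closure_of W"
  have "definable_over K {} (grp_sig K @ Cover # \<tau>) W"
  proof -
    let ?\<sigma> = "[Cover] @ grp_sig K @ Cover # \<tau>"
    \<comment> \<open>The leading coordinate stands for the value \<open>act K g c\<close>. The
      first condition puts it on the graph of the action, the second puts it in front of
      \<open>t\<close> into \<open>P\<close>; quantifying it away leaves \<open>W\<close>.\<close>
    define E where "E = {w \<in> tuples ?D ?\<sigma>. map (tm_val w) (vars 1 (Suc ?l) @ vars 0 1) \<in> ?\<Gamma>} \<inter>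
      {w \<in> tuples ?D ?\<sigma>. map (tm_val w) (vars 0 1 @ vars (?l + 2) (length \<tau>)) \<in> P}"
    have "list_all2 (tm_has_sort ?D ?\<sigma>) (vars 1 (Suc ?l)) (grp_sig K @ [Cover])"
      by (rule vars_sorted) auto
    moreover have "list_all2 (tm_has_sort ?D ?\<sigma>) (vars 0 1) [Cover]"
      by (rule vars_sorted) auto
    ultimately have s1: "list_all2 (tm_has_sort ?D ?\<sigma>) (vars 1 (Suc ?l) @ vars 0 1) (grp_sig K @ [Cover, Cover])"
      using list_all2_appendI by fastforce
    have "list_all2 (tm_has_sort ?D ?\<sigma>) (vars 0 1 @ vars (?l + 2) (length \<tau>)) ([Cover] @ \<tau>)"
      by (intro list_all2_appendI vars_sorted) auto
    then have s2: "list_all2 (tm_has_sort ?D ?\<sigma>) (vars 0 1 @ vars (?l + 2) (length \<tau>)) (Cover # \<tau>)"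
      by simp
    have "definable_over K {} ?\<sigma> E"
      unfolding E_def
      by (intro definable_over_Int definable_over_subst[OF definable_act_graph s1] definable_over_subst[OF dP s2])
        (auto simp: vars_def)
    from definable_over_Ex[OF this]
    have "definable_over K {} (grp_sig K @ Cover # \<tau>)
      {z \<in> tuples ?D (grp_sig K @ Cover # \<tau>). \<exists>y\<in>tuples ?D [Cover]. y @ z \<in> E}" .
    moreover have "{z \<in> tuples ?D (grp_sig K @ Cover # \<tau>). \<exists>y\<in>tuples ?D [Cover]. y @ z \<in> E} = W"
    proof -
      have E: "y # g @ c # t \<in> E \<longleftrightarrow> g @ [c, y] \<in> ?\<Gamma> \<and> y # t \<in> P"
        if "y \<in> ?C" "g \<in> tuples ?D (grp_sig K)" "c \<in> ?C" "t \<in> tuples ?D \<tau>" for y g c t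
      proof -
        have "length g = ?l" using length_tuples[OF that(2)] by simp
        then show ?thesis
          using that by (simp add: E_def map_tm_val_vars length_tuples append_in_tuples)
      qed
      have \<Gamma>: "g @ [c, y] \<in> ?\<Gamma> \<longleftrightarrow> g \<in> ?G \<and> c \<in> ?C \<and> y = act K g c" for g c y
        by auto
      show ?thesis
      proof (intro equalityI subsetI)
        fix z assume "z \<in> {z \<in> tuples ?D (grp_sig K @ Cover # \<tau>). \<exists>y\<in>tuples ?D [Cover]. y @ z \<in> E}"
        then obtain y where z: "z \<in> tuples ?D (grp_sig K @ Cover # \<tau>)" "y \<in> ?C" "y # z \<in> E"
          by (auto simp: tuples_Cons)
        obtain g ct where "z = g @ ct" "g \<in> tuples ?D (grp_sig K)" "ct \<in> tuples ?D (Cover # \<tau>)"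
          using z(1) by (rule tuples_appendE)
        then obtain c t where zt: "z = g @ c # t" "c \<in> ?C" "t \<in> tuples ?D \<tau>" "g \<in> tuples ?D (grp_sig K)"
          by (auto simp: tuples_Cons)
        have "g @ [c, y] \<in> ?\<Gamma>" "y # t \<in> P"
          using z(3) E[OF z(2) zt(4,2,3)] unfolding zt(1) by blast+
        then have "g \<in> ?G" "act K g c # t \<in> P" unfolding \<Gamma> by blast+
        then show "z \<in> W" unfolding zt(1) using zt(2,3) by (intro WI)
      next
        fix z assume "z \<in> W"
        then obtain g c t where z: "z = g @ c # t" "g \<in> ?G" "c \<in> ?C" "t \<in> tuples ?D \<tau>" "act K g c # t \<in> P"
          unfolding W_def by blast
        have g: "g \<in> tuples ?D (grp_sig K)" using z(2) grp_subset_tuples by blast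
        have "act K g c # g @ c # t \<in> E"
          using E[OF act_closed[OF z(2,3)] g z(3,4)] z \<Gamma> by blast
        then show "z \<in> {z \<in> tuples ?D (grp_sig K @ Cover # \<tau>). \<exists>y\<in>tuples ?D [Cover]. y @ z \<in> E}"
          using z g act_closed[OF z(2,3)]
          by (auto intro!: append_in_tuplesI bexI[of _ "[act K g c]"])
      qed
    qed
    ultimately show ?thesis by simp
  qed
  then have QR: "?Q \<in> rels K (grp_sig K @ Cover # \<tau>)" and WT: "W \<subseteq> tuples ?D (grp_sig K @ Cover # \<tau>)"
    using definable_over_closure definable_over_subset by blast+
  have Q: "g @ c # t \<in> ?Q \<longleftrightarrow> act K g c # t \<in> P"
    if "g \<in> ?G" "c \<in> ?C" "t \<in> tuples ?D \<tau>" for g c t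
  proof
    assume "act K g c # t \<in> P"
    then have "g @ c # t \<in> W" using that by (intro WI)
    then show "g @ c # t \<in> ?Q" using closure_of_subset[of W "zar K (grp_sig K @ Cover # \<tau>)"] WT
      by (auto simp: topspace_eq)
  next
    assume "g @ c # t \<in> ?Q"
    \<comment> \<open>The closure adds nothing over \<open>G\<close>: it lies in \<open>F\<close>,
      which cuts out \<open>W\<close> there.\<close>
    moreover have "?Q \<subseteq> F" using F by (intro closure_of_minimal) auto
    moreover have "g @ c # t = (g @ [c]) @ t" by simp
    then have "g @ c # t \<in> ?GCT" using that by blast
    ultimately have "g @ c # t \<in> W" using F(2) by blast
    then obtain g' c' t' where eq: "g @ c # t = g' @ c' # t'" and g': "g' \<in> ?G" and "act K g' c' # t' \<in> P"
      unfolding W_def by blast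
    moreover have "length g = length g'" using that(1) g' by (simp add: length_grp)
    ultimately show "act K g c # t \<in> P" by simp
  qed
  show ?thesis by (rule bexI[OF _ QR]) (intro ballI Q)
qed

text \<open>The preimage is a fibre of the predicate given by \<open>act_preimage\<close>. Its
  parameters are those of \<open>X\<close> and the entries of \<open>g\<close>, which lie in
  \<open>M\<close> and hence in \<open>A\<close>.\<close>

lemma closed_over_act_coordinate:
  assumes X: "closed_over K A \<sigma> X" and A: "univ K Base \<subseteq> A"
    and i: "i < length \<sigma>" "\<sigma> ! i = Cover" and g: "g \<in> carrier (grp K)"
  shows "closed_over K A \<sigma> {x \<in> tuples (univ K) \<sigma>. x[i := act K g (x ! i)] \<in> X}"
proof -
  let ?D = "univ K"
  obtain \<rho> a P where a: "a \<in> tuples ?D \<rho>" "set a \<subseteq> A \<union> (\<Union>s. named K s)"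
    and P: "P \<in> rels K (\<rho> @ \<sigma>)" and XP: "X = {x \<in> tuples ?D \<sigma>. a @ x \<in> P}"
    using X by (rule closed_over_abstract)
  let ?\<tau> = "\<rho> @ \<sigma>"
  \<comment> \<open>Position \<open>i\<close> of \<open>x\<close> reads the new leading variable.
    Thus \<open>P'\<close> says of \<open>c # a @ x\<close> that \<open>x\<close> with its entry
    \<open>i\<close> overwritten by \<open>c\<close> lies in \<open>X\<close>.\<close>
  let ?ts = "(vars 1 (length ?\<tau>))[length \<rho> + i := Var 0] :: 'a tm list"
  have upd: "?\<tau>[length \<rho> + i := Cover] = ?\<tau>" using i by (simp add: list_update_append list_update_same_conv)
  have "list_all2 (tm_has_sort ?D (Cover # ?\<tau>)) ?ts (?\<tau>[length \<rho> + i := Cover])"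
    by (intro list_all2_update_cong vars_sorted) auto
  then have s: "list_all2 (tm_has_sort ?D (Cover # ?\<tau>)) ?ts ?\<tau>" unfolding upd .
  define P' where "P' = {w \<in> tuples ?D (Cover # ?\<tau>). map (tm_val w) ?ts \<in> P}"
  have "P' \<in> rels K (Cover # ?\<tau>)"
    unfolding P'_def
    by (intro closed_over_rels closed_over_Rel[OF P s])
      (use set_update_subset_insert[of "vars 1 (length ?\<tau>)" "length \<rho> + i" "Var 0 :: 'a tm"] in
        \<open>auto simp: vars_def\<close>)
  then obtain Q where Q: "Q \<in> rels K (grp_sig K @ Cover # ?\<tau>)" and
    Q': "\<And>g c t. g \<in> carrier (grp K) \<Longrightarrow> c \<in> ?D Cover \<Longrightarrow> t \<in> tuples ?D ?\<tau> \<Longrightarrow>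
      g @ c # t \<in> Q \<longleftrightarrow> act K g c # t \<in> P'"
    using act_preimage by blast
  have P'': "c # a @ x \<in> P' \<longleftrightarrow> x[i := c] \<in> X" if "c \<in> ?D Cover" "x \<in> tuples ?D \<sigma>" for c x
  proof -
    have "x[i := c] \<in> tuples ?D \<sigma>" using that i by (auto simp: tuples_iff nth_list_update)
    then show ?thesis
      using that a(1) by (simp add: P'_def XP map_update map_tm_val_vars length_tuples append_in_tuples list_update_append)
  qed
  \<comment> \<open>The entry \<open>x ! i\<close> occurs twice: as the point that \<open>g\<close>
    moves, and at its old place, where the result overwrites it.\<close>
  let ?us = "map Const g @ vars i 1 @ map Const a @ vars 0 (length \<sigma>)"
  have "list_all2 (tm_has_sort ?D \<sigma>) ?us (grp_sig K @ [Cover] @ \<rho> @ \<sigma>)"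
  proof (intro list_all2_appendI)
    show "list_all2 (tm_has_sort ?D \<sigma>) (map Const g) (grp_sig K)"
      using g grp_subset_tuples by (auto simp: Const_sorted)
    show "list_all2 (tm_has_sort ?D \<sigma>) (vars i 1) [Cover]"
      using i by (intro vars_sorted) (auto simp: take_Suc_conv_app_nth hd_drop_conv_nth take_Suc)
    show "list_all2 (tm_has_sort ?D \<sigma>) (map Const a) \<rho>" using a by (simp add: Const_sorted)
  qed (simp add: vars_sorted)
  then have "list_all2 (tm_has_sort ?D \<sigma>) ?us (grp_sig K @ Cover # ?\<tau>)" by simp
  moreover have "(\<Union>t\<in>set ?us. tm_params t) \<subseteq> A \<union> (\<Union>s. named K s)"
    using set_grp[OF g] A a(2) by (auto simp: vars_def)
  ultimately have "closed_over K A \<sigma> {x \<in> tuples ?D \<sigma>. map (tm_val x) ?us \<in> Q}"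
    by (rule closed_over_Rel[OF Q])
  moreover have "map (tm_val x) ?us \<in> Q \<longleftrightarrow> x[i := act K g (x ! i)] \<in> X" if x: "x \<in> tuples ?D \<sigma>" for x
  proof -
    have xi: "x ! i \<in> ?D Cover" using x i by (auto simp: tuples_iff)
    have "map (tm_val x) ?us = g @ x ! i # a @ x"
      using x i length_tuples[OF x] by (simp add: map_tm_val_vars take_Suc hd_drop_conv_nth)
    then show ?thesis
      using Q'[OF g xi append_in_tuplesI[OF a(1) x]] P''[OF act_closed[OF g xi] x] by simp
  qed
  ultimately show ?thesis by (simp cong: conj_cong)
qed

lemma power_act_in_tuples:
  "x \<in> tuples (univ K) (replicate n Cover) \<Longrightarrow> \<forall>i<n. g i \<in> carrier (grp K) \<Longrightarrow>
    power_act K g x \<in> tuples (univ K) (replicate n Cover)"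
  by (auto simp: tuples_iff power_act_def act_closed)

lemma power_act_mult:
  "x \<in> tuples (univ K) (replicate n Cover) \<Longrightarrow> \<forall>i<n. g i \<in> carrier (grp K) \<Longrightarrow>
    \<forall>i<n. h i \<in> carrier (grp K) \<Longrightarrow>
    power_act K g (power_act K h x) = power_act K (\<lambda>i. g i \<otimes>\<^bsub>grp K\<^esub> h i) x"
  by (auto simp: tuples_iff power_act_def act_mult)

lemma power_act_inv:
  assumes "x \<in> tuples (univ K) (replicate n Cover)" "\<forall>i<n. g i \<in> carrier (grp K)"
  shows "power_act K g (power_act K (\<lambda>i. inv\<^bsub>grp K\<^esub> (g i)) x) = x"
    and "power_act K (\<lambda>i. inv\<^bsub>grp K\<^esub> (g i)) (power_act K g x) = x"
proof -
  interpret group "grp K" by (rule group_grp)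
  show "power_act K g (power_act K (\<lambda>i. inv\<^bsub>grp K\<^esub> (g i)) x) = x"
    using assms
    by (intro nth_equalityI) (auto simp: tuples_iff power_act_def simp flip: act_mult, simp add: act_one)
  show "power_act K (\<lambda>i. inv\<^bsub>grp K\<^esub> (g i)) (power_act K g x) = x"
    using assms
    by (intro nth_equalityI) (auto simp: tuples_iff power_act_def simp flip: act_mult, simp add: act_one)
qed

text \<open>Only one coordinate can be moved at a time; \<open>p j\<close> is the action on the
  first \<open>j\<close> of them.\<close>

lemma closed_over_power_act:
  assumes X: "closed_over K A (replicate n Cover) X" and A: "univ K Base \<subseteq> A"
    and g: "\<forall>i<n. g i \<in> carrier (grp K)"
  shows "closed_over K A (replicate n Cover) {x \<in> tuples (univ K) (replicate n Cover). power_act K g x \<in> X}"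
proof -
  let ?\<sigma> = "replicate n Cover" and ?D = "univ K"
  define p where "p j x = map (\<lambda>i. if i < j then act K (g i) (x ! i) else x ! i) [0..<n]" for j x
  have "closed_over K A ?\<sigma> {x \<in> tuples ?D ?\<sigma>. p j x \<in> X}" if "j \<le> n" for j
    using that
  proof (induction j)
    case 0
    have "p 0 x = x" if "x \<in> tuples ?D ?\<sigma>" for x
      using length_tuples[OF that] by (auto simp: p_def intro: nth_equalityI)
    then have "{x \<in> tuples ?D ?\<sigma>. p 0 x \<in> X} = X"
      using definable_over_subset[OF definable_closed_over[OF X]] by auto
    then show ?case using X by simp
  next
    case (Suc j)
    let ?Y = "{x \<in> tuples ?D ?\<sigma>. p j x \<in> X}"
    have gj: "g j \<in> carrier (grp K)" using g Suc by simp
    have "closed_over K A ?\<sigma> {x \<in> tuples ?D ?\<sigma>. x[j := act K (g j) (x ! j)] \<in> ?Y}"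
      using Suc by (intro closed_over_act_coordinate[OF _ A]) (auto simp: gj)
    moreover have "x[j := act K (g j) (x ! j)] \<in> ?Y \<longleftrightarrow> p (Suc j) x \<in> X" if x: "x \<in> tuples ?D ?\<sigma>" for x
    proof -
      have "x[j := act K (g j) (x ! j)] \<in> tuples ?D ?\<sigma>"
        using x Suc.prems gj by (auto simp: tuples_iff nth_list_update act_closed)
      moreover have "p j (x[j := act K (g j) (x ! j)]) = p (Suc j) x"
        using length_tuples[OF x] Suc.prems
        by (intro nth_equalityI) (auto simp: p_def nth_list_update less_Suc_eq)
      ultimately show ?thesis by simp
    qed
    ultimately show ?case by (simp cong: conj_cong)
  qed
  from this[of n] have "closed_over K A ?\<sigma> {x \<in> tuples ?D ?\<sigma>. p n x \<in> X}" by simp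
  moreover have "p n x = power_act K g x" if "x \<in> tuples ?D ?\<sigma>" for x
    using length_tuples[OF that] by (auto simp: p_def power_act_def)
  ultimately show ?thesis by (simp cong: conj_cong)
qed

text \<open>Closedness is tested after pulling back along the quotient map on the second coordinate.
  There the graph becomes the orbit relation, which is closed because the action is free.\<close>

lemma proj_graph_rels: "{[x, proj K x] | x. x \<in> univ K Cover} \<in> rels K [Cover, Base]"
proof -
  let ?\<Gamma> = "{[x, proj K x] | x. x \<in> univ K Cover}"
  have q: "quotient_map (zar K [Cover, Cover]) (zar K [Cover, Base]) (proj_at K [Cover, Base])"
  proof -
    have "\<forall>\<sigma>. quotient_map (zar K (replicate (length \<sigma>) Cover)) (zar K \<sigma>) (proj_at K \<sigma>)"
      using regular unfolding regular_cover_def by blast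
    from spec[OF this, of "[Cover, Base]"] show ?thesis by (simp add: numeral_2_eq_2)
  qed
  have proj: "proj K ` univ K Cover = univ K Base" using regular unfolding regular_cover_def by blast
  have pre: "{z \<in> topspace (zar K [Cover, Cover]). proj_at K [Cover, Base] z \<in> ?\<Gamma>} = orbit_relation K"
  proof (intro equalityI subsetI)
    fix z assume "z \<in> {z \<in> topspace (zar K [Cover, Cover]). proj_at K [Cover, Base] z \<in> ?\<Gamma>}"
    then obtain x y where z: "z = [x, y]" "x \<in> univ K Cover" "y \<in> univ K Cover" "proj K y = proj K x"
      by (auto simp: topspace_eq tuples_Cons proj_at_def)
    then show "z \<in> orbit_relation K" using proj_eq_iff[OF z(2,3)] by (auto simp: orbit_relation_def)
  next
    fix z assume "z \<in> orbit_relation K"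
    then obtain g x where z: "z = [x, act K g x]" "g \<in> carrier (grp K)" "x \<in> univ K Cover"
      by (auto simp: orbit_relation_def)
    then have "proj K (act K g x) = proj K x" using proj_eq_iff[of x "act K g x"] act_closed by blast
    then show "z \<in> {z \<in> topspace (zar K [Cover, Cover]). proj_at K [Cover, Base] z \<in> ?\<Gamma>}"
      using z act_closed by (auto simp: topspace_eq proj_at_def)
  qed
  have cl: "closedin (zar K [Cover, Cover]) (orbit_relation K)"
    using regular unfolding regular_cover_def free_action_def by blast
  have sub: "?\<Gamma> \<subseteq> topspace (zar K [Cover, Base])" using proj by (auto simp: topspace_eq)
  have "closedin (zar K [Cover, Base]) ?\<Gamma>"
    using q[unfolded quotient_map_closedin, THEN conjunct2, THEN spec, THEN mp, OF sub] cl
    unfolding pre by (rule iffD1)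
  then show ?thesis using regular by (simp add: rels_iff regular_cover_def)
qed

lemma closed_over_fibre:
  assumes A: "univ K Base \<subseteq> A" and b: "b \<in> tuples (univ K) (replicate n Cover)"
  shows "closed_over K A (replicate n Cover)
    {c \<in> tuples (univ K) (replicate n Cover). map (proj K) c = map (proj K) b}"
proof -
  let ?\<sigma> = "replicate n Cover" and ?D = "univ K"
  have "closed_over K A ?\<sigma> {c \<in> tuples ?D ?\<sigma>. \<forall>i<j. proj K (c ! i) = proj K (b ! i)}" if "j \<le> n" for j
    using that
  proof (induction j)
    case (Suc j)
    have bj: "b ! j \<in> ?D Cover" using b Suc.prems by (auto simp: tuples_iff)
    then have pb: "proj K (b ! j) \<in> ?D Base" using regular unfolding regular_cover_def by blast
    have "closed_over K A ?\<sigma>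
        {c \<in> tuples ?D ?\<sigma>. map (tm_val c) [Var j, Const (proj K (b ! j))] \<in> {[x, proj K x] | x. x \<in> ?D Cover}}"
      using Suc.prems pb A by (intro closed_over_Rel[OF proj_graph_rels]) auto
    moreover have "map (tm_val c) [Var j, Const (proj K (b ! j))] \<in> {[x, proj K x] | x. x \<in> ?D Cover} \<longleftrightarrow>
        proj K (c ! j) = proj K (b ! j)" if "c \<in> tuples ?D ?\<sigma>" for c
      using that Suc.prems by (auto simp: tuples_iff)
    ultimately have "closed_over K A ?\<sigma> {c \<in> tuples ?D ?\<sigma>. proj K (c ! j) = proj K (b ! j)}"
      by (simp cong: conj_cong)
    from closed_over_Int[OF this Suc.IH] Suc.prems
    have "closed_over K A ?\<sigma> ({c \<in> tuples ?D ?\<sigma>. proj K (c ! j) = proj K (b ! j)} \<inter>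
      {c \<in> tuples ?D ?\<sigma>. \<forall>i<j. proj K (c ! i) = proj K (b ! i)})" by simp
    then show ?case by (rule back_subst[of "closed_over K A ?\<sigma>"]) (auto simp: less_Suc_eq)
  qed simp
  from this[of n] show ?thesis
    by (rule back_subst[of "closed_over K A ?\<sigma>"])
      (use length_tuples[OF b] in \<open>auto simp: list_eq_iff_nth_eq length_tuples\<close>)
qed

lemma fibre_eq_orbit:
  assumes "b \<in> tuples (univ K) (replicate n Cover)" "c \<in> tuples (univ K) (replicate n Cover)"
    and "map (proj K) c = map (proj K) b"
  obtains g where "\<forall>i<n. g i \<in> carrier (grp K)" "c = power_act K g b"
proof -
  have "\<forall>i\<in>{..<n}. \<exists>h. h \<in> carrier (grp K) \<and> c ! i = act K h (b ! i)"
  proof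
    fix i assume i: "i \<in> {..<n}"
    have "proj K (c ! i) = proj K (b ! i)"
      using assms(3) i length_tuples[OF assms(1)] length_tuples[OF assms(2)] by (simp add: list_eq_iff_nth_eq)
    then show "\<exists>h. h \<in> carrier (grp K) \<and> c ! i = act K h (b ! i)"
      using proj_eq_iff[of "b ! i" "c ! i"] assms(1,2) i by (auto simp: tuples_iff)
  qed
  from bchoice[OF this] obtain g
    where g: "\<forall>i\<in>{..<n}. g i \<in> carrier (grp K) \<and> c ! i = act K (g i) (b ! i)"
    by (elim exE) (rule that)
  have "c = power_act K g b"
    using g length_tuples[OF assms(1)] length_tuples[OF assms(2)]
    by (intro nth_equalityI) (auto simp: power_act_def)
  then show ?thesis using g by (intro that[of g]) auto
qed

end

section \<open>The stabiliser of a locus\<close>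

locale locus = rcover +
  fixes A :: "'a set" and n :: nat and b :: "'a list"
  assumes base: "univ K Base \<subseteq> A" and b: "b \<in> tuples (univ K) (replicate n Cover)"
begin

abbreviation "L \<equiv> loc K A (replicate n Cover) b"

text \<open>Only the base point is required to stay in \<open>L\<close>; that all of
  \<open>L\<close> is preserved is derived. Values at indices from \<open>n\<close> on are
  unconstrained, so that products and inverses are taken pointwise, and \<open>S_cong\<close>
  changes representatives.\<close>

definition S :: "(nat \<Rightarrow> 'a list) set" where
  "S = {g. (\<forall>i<n. g i \<in> carrier (grp K)) \<and> power_act K g b \<in> L}"

lemma L_tuples: "L \<subseteq> tuples (univ K) (replicate n Cover)"
  using b by (rule loc_subset_tuples)

lemma L_fibre: "c \<in> L \<Longrightarrow> map (proj K) c = map (proj K) b"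
  using loc_subset[OF closed_over_fibre[OF base b], of b] b by blast

lemma L_orbit:
  assumes "c \<in> L"
  obtains g where "g \<in> S" "c = power_act K g b"
proof -
  obtain g where "\<forall>i<n. g i \<in> carrier (grp K)" "c = power_act K g b"
    using fibre_eq_orbit[OF b _ L_fibre] assms L_tuples by blast
  then show ?thesis using assms by (intro that[of g]) (auto simp: S_def)
qed

text \<open>The points that \<open>g\<close> moves into \<open>L\<close> form a set closed over
  \<open>A\<close> that contains \<open>b\<close>, so it contains the locus of
  \<open>b\<close>.\<close>

lemma S_L: "g \<in> S \<Longrightarrow> x \<in> L \<Longrightarrow> power_act K g x \<in> L"
  using loc_subset[OF closed_over_power_act[OF closed_over_loc[OF b] base, of g], of b] b
  by (auto simp: S_def)

text \<open>Since \<open>g L \<subseteq> L\<close>, the translates \<open>g\<^sup>m L\<close> form a descending chain.\<close>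

lemma S_inv_L:
  assumes g: "g \<in> S" and x: "x \<in> L"
  shows "power_act K (\<lambda>i. inv\<^bsub>grp K\<^esub> (g i)) x \<in> L"
proof -
  let ?h = "power_act K (\<lambda>i. inv\<^bsub>grp K\<^esub> (g i))" and ?g = "power_act K g" and ?\<sigma> = "replicate n Cover"
  let ?T = "tuples (univ K) ?\<sigma>"
  interpret group "grp K" by (rule group_grp)
  have gc: "\<forall>i<n. g i \<in> carrier (grp K)" using g by (simp add: S_def)
  then have hc: "\<forall>i<n. inv\<^bsub>grp K\<^esub> (g i) \<in> carrier (grp K)" by simp
  have hT: "(?h ^^ m) y \<in> ?T" if "y \<in> ?T" for m y
    using that by (induction m) (simp_all add: power_act_in_tuples[OF _ hc])
  have gT: "(?g ^^ m) y \<in> ?T" if "y \<in> ?T" for m y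
    using that by (induction m) (simp_all add: power_act_in_tuples[OF _ gc])
  \<comment> \<open>The translate \<open>g^m L\<close>, written as a preimage under the inverse so
    that it is visibly closed.\<close>
  define F where "F m = {y \<in> ?T. (?h ^^ m) y \<in> L}" for m
  have "closed_over K A ?\<sigma> (F m)" for m
  proof (induction m)
    case 0
    have "F 0 = L" using L_tuples by (auto simp: F_def)
    then show ?case using closed_over_loc[OF b] by simp
  next
    case (Suc m)
    have "F (Suc m) = {y \<in> ?T. ?h y \<in> F m}"
      unfolding F_def by (auto simp: funpow_swap1 power_act_in_tuples[OF _ hc])
    then show ?case using closed_over_power_act[OF Suc base hc] by simp
  qed
  then have "\<And>m. closedin (zar K ?\<sigma>) (F m)" by (rule closed_over_closedin)
  moreover have "decseq F"
  proof (rule decseq_SucI, rule subsetI)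
    fix m y assume y: "y \<in> F (Suc m)"
    then have "?g (?h ((?h ^^ m) y)) \<in> L" using S_L[OF g] by (simp add: F_def)
    then show "y \<in> F m" using y hT power_act_inv(1)[OF _ gc] by (simp add: F_def)
  qed
  ultimately obtain N where "\<forall>m\<ge>N. F m = F N" using dcc by blast
  then have FN: "F (Suc N) = F N" by (rule allE[of _ "Suc N"]) simp
  have cancel: "(?h ^^ m) ((?g ^^ m) y) = y" if "y \<in> ?T" for m y
    using that
  proof (induction m)
    case (Suc m)
    have "(?h ^^ Suc m) ((?g ^^ Suc m) y) = (?h ^^ m) (?h (?g ((?g ^^ m) y)))"
      by (simp add: funpow_swap1)
    then show ?case using Suc gT[of y m] power_act_inv(2)[OF _ gc] by simp
  qed simp
  have xT: "x \<in> ?T" using x L_tuples by blast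
  \<comment> \<open>\<open>g^N x\<close> lies in \<open>g^N L = g^(N+1) L\<close>; cancelling
    \<open>g^N\<close> puts \<open>x\<close> into \<open>g L\<close>.\<close>
  have "(?g ^^ N) x \<in> F N" using cancel[OF xT] gT[OF xT] x by (simp add: F_def)
  then have "(?g ^^ N) x \<in> F (Suc N)" using FN by simp
  then show ?thesis using cancel[OF xT] by (simp add: F_def)
qed

lemma S_one: "(\<lambda>i. \<one>\<^bsub>grp K\<^esub>) \<in> S"
proof -
  interpret group "grp K" by (rule group_grp)
  have "power_act K (\<lambda>i. \<one>\<^bsub>grp K\<^esub>) b = b"
    using b by (intro nth_equalityI) (auto simp: power_act_def tuples_iff act_one)
  then show ?thesis using mem_loc[of b] by (simp add: S_def)
qed

lemma S_mult: "g \<in> S \<Longrightarrow> h \<in> S \<Longrightarrow> (\<lambda>i. g i \<otimes>\<^bsub>grp K\<^esub> h i) \<in> S"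
proof -
  interpret group "grp K" by (rule group_grp)
  assume g: "g \<in> S" and h: "h \<in> S"
  then have "power_act K g (power_act K h b) \<in> L" using S_L[OF g] by (simp add: S_def)
  then show ?thesis using g h power_act_mult[OF b, of g h] by (simp add: S_def)
qed

lemma S_inv: "g \<in> S \<Longrightarrow> (\<lambda>i. inv\<^bsub>grp K\<^esub> (g i)) \<in> S"
proof -
  interpret group "grp K" by (rule group_grp)
  assume "g \<in> S"
  then show ?thesis using S_inv_L[of g b] mem_loc[of b] by (simp add: S_def)
qed

lemma S_cong:
  assumes "g \<in> S" "\<forall>i<n. g i = h i"
  shows "h \<in> S"
proof -
  have "power_act K g b = power_act K h b"
    using assms(2) length_tuples[OF b] by (simp add: power_act_def)
  then show ?thesis using assms by (simp add: S_def)
qed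

text \<open>For the converse let \<open>c = g b\<close> lie in \<open>X\<close>. The set of
  \<open>x\<close> with \<open>g x\<close> in \<open>X\<close> is closed over \<open>A\<close> and
  contains \<open>b\<close>, hence all of \<open>L\<close>, in particular the inverse translate of
  \<open>b\<close>. Moving that point by \<open>g\<close> returns \<open>b\<close>.\<close>

lemma same_closed_sets:
  assumes c: "c \<in> L" and X: "closed_over K A (replicate n Cover) X"
  shows "b \<in> X \<longleftrightarrow> c \<in> X"
proof
  assume "b \<in> X" then show "c \<in> X" using loc_subset[OF X] c by blast
next
  assume cX: "c \<in> X"
  obtain g where g: "g \<in> S" "c = power_act K g b" using c by (rule L_orbit)
  then have gc: "\<forall>i<n. g i \<in> carrier (grp K)" by (simp add: S_def)
  have "L \<subseteq> {x \<in> tuples (univ K) (replicate n Cover). power_act K g x \<in> X}"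
    using b cX g by (intro loc_subset closed_over_power_act[OF X base gc]) auto
  then have "power_act K g (power_act K (\<lambda>i. inv\<^bsub>grp K\<^esub> (g i)) b) \<in> X"
    using S_inv_L[OF g(1) mem_loc] by blast
  then show "b \<in> X" using power_act_inv(1)[OF b gc] by simp
qed

lemma same_type: "c \<in> L \<Longrightarrow> same_type_over K A (replicate n Cover) b c"
  using b L_tuples same_closed_sets by (intro same_type_overI) auto

lemma atom: "atom_over K A (replicate n Cover) L"
  unfolding atom_over_def
proof
  show "definable_over K A (replicate n Cover) L"
    by (rule definable_closed_over[OF closed_over_loc[OF b]])
  show "\<forall>x\<in>L. \<forall>y\<in>L. same_type_over K A (replicate n Cover) x y"
    using same_type unfolding same_type_over_def by blast
qed

end

section \<open>The kernel of the projection to an independent tuple\<close>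

lemma same_type_over_definable:
  assumes "same_type_over Z A \<sigma> x y" "definable_over Z A \<sigma> X" "x \<in> X" "y \<in> tuples (univ Z) \<sigma>"
  shows "y \<in> X"
proof -
  obtain \<phi> where "formula_over Z A \<sigma> \<phi>" "X = solutions Z \<sigma> \<phi>"
    using assms(2) unfolding definable_over_def by (elim exE conjE) (rule that)
  then show ?thesis using assms unfolding same_type_over_def solutions_def by blast
qed

lemma set_tuples_replicate: "a \<in> tuples D (replicate n s) \<Longrightarrow> set a \<subseteq> D s"
  by (auto simp: tuples_iff in_set_conv_nth)

context rcover
begin

text \<open>The hypothesis on powers of \<open>G\<close> is used for the first power, whose elements
  are functions on a one-element set; \<open>N'\<close> is \<open>N\<close> in this guise.\<close>

lemma normal_subgroup_definable:
  assumes st: "standing_assumptions K"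
    and N: "N \<lhd> grp K" "definable_over K UNIV (grp_sig K) N"
  shows "definable_over K {} (grp_sig K) N"
proof -
  interpret G: group "grp K" by (rule group_grp)
  interpret N: normal N "grp K" by (rule N(1))
  define P where "P = grp_power K 1"
  define N' where "N' = {f \<in> carrier P. f 0 \<in> N}"
  have gP: "group P" unfolding P_def grp_power_def by (rule product_group) (rule group_grp)
  interpret P: group P by (rule gP)
  have carrier: "carrier P = ({..<1} \<rightarrow>\<^sub>E carrier (grp K))" by (simp add: P_def grp_power_def)
  have f0: "f 0 \<in> carrier (grp K)" if "f \<in> carrier P" for f
    using that unfolding carrier by auto
  have mult: "(f \<otimes>\<^bsub>P\<^esub> h) 0 = f 0 \<otimes>\<^bsub>grp K\<^esub> h 0" for f h
    by (simp add: P_def grp_power_def)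
  have one: "\<one>\<^bsub>P\<^esub> 0 = \<one>\<^bsub>grp K\<^esub>" by (simp add: P_def grp_power_def)
  have inv: "(inv\<^bsub>P\<^esub> f) 0 = inv\<^bsub>grp K\<^esub> (f 0)" if "f \<in> carrier P" for f
  proof -
    have "inv\<^bsub>P\<^esub> f = (\<lambda>i\<in>{..<1}. inv\<^bsub>grp K\<^esub> f i)"
      unfolding P_def grp_power_def by (intro inv_product_group that[unfolded carrier] group_grp)
    then show ?thesis by simp
  qed
  have "subgroup N' P"
  proof (rule P.subgroupI)
    show "N' \<noteq> {}" using P.one_closed one N.one_closed unfolding N'_def by auto
  qed (auto simp: N'_def mult inv)
  then have "N' \<lhd> P"
    unfolding P.normal_inv_iff by (auto simp: N'_def mult inv f0 N.inv_op_closed2)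
  have img: "(\<lambda>g. concat (map g [0..<1])) ` N' = N"
  proof (intro equalityI subsetI)
    fix x assume x: "x \<in> N"
    have "(\<lambda>i\<in>{..<1}. x) \<in> N'" using x N.subset by (auto simp: N'_def carrier)
    moreover have "concat (map (\<lambda>i\<in>{..<1}. x) [0..<1]) = x" by simp
    ultimately show "x \<in> (\<lambda>g. concat (map g [0..<1])) ` N'" by (metis imageI)
  qed (auto simp: N'_def)
  have "power_definable_over K UNIV 1 N'"
    unfolding power_definable_over_def img using N(2) by simp
  then have "power_definable_over K {} 1 N'"
    using st \<open>N' \<lhd> P\<close> unfolding standing_assumptions_def P_def by blast
  then show ?thesis unfolding power_definable_over_def img by simp
qed

text \<open>\<open>kernel_at b1 c\<close> is the kernel of the projection of the stabiliser of the locus of \<open>(b1, c)\<close> to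
  the coordinates of \<open>b1\<close>.\<close>

definition kernel_at :: "'a list \<Rightarrow> 'a \<Rightarrow> 'a list set" where
  "kernel_at b1 c = {h \<in> carrier (grp K).
    b1 @ [act K h c] \<in> loc K (univ K Base) (replicate (length b1 + 1) Cover) (b1 @ [c])}"

text \<open>An arbitrary \<open>x\<close> in \<open>G\<close> occurs as the last coordinate of some
  \<open>r\<close> in the stabiliser. Conjugation by \<open>r\<close> preserves the kernel and acts
  on it as conjugation by \<open>x\<close>.\<close>

lemma kernel_at_normal:
  assumes st: "standing_assumptions K"
    and b1: "b1 \<in> tuples (univ K) (replicate n Cover)" and c: "c \<in> univ K Cover"
  shows "kernel_at b1 c \<lhd> grp K"
proof -
  let ?D = "univ K" and ?b = "b1 @ [c]" and ?B = "univ K Base"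
  have len: "length b1 = n" using length_tuples[OF b1] by simp
  have sig: "replicate (n + 1) Cover = replicate n Cover @ [Cover]" by (simp add: replicate_append_same)
  have bT: "?b \<in> tuples ?D (replicate (n + 1) Cover)"
    unfolding sig using b1 c by (intro append_in_tuplesI) auto
  interpret locus K ?B "n + 1" ?b
    by unfold_locales (rule order_refl, rule bT)
  interpret G: group "grp K" by (rule group_grp)
  \<comment> \<open>The embedding of \<open>G\<close> as the last factor: coordinates are counted
    from 0, so the last one has index \<open>n\<close>.\<close>
  define e where "e h = (\<lambda>j::nat. if j < n then \<one>\<^bsub>grp K\<^esub> else h)" for h
  have act_e: "power_act K (e h) ?b = b1 @ [act K h c]" for h
    using b1 len
    by (intro nth_equalityI) (auto simp: power_act_def e_def nth_append tuples_iff act_one less_Suc_eq)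
  have ker: "h \<in> kernel_at b1 c \<longleftrightarrow> h \<in> carrier (grp K) \<and> e h \<in> S" for h
    unfolding kernel_at_def S_def using act_e[of h] len by (auto simp: e_def)
  have sub: "subgroup (kernel_at b1 c) (grp K)"
  proof (rule G.subgroupI)
    show "kernel_at b1 c \<subseteq> carrier (grp K)" by (auto simp: kernel_at_def)
    have "e \<one>\<^bsub>grp K\<^esub> \<in> S" using S_cong[OF S_one] by (simp add: e_def)
    then show "kernel_at b1 c \<noteq> {}" using ker by blast
  next
    fix h assume h: "h \<in> kernel_at b1 c"
    then have "e h \<in> S" using ker by blast
    from S_cong[OF S_inv[OF this], of "e (inv\<^bsub>grp K\<^esub> h)"]
    show "inv\<^bsub>grp K\<^esub> h \<in> kernel_at b1 c" using h ker by (simp add: e_def)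
  next
    fix h h' assume h: "h \<in> kernel_at b1 c" "h' \<in> kernel_at b1 c"
    then have "e h \<in> S" "e h' \<in> S" using ker by blast+
    from S_cong[OF S_mult[OF this], of "e (h \<otimes>\<^bsub>grp K\<^esub> h')"]
    show "h \<otimes>\<^bsub>grp K\<^esub> h' \<in> kernel_at b1 c" using h ker by (simp add: e_def)
  qed
  have last: "\<exists>r\<in>S. r n = x" if x: "x \<in> carrier (grp K)" for x
  proof -
    \<comment> \<open>This projection of the locus is definable over \<open>M\<close> but not known
      to be closed; the atom hypothesis applies as it concerns all definable sets. As
      \<open>?Y\<close> contains \<open>c\<close>, it contains the whole fibre of
      \<open>c\<close>.\<close>
    let ?Y = "{y \<in> tuples ?D [Cover]. \<exists>z\<in>tuples ?D (replicate n Cover). z @ y \<in> L}"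
    have "definable_over K ?B (replicate n Cover @ [Cover]) L"
      using definable_closed_over[OF closed_over_loc[OF b]] unfolding sig .
    then have dY: "definable_over K ?B [Cover] ?Y" by (rule definable_over_Ex)
    have cY: "[c] \<in> ?Y" using b1 c mem_loc[of ?b] by auto
    let ?m = "proj K c"
    have "?m \<in> ?B" using regular c unfolding regular_cover_def by blast
    then have at: "atom_over K ?B [Cover] {[x] | x. x \<in> ?D Cover \<and> proj K x = ?m}"
      using st unfolding standing_assumptions_def by blast
    have xc: "act K x c \<in> ?D Cover" using x c by (rule act_closed)
    moreover have "proj K (act K x c) = ?m" using proj_eq_iff[OF c xc] x by blast
    ultimately have "same_type_over K ?B [Cover] [c] [act K x c]"
      using at c unfolding atom_over_def by blast
    then have "[act K x c] \<in> ?Y"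
      using same_type_over_definable[OF _ dY cY] xc by simp
    then obtain z where z: "z \<in> tuples ?D (replicate n Cover)" "z @ [act K x c] \<in> L" by blast
    obtain r where r: "r \<in> S" "z @ [act K x c] = power_act K r ?b" using L_orbit[OF z(2)] by blast
    have "(z @ [act K x c]) ! n = act K x c" using length_tuples[OF z(1)] by (simp add: nth_append)
    moreover have "power_act K r ?b ! n = act K (r n) c" using len by (simp add: power_act_def nth_append)
    ultimately have "act K (r n) c = act K x c" using r(2) by simp
    moreover have "r n \<in> carrier (grp K)" using r(1) unfolding S_def by simp
    ultimately have "r n = x" using act_cancel x c by blast
    then show ?thesis using r(1) by blast
  qed
  show ?thesis unfolding G.normal_inv_iff
  proof (intro conjI ballI sub)
    fix x h assume x: "x \<in> carrier (grp K)" and h: "h \<in> kernel_at b1 c"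
    obtain r where r: "r \<in> S" "r n = x" using last[OF x] by blast
    then have rc: "\<forall>i<n. r i \<in> carrier (grp K)" unfolding S_def by auto
    have "e h \<in> S" "h \<in> carrier (grp K)" using h ker by blast+
    \<comment> \<open>In the first \<open>n\<close> coordinates the conjugate of \<open>e h\<close>
      by \<open>r\<close> is the identity, whatever \<open>r\<close> is there.\<close>
    from S_cong[OF S_mult[OF S_mult[OF r(1) this(1)] S_inv[OF r(1)]],
        of "e (x \<otimes>\<^bsub>grp K\<^esub> h \<otimes>\<^bsub>grp K\<^esub> inv\<^bsub>grp K\<^esub> x)"]
    show "x \<otimes>\<^bsub>grp K\<^esub> h \<otimes>\<^bsub>grp K\<^esub> inv\<^bsub>grp K\<^esub> x \<in> kernel_at b1 c"
      using x h ker r(2) rc \<open>h \<in> carrier (grp K)\<close> by (simp add: e_def less_Suc_eq)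
  qed
qed

text \<open>Parameters are unrestricted here: almost simplicity and the hypothesis on normal
  subgroups both accept subgroups definable over the whole structure, and the latter then removes
  the parameters.\<close>

lemma kernel_at_definable:
  assumes b1: "b1 \<in> tuples (univ K) (replicate n Cover)" and c: "c \<in> univ K Cover"
  shows "definable_over K UNIV (grp_sig K) (kernel_at b1 c)"
proof -
  let ?D = "univ K" and ?l = "grp_len K" and ?\<sigma> = "[Cover] @ grp_sig K"
  let ?\<Gamma> = "{g @ [x, act K g x] | g x. g \<in> carrier (grp K) \<and> x \<in> univ K Cover}"
  define Q where "Q = loc K (univ K Base) (replicate (n + 1) Cover) (b1 @ [c])"
  have len: "length b1 = n" using length_tuples[OF b1] by simp
  have sig: "replicate (n + 1) Cover = replicate n Cover @ [Cover]" by (simp add: replicate_append_same)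
  have bT: "b1 @ [c] \<in> tuples ?D (replicate (n + 1) Cover)"
    unfolding sig using b1 c by (intro append_in_tuplesI) auto
  have dQ: "definable_over K UNIV (replicate (n + 1) Cover) Q"
    unfolding Q_def using definable_closed_over[OF closed_over_loc[OF bT]] by (rule definable_over_mono) simp
  have d\<Gamma>: "definable_over K UNIV (grp_sig K @ [Cover, Cover]) ?\<Gamma>"
    using definable_act_graph by (rule definable_over_mono) simp
  let ?ts = "vars 1 ?l @ map Const [c] @ vars 0 1" and ?us = "map Const b1 @ vars 0 1"
  have v: "list_all2 (tm_has_sort ?D ?\<sigma>) (vars 0 1) [Cover]" by (rule vars_sorted) auto
  have "list_all2 (tm_has_sort ?D ?\<sigma>) ?ts (grp_sig K @ [Cover] @ [Cover])"
    using c by (intro list_all2_appendI v vars_sorted) (auto simp: Const_sorted)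
  then have s1: "list_all2 (tm_has_sort ?D ?\<sigma>) ?ts (grp_sig K @ [Cover, Cover])" by simp
  have s2: "list_all2 (tm_has_sort ?D ?\<sigma>) ?us (replicate (n + 1) Cover)"
    unfolding sig using b1 by (intro list_all2_appendI v) (simp add: Const_sorted)
  define E where "E = {w \<in> tuples ?D ?\<sigma>. map (tm_val w) ?ts \<in> ?\<Gamma>} \<inter> {w \<in> tuples ?D ?\<sigma>. map (tm_val w) ?us \<in> Q}"
  have "definable_over K UNIV ?\<sigma> E"
    unfolding E_def by (intro definable_over_Int definable_over_subst[OF d\<Gamma> s1] definable_over_subst[OF dQ s2]) auto
  from definable_over_Ex[OF this]
  have "definable_over K UNIV (grp_sig K) {g \<in> tuples ?D (grp_sig K). \<exists>y\<in>tuples ?D [Cover]. y @ g \<in> E}" .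
  moreover have "(\<exists>y\<in>tuples ?D [Cover]. y @ g \<in> E) \<longleftrightarrow> g \<in> kernel_at b1 c"
    if g: "g \<in> tuples ?D (grp_sig K)" for g
  proof -
    have lg: "length g = ?l" using length_tuples[OF g] by simp
    have E: "[y] @ g \<in> E \<longleftrightarrow> g @ [c, y] \<in> ?\<Gamma> \<and> b1 @ [y] \<in> Q" if "y \<in> ?D Cover" for y
      using that g lg by (simp add: E_def map_tm_val_vars)
    have \<Gamma>: "g @ [c, y] \<in> ?\<Gamma> \<longleftrightarrow> g \<in> carrier (grp K) \<and> y = act K g c" for y
      using c by auto
    have ker: "g \<in> kernel_at b1 c \<longleftrightarrow> g \<in> carrier (grp K) \<and> b1 @ [act K g c] \<in> Q"
      unfolding kernel_at_def Q_def len by simp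
    have "(\<exists>y\<in>tuples ?D [Cover]. y @ g \<in> E) \<longleftrightarrow> (\<exists>y\<in>?D Cover. [y] @ g \<in> E)"
      by (auto simp: tuples_Cons)
    also have "\<dots> \<longleftrightarrow> (\<exists>y\<in>?D Cover. g \<in> carrier (grp K) \<and> y = act K g c \<and> b1 @ [y] \<in> Q)"
      by (rule bex_cong[OF refl]) (simp only: E \<Gamma> conj_assoc)
    also have "\<dots> \<longleftrightarrow> g \<in> kernel_at b1 c"
      unfolding ker using act_closed[OF _ c] by auto
    finally show ?thesis .
  qed
  then have "{g \<in> tuples ?D (grp_sig K). \<exists>y\<in>tuples ?D [Cover]. y @ g \<in> E} = kernel_at b1 c"
    using grp_subset_tuples by (auto simp: kernel_at_def)
  ultimately show ?thesis by simp
qed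

text \<open>
  If the kernel were everything, the locus of \<open>(b1, c)\<close> would contain \<open>(b1, y)\<close> for all \<open>y\<close> in the
  fibre of \<open>c\<close>. This is a property of the type of \<open>b1\<close>, shared by the whole fibre of \<open>b1\<close>.
\<close>

lemma kernel_at_proper:
  assumes b1: "b1 \<in> tuples (univ K) (replicate n Cover)" and c: "c \<in> univ K Cover"
    and si: "strongly_independent K U b1" and nsi: "\<not> strongly_independent K {} (b1 @ [c])"
  shows "kernel_at b1 c \<noteq> carrier (grp K)"
proof
  assume all: "kernel_at b1 c = carrier (grp K)"
  let ?D = "univ K" and ?b = "b1 @ [c]" and ?B = "univ K Base" and ?\<sigma> = "replicate n Cover"
  have len: "length b1 = n" using length_tuples[OF b1] by simp
  have sig: "replicate (n + 1) Cover = ?\<sigma> @ [Cover]" by (simp add: replicate_append_same)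
  have bT: "?b \<in> tuples ?D (replicate (n + 1) Cover)"
    unfolding sig using b1 c by (intro append_in_tuplesI) auto
  define Q where "Q = loc K ?B (replicate (n + 1) Cover) ?b"
  have dQ: "definable_over K ?B (replicate (n + 1) Cover) Q"
    unfolding Q_def by (rule definable_closed_over[OF closed_over_loc[OF bT]])
  have QF: "Q \<subseteq> {d \<in> tuples ?D (replicate (n + 1) Cover). map (proj K) d = map (proj K) ?b}"
    unfolding Q_def by (rule loc_subset[OF closed_over_fibre[OF order_refl bT]]) (use bT in simp)
  have inQ: "b1 @ [y] \<in> Q" if y: "y \<in> ?D Cover" "proj K y = proj K c" for y
  proof -
    obtain g where "g \<in> carrier (grp K)" "y = act K g c" using proj_eq_iff[OF c y(1)] y(2) by blast
    then show ?thesis using all len unfolding kernel_at_def Q_def by auto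
  qed
  let ?F = "{y \<in> tuples ?D (replicate 1 Cover). map (proj K) y = map (proj K) [c]}"
  have dF: "definable_over K ?B (replicate 1 Cover) ?F"
    using c by (intro definable_closed_over closed_over_fibre) auto
  let ?ts = "vars 1 n @ vars 0 1"
  have v: "list_all2 (tm_has_sort ?D ([Cover] @ ?\<sigma>)) (vars 0 1) [Cover]" by (rule vars_sorted) auto
  have s2: "list_all2 (tm_has_sort ?D ([Cover] @ ?\<sigma>)) ?ts (replicate (n + 1) Cover)"
    unfolding sig by (intro list_all2_appendI v vars_sorted) auto
  have s1: "list_all2 (tm_has_sort ?D ([Cover] @ ?\<sigma>)) (vars 0 1) (replicate 1 Cover)" using v by simp
  \<comment> \<open>Pairs violating the property: \<open>y\<close> in the fibre of \<open>c\<close>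
    with \<open>z @ [y]\<close> outside \<open>Q\<close>. The \<open>z\<close> without such a
    \<open>y\<close> form \<open>?X\<close>, definable over \<open>M\<close>.\<close>
  define E where "E = {w \<in> tuples ?D ([Cover] @ ?\<sigma>). map (tm_val w) (vars 0 1) \<in> ?F} -
    {w \<in> tuples ?D ([Cover] @ ?\<sigma>). map (tm_val w) ?ts \<in> Q}"
  have E: "[y] @ z \<in> E \<longleftrightarrow> proj K y = proj K c \<and> z @ [y] \<notin> Q"
    if "y \<in> ?D Cover" "z \<in> tuples ?D ?\<sigma>" for y z
    using that length_tuples[OF that(2)] by (simp add: E_def map_tm_val_vars del: map_map)
  have "definable_over K ?B ([Cover] @ ?\<sigma>) E"
    unfolding E_def
    by (intro definable_over_Diff definable_over_subst[OF dF s1] definable_over_subst[OF dQ s2])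
      (auto simp: vars_def)
  from definable_over_Compl[OF definable_over_Ex[OF this]]
  have dX: "definable_over K ?B ?\<sigma> (tuples ?D ?\<sigma> - {z \<in> tuples ?D ?\<sigma>. \<exists>y\<in>tuples ?D [Cover]. y @ z \<in> E})"
    (is "definable_over K ?B ?\<sigma> ?X") .
  have X: "z \<in> ?X \<longleftrightarrow> (\<forall>y\<in>?D Cover. proj K y = proj K c \<longrightarrow> z @ [y] \<in> Q)" if "z \<in> tuples ?D ?\<sigma>" for z
  proof -
    have "z \<in> ?X \<longleftrightarrow> (\<forall>y\<in>?D Cover. [y] @ z \<notin> E)" using that by (auto simp: tuples_Cons)
    then show ?thesis using E[OF _ that] by auto
  qed
  have "b1 \<in> ?X" unfolding X[OF b1] using inQ by blast
  \<comment> \<open>Strong independence makes the whole fibre of \<open>b1\<close> the locus of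
    \<open>b1\<close> over \<open>M\<close> and \<open>U\<close>. All its points then have the type
    of \<open>b1\<close> over these parameters, and so lie in \<open>?X\<close> with it.\<close>
  interpret b1: locus K "?B \<union> U" n b1 using b1 by unfold_locales auto
  have "{d \<in> tuples ?D (replicate (n + 1) Cover). map (proj K) d = map (proj K) ?b} \<subseteq> Q"
  proof
    fix d assume d: "d \<in> {d \<in> tuples ?D (replicate (n + 1) Cover). map (proj K) d = map (proj K) ?b}"
    then have "d \<in> tuples ?D (?\<sigma> @ [Cover])" unfolding sig by blast
    then obtain z y where zy: "d = z @ y" "z \<in> tuples ?D ?\<sigma>" "y \<in> tuples ?D [Cover]"
      by (rule tuples_appendE)
    then obtain y' where y: "y = [y']" "y' \<in> ?D Cover" by (auto simp: tuples_Cons)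
    have "map (proj K) z = map (proj K) b1" "proj K y' = proj K c" using d unfolding zy y by auto
    then have "z \<in> b1.L"
      using si zy(2) unfolding strongly_independent_def len by simp
    then have "z \<in> ?X"
      using same_type_over_definable[OF b1.same_type definable_over_mono[OF dX] \<open>b1 \<in> ?X\<close> zy(2)] by simp
    then show "d \<in> Q" unfolding X[OF zy(2)] zy(1) y(1) using y(2) \<open>proj K y' = proj K c\<close> by blast
  qed
  then have "strongly_independent K {} ?b"
    using QF unfolding strongly_independent_def Q_def by (simp add: len)
  then show False using nsi by blast
qed

section \<open>The finite group and the formula\<close>

lemma concat_in_tuples:
  "\<forall>i<k. g i \<in> tuples D (replicate l s) \<Longrightarrow> concat (map g [0..<k]) \<in> tuples D (replicate (k * l) s)"
proof (induction k)
  case (Suc k)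
  have "replicate (Suc k * l) s = replicate (k * l) s @ replicate l s"
    by (simp flip: replicate_add add: add.commute)
  then show ?case using Suc by (simp add: append_in_tuplesI)
qed simp

theorem locus_is_finite_orbit:
  assumes st: "standing_assumptions K"
    and b1: "b1 \<in> tuples (univ K) (replicate n Cover)"
    and b2: "b2 \<in> tuples (univ K) (replicate k Cover)"
    and si: "strongly_independent K U b1"
    and nsi: "\<forall>i<k. \<not> strongly_independent K {} (b1 @ [b2 ! i])"
  shows "\<exists>Hs H \<phi>.
    (\<forall>i<k. Hs i \<lhd> grp K \<and> finite (Hs i) \<and> definable_over K {} (grp_sig K) (Hs i)) \<and>
    subgroup H (product_group {..<k} (\<lambda>i. (grp K)\<lparr>carrier := Hs i\<rparr>)) \<and>
    power_definable_over K {} k H \<and>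
    formula_over K (U \<union> univ K Base) (replicate n Cover @ replicate k Cover) \<phi> \<and>
    pos_qf \<phi> \<and>
    sat (univ K) \<phi> (b1 @ b2) \<and>
    (\<lambda>h. power_act K h b2) ` H =
      {c \<in> tuples (univ K) (replicate k Cover). sat (univ K) \<phi> (b1 @ c)} \<and>
    atom_over K (univ K Base \<union> set b1 \<union> U) (replicate k Cover)
      {c \<in> tuples (univ K) (replicate k Cover). sat (univ K) \<phi> (b1 @ c)}"
proof -
  let ?D = "univ K" and ?B = "univ K Base" and ?G = "carrier (grp K)"
  define A where "A = ?B \<union> set b1 \<union> U"
  interpret locus K A k b2 using b2 by unfold_locales (auto simp: A_def)
  interpret G: group "grp K" by (rule group_grp)
  have len: "length b1 = n" using length_tuples[OF b1] by simp
  \<comment> \<open>The kernels come from loci over \<open>M\<close> alone, where the atom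
    hypothesis on the fibres applies, whereas \<open>L\<close> is a locus over the larger
    \<open>A\<close>. \<open>S_Hs\<close> relates the two.\<close>
  define Hs where "Hs i = kernel_at b1 (b2 ! i)" for i
  have b2i: "b2 ! i \<in> ?D Cover" if "i < k" for i using b2 that by (auto simp: tuples_iff)
  have Hs: "Hs i \<lhd> grp K \<and> finite (Hs i) \<and> definable_over K {} (grp_sig K) (Hs i)" if i: "i < k" for i
  proof -
    have n: "Hs i \<lhd> grp K" unfolding Hs_def by (rule kernel_at_normal[OF st b1 b2i[OF i]])
    have d: "definable_over K UNIV (grp_sig K) (Hs i)"
      unfolding Hs_def by (rule kernel_at_definable[OF b1 b2i[OF i]])
    have "Hs i \<noteq> ?G" unfolding Hs_def using kernel_at_proper[OF b1 b2i[OF i] si] nsi i by blast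
    then have "finite (Hs i)"
      using st n d unfolding standing_assumptions_def definably_almost_simple_def by blast
    then show ?thesis using n d normal_subgroup_definable[OF st n d] by blast
  qed
  \<comment> \<open>That \<open>(b1, y_i)\<close> lies in the locus of \<open>(b1, b2_i)\<close>
    over \<open>M\<close> is a condition on \<open>y\<close> closed over \<open>M\<close> and
    \<open>b1\<close>. It holds at \<open>b2\<close>, hence on all of \<open>L\<close>.\<close>
  have S_Hs: "g i \<in> Hs i" if g: "g \<in> S" and i: "i < k" for g i
  proof -
    let ?Q = "loc K ?B (replicate (n + 1) Cover) (b1 @ [b2 ! i])"
    have sig: "replicate (n + 1) Cover = replicate n Cover @ [Cover]" by (simp add: replicate_append_same)
    have bT: "b1 @ [b2 ! i] \<in> tuples ?D (replicate (n + 1) Cover)"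
      unfolding sig using b1 b2i[OF i] by (intro append_in_tuplesI) auto
    let ?ts = "map Const b1 @ vars i 1"
    have "list_all2 (tm_has_sort ?D (replicate k Cover)) ?ts (replicate (n + 1) Cover)"
      unfolding sig using b1 i by (intro list_all2_appendI vars_sorted) (auto simp: Const_sorted)
    moreover have "(\<Union>t\<in>set ?ts. tm_params t) \<subseteq> A \<union> (\<Union>s. named K s)" by (auto simp: vars_def A_def)
    moreover have "closed_over K A (replicate (n + 1) Cover) ?Q"
      by (rule closed_over_mono[OF closed_over_loc[OF bT]]) (auto simp: A_def)
    ultimately have cl: "closed_over K A (replicate k Cover)
        {y \<in> tuples ?D (replicate k Cover). map (tm_val y) ?ts \<in> ?Q}"
      by (intro closed_over_subst)
    have val: "map (tm_val y) ?ts = b1 @ [y ! i]" if "y \<in> tuples ?D (replicate k Cover)" for y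
      using length_tuples[OF that] i by (simp add: map_tm_val_vars take_Suc hd_drop_conv_nth)
    have "L \<subseteq> {y \<in> tuples ?D (replicate k Cover). map (tm_val y) ?ts \<in> ?Q}"
      by (rule loc_subset[OF cl]) (use b2 val mem_loc in simp)
    moreover have gL: "power_act K g b2 \<in> L" using g by (simp add: S_def)
    ultimately have "map (tm_val (power_act K g b2)) ?ts \<in> ?Q" by blast
    then have "b1 @ [power_act K g b2 ! i] \<in> ?Q" using val[of "power_act K g b2"] gL L_tuples by auto
    moreover have "power_act K g b2 ! i = act K (g i) (b2 ! i)"
      using i length_tuples[OF b2] by (simp add: power_act_def)
    ultimately show ?thesis using g i len by (simp add: Hs_def kernel_at_def S_def)
  qed
  \<comment> \<open>Elements of the product group are extensional functions, so each class of
    functions in \<open>S\<close> agreeing below \<open>k\<close> is represented once.\<close>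
  define H where "H = S \<inter> extensional {..<k}"
  let ?P = "product_group {..<k} (\<lambda>i. (grp K)\<lparr>carrier := Hs i\<rparr>)"
  have sub: "subgroup (Hs i) (grp K)" if "i < k" for i using Hs[OF that] G.normal_inv_iff by blast
  have HP: "H \<subseteq> ({..<k} \<rightarrow>\<^sub>E \<Union>(Hs ` {..<k}))" "H \<subseteq> carrier ?P"
    using S_Hs by (auto simp: H_def PiE_iff extensional_def)
  have "subgroup H ?P"
  proof
    show "H \<subseteq> carrier ?P" by (rule HP(2))
  next
    fix f h assume fh: "f \<in> H" "h \<in> H"
    then have "(\<lambda>i. f i \<otimes>\<^bsub>grp K\<^esub> h i) \<in> S" using S_mult by (simp add: H_def)
    from S_cong[OF this, of "\<lambda>i\<in>{..<k}. f i \<otimes>\<^bsub>grp K\<^esub> h i"]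
    show "f \<otimes>\<^bsub>?P\<^esub> h \<in> H" by (simp add: H_def)
  next
    from S_cong[OF S_one, of "\<lambda>i\<in>{..<k}. \<one>\<^bsub>grp K\<^esub>"]
    show "\<one>\<^bsub>?P\<^esub> \<in> H" by (simp add: H_def)
  next
    fix f assume f: "f \<in> H"
    have "inv\<^bsub>?P\<^esub> f = (\<lambda>i\<in>{..<k}. inv\<^bsub>(grp K)\<lparr>carrier := Hs i\<rparr>\<^esub> f i)"
      using f HP(2) sub by (intro inv_product_group) (auto intro: G.subgroup_imp_group)
    also have "\<dots> = (\<lambda>i\<in>{..<k}. inv\<^bsub>grp K\<^esub> f i)"
      using f S_Hs sub by (intro restrict_ext G.m_inv_consistent) (auto simp: H_def)
    finally have eq: "inv\<^bsub>?P\<^esub> f = (\<lambda>i\<in>{..<k}. inv\<^bsub>grp K\<^esub> f i)" .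
    have "(\<lambda>i. inv\<^bsub>grp K\<^esub> f i) \<in> S" using f S_inv by (simp add: H_def)
    from S_cong[OF this, of "\<lambda>i\<in>{..<k}. inv\<^bsub>grp K\<^esub> f i"]
    show "inv\<^bsub>?P\<^esub> f \<in> H" unfolding eq by (simp add: H_def)
  qed
  moreover have "power_definable_over K {} k H"
    unfolding power_definable_over_def
  \<comment> \<open>\<open>H\<close> need not be normal, so the hypothesis on normal subgroups is
    not applied to it; it is listed as a finite set of tuples with named entries.\<close>
  proof (rule definable_over_finite)
    have "finite ({..<k} \<rightarrow>\<^sub>E \<Union>(Hs ` {..<k}))" using Hs by (intro finite_PiE) auto
    then show "finite ((\<lambda>g. concat (map g [0..<k])) ` H)" using HP(1) finite_subset by blast
    show "(\<lambda>g. concat (map g [0..<k])) ` H \<subseteq> tuples ?D (replicate (k * grp_len K) Base)"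
    proof (rule image_subsetI, rule concat_in_tuples)
      fix g assume "g \<in> H"
      then show "\<forall>i<k. g i \<in> tuples ?D (grp_sig K)"
        using grp_subset_tuples by (auto simp: H_def S_def)
    qed
    show "\<forall>a\<in>(\<lambda>g. concat (map g [0..<k])) ` H. set a \<subseteq> {} \<union> (\<Union>s. named K s)"
    proof (rule ballI, elim imageE)
      fix a g assume g: "g \<in> H" and a: "a = concat (map g [0..<k])"
      have "set (g i) \<subseteq> (\<Union>s. named K s)" if i: "i < k" for i
      proof (rule finite_definable_named)
        show "base_prime_model_named K" using st unfolding standing_assumptions_def by blast
        show "definable_over K {} (grp_sig K) (Hs i)" "finite (Hs i)" using Hs[OF i] by blast+
        show "g i \<in> Hs i" using S_Hs g i by (simp add: H_def)
      qed
      then show "set a \<subseteq> {} \<union> (\<Union>s. named K s)" unfolding a by (simp add: UN_subset_iff)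
    qed
  qed
  \<comment> \<open>\<open>L\<close> is a fibre of one predicate \<open>P\<close> at parameters from
    \<open>A\<close> and the named elements. To have a formula over \<open>U\<close> and
    \<open>M\<close>, the parameters occurring in \<open>b1\<close> must become variables.\<close>
  moreover have "\<exists>\<phi>. formula_over K (U \<union> ?B) (replicate n Cover @ replicate k Cover) \<phi> \<and> pos_qf \<phi> \<and>
      (\<forall>c\<in>tuples ?D (replicate k Cover). sat ?D \<phi> (b1 @ c) \<longleftrightarrow> c \<in> L)"
  proof -
    obtain \<rho> a P where a: "a \<in> tuples ?D \<rho>" "set a \<subseteq> A \<union> (\<Union>s. named K s)"
      and P: "P \<in> rels K (\<rho> @ replicate k Cover)"
      and LP: "L = {x \<in> tuples ?D (replicate k Cover). a @ x \<in> P}"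
      by (rule closed_over_abstract[OF closed_over_loc[OF b]])
    have "\<forall>x\<in>set b1. \<exists>i. i < n \<and> b1 ! i = x" using len by (auto simp: in_set_conv_nth)
    from bchoice[OF this] obtain pos where pos: "\<forall>x\<in>set b1. pos x < n \<and> b1 ! pos x = x"
      by (elim exE) (rule that)
    \<comment> \<open>\<open>pos x\<close> is some position of \<open>x\<close> in
      \<open>b1\<close>, so evaluating at \<open>b1 @ c\<close> restores the parameter. A parameter
      not in \<open>b1\<close> stays a constant; it lies in \<open>U\<close> or \<open>M\<close> or
      is named.\<close>
    define v where "v x = (if x \<in> set b1 then Var (pos x) else Const x)" for x
    let ?\<sigma> = "replicate n Cover @ replicate k Cover" and ?ts = "map v a @ vars n k"
    let ?\<phi> = "Rel (\<rho> @ replicate k Cover) P ?ts"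
    have "tm_has_sort ?D ?\<sigma> (v (a ! j)) (\<rho> ! j)" if j: "j < length \<rho>" for j
    proof (cases "a ! j \<in> set b1")
      case True
      have "a ! j \<in> ?D (\<rho> ! j)" using a(1) j by (auto simp: tuples_iff)
      moreover have "a ! j \<in> ?D Cover" using True set_tuples_replicate[OF b1] by blast
      \<comment> \<open>The variable put in has sort \<open>Cover\<close>; by disjointness of the
        sorts this is the sort that \<open>P\<close> expects.\<close>
      ultimately have "\<rho> ! j = Cover" by (rule sort_unique)
      then show ?thesis using True pos by (simp add: v_def nth_append trans_less_add1)
    next
      case False
      then show ?thesis using a(1) j by (auto simp: v_def tuples_iff)
    qed
    then have "list_all2 (tm_has_sort ?D ?\<sigma>) (map v a) \<rho>"
      using length_tuples[OF a(1)] by (simp add: list_all2_conv_all_nth)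
    then have "list_all2 (tm_has_sort ?D ?\<sigma>) ?ts (\<rho> @ replicate k Cover)"
      by (intro list_all2_appendI vars_sorted) auto
    moreover have "params ?\<phi> \<subseteq> (U \<union> ?B) \<union> (\<Union>s. named K s)"
      using a(2) by (auto simp: v_def vars_def A_def split: if_splits)
    ultimately have "formula_over K (U \<union> ?B) ?\<sigma> ?\<phi>" using P by (simp add: formula_over_def)
    moreover have "sat ?D ?\<phi> (b1 @ c) \<longleftrightarrow> c \<in> L" if c: "c \<in> tuples ?D (replicate k Cover)" for c
    proof -
      have "map (tm_val (b1 @ c)) (map v a) = a"
        unfolding map_map by (rule map_idI) (use pos len in \<open>auto simp: v_def nth_append\<close>)
      moreover have "map (tm_val (b1 @ c)) (vars n k) = c"
        using length_tuples[OF c] len by (simp add: map_tm_val_vars)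
      ultimately have "map (tm_val (b1 @ c)) ?ts = a @ c" by (simp only: map_append)
      then show ?thesis unfolding sat.simps LP using c by simp
    qed
    ultimately show ?thesis by (intro exI[of _ ?\<phi>]) simp
  qed
  then obtain \<phi> where \<phi>: "formula_over K (U \<union> ?B) (replicate n Cover @ replicate k Cover) \<phi>" "pos_qf \<phi>"
    and sat: "\<forall>c\<in>tuples ?D (replicate k Cover). sat ?D \<phi> (b1 @ c) \<longleftrightarrow> c \<in> L"
    by (elim exE conjE) (rule that)
  have sol: "{c \<in> tuples ?D (replicate k Cover). sat ?D \<phi> (b1 @ c)} = L"
    using sat L_tuples by blast
  have orb: "(\<lambda>h. power_act K h b2) ` H = L"
  proof (intro equalityI subsetI)
    fix x assume "x \<in> L"
    then obtain g where g: "g \<in> S" "x = power_act K g b2" by (rule L_orbit)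
    have "power_act K (restrict g {..<k}) b2 = power_act K g b2"
      using length_tuples[OF b2] by (simp add: power_act_def)
    moreover have "restrict g {..<k} \<in> H" using S_cong[OF g(1), of "restrict g {..<k}"] by (simp add: H_def)
    ultimately show "x \<in> (\<lambda>h. power_act K h b2) ` H" using g(2) by (metis imageI)
  qed (auto simp: H_def S_def)
  have "sat ?D \<phi> (b1 @ b2)" using sat b2 mem_loc by blast
  moreover have "atom_over K (?B \<union> set b1 \<union> U) (replicate k Cover) L" using atom unfolding A_def .
  ultimately show ?thesis
    using Hs \<phi> by (intro exI[of _ Hs] exI[of _ H] exI[of _ \<phi>]) (simp add: sol orb)
qed

end

theorem theorem3p11:
  fixes K :: "'a cover" and U :: "'a set" and n k :: nat and b1 b2 :: "'a list"
  assumes "regular_cover K"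
    and "standing_assumptions K"
    and "U \<subseteq> univ K Cover"
    and "b1 \<in> tuples (univ K) (replicate n Cover)"
    and "b2 \<in> tuples (univ K) (replicate k Cover)"
    and "strongly_independent K U b1"
    and "\<forall>i<k. \<not> strongly_independent K {} (b1 @ [b2 ! i])"
  shows "\<exists>Hs H \<phi>.
    (\<forall>i<k. Hs i \<lhd> grp K \<and> finite (Hs i) \<and> definable_over K {} (grp_sig K) (Hs i)) \<and>
    subgroup H (product_group {..<k} (\<lambda>i. (grp K)\<lparr>carrier := Hs i\<rparr>)) \<and>
    power_definable_over K {} k H \<and>
    formula_over K (U \<union> univ K Base) (replicate n Cover @ replicate k Cover) \<phi> \<and>
    pos_qf \<phi> \<and>
    sat (univ K) \<phi> (b1 @ b2) \<and>
    (\<lambda>h. power_act K h b2) ` H =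
      {c \<in> tuples (univ K) (replicate k Cover). sat (univ K) \<phi> (b1 @ c)} \<and>
    atom_over K (univ K Base \<union> set b1 \<union> U) (replicate k Cover)
      {c \<in> tuples (univ K) (replicate k Cover). sat (univ K) \<phi> (b1 @ c)}"
proof -
  interpret rcover K using assms(1) by unfold_locales
  show ?thesis using assms(2,4-7) by (rule locus_is_finite_orbit)
qed

end
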